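(* Let $X\subset\mathbb{P}^4$ (homogeneous coordinates $(x:y:z:w:t)$, over $\mathbb{C}$) be the quintic threefold with equation $$7m_{(5,0,0,0,0)}-5m_{(4,1,0,0,0)}-2m_{(3,2,0,0,0)}+4m_{(3,1,1,0,0)}+2m_{(2,2,1,0,0)}-4m_{(2,1,1,1,0)}+8m_{(1,1,1,1,1)}=0,$$ where $m_\alpha=m_\alpha(x,y,z,w,t)$ denotes the monomial symmetric polynomial. Among the sections of $X$ by tangent hyperplanes $H\subset \mathbb{P}^4$ there are quintic surfaces $X\cap H\subset H\cong\mathbb{P}^3$ with singular set of each of the following types: $$17\mathsf{A}_2,\qquad 16\mathsf{A}_2,\qquad 15\mathsf{A}_2+\mathsf{A}_3,\qquad 15\mathsf{A}_2+\mathsf{D}_4.$$ Moreover, the hyperplane section of $X$ by $3x-13y-13z+7w+7t=0$ has singular set $17\mathsf{A}_2$.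
   Context: All varieties are over $\mathbb{C}$. For $\alpha=(\alpha_1,\dots,\alpha_5)$, $m_{\alpha}(x,y,z,w,t)$ is the sum of all distinct monomials $x^{\beta_1}y^{\beta_2}z^{\beta_3}w^{\beta_4}t^{\beta_5}$ with $(\beta_1,\dots,\beta_5)$ a permutation of $\alpha$. A tangent hyperplane of $X$ is a hyperplane equal to the projective tangent space of $X$ at some smooth point of $X$. "Singular set $n\mathsf{A}_2+\cdots$" means that the singular points of the surface are exactly $n$ singularities of type $\mathsf{A}_2$ (ordinary cusps) together with one singularity of each further type listed, where $\mathsf{A}_k$, $\mathsf{D}_k$ denote the usual rational double points (ADE surface singularities). *)

theory Defs
  imports "HOL-Analysis.Analysis" "HOL-Library.Multiset"
begin

section \<open>Monomial symmetric polynomials and the quintic threefold\<close>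

text \<open>The inner set collects the distinct rearrangements of the exponent vector, so every monomial
  is counted once. The coordinates \<open>(x, y, z, w, t)\<close> are \<open>v $ 1, \<dots>, v $ 5\<close>, which agrees with
  the library notation \<open>vector [x, y, z, w, t]\<close> (in the numeral type \<open>5\<close> one has \<open>5 = 0\<close>).\<close>

definition monomial_sym :: "nat ^ 'n \<Rightarrow> complex ^ 'n \<Rightarrow> complex" where
  "monomial_sym \<alpha> v =
     (\<Sum>\<beta> \<in> {(\<chi> i. \<alpha> $ \<pi> i) | \<pi>. bij \<pi>}. \<Prod>i\<in>UNIV. (v $ i) ^ (\<beta> $ i))"

definition quintic :: "complex ^ 5 \<Rightarrow> complex" where
  "quintic v =
       7 * monomial_sym (vector [5,0,0,0,0]) v
     - 5 * monomial_sym (vector [4,1,0,0,0]) v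
     - 2 * monomial_sym (vector [3,2,0,0,0]) v
     + 4 * monomial_sym (vector [3,1,1,0,0]) v
     + 2 * monomial_sym (vector [2,2,1,0,0]) v
     - 4 * monomial_sym (vector [2,1,1,1,0]) v
     + 8 * monomial_sym (vector [1,1,1,1,1]) v"

section \<open>Hyperplanes and tangent hyperplanes\<close>

definition partial_deriv :: "'n \<Rightarrow> (complex ^ 'n \<Rightarrow> complex) \<Rightarrow> complex ^ 'n \<Rightarrow> complex" where
  "partial_deriv i f v = deriv (\<lambda>s. f (v + s *s axis i 1)) 0"

definition gradient :: "(complex ^ 'n \<Rightarrow> complex) \<Rightarrow> complex ^ 'n \<Rightarrow> complex ^ 'n" where
  "gradient f v = (\<chi> i. partial_deriv i f v)"

text \<open>A projective hyperplane is represented by the linear hyperplane lying over it; the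
  coefficient vector is meant to be nonzero.\<close>

definition hyperplane :: "complex ^ 'n \<Rightarrow> (complex ^ 'n) set" where
  "hyperplane a = {v. (\<Sum>i\<in>UNIV. a $ i * v $ i) = 0}"

definition tangent_hyperplane :: "(complex ^ 'n \<Rightarrow> complex) \<Rightarrow> (complex ^ 'n) set \<Rightarrow> bool" where
  "tangent_hyperplane F H \<longleftrightarrow>
     (\<exists>p. p \<noteq> 0 \<and> F p = 0 \<and> gradient F p \<noteq> 0 \<and> H = hyperplane (gradient F p))"

section \<open>Isomorphism of hypersurface germs and rational double points\<close>

text \<open>Holomorphy in several variables: complex differentiability at every point of an open set.\<close>

definition holo_on :: "(complex ^ 'n \<Rightarrow> complex) \<Rightarrow> (complex ^ 'n) set \<Rightarrow> bool" where
  "holo_on f U \<longleftrightarrow>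
     (\<forall>x\<in>U. \<exists>a :: complex ^ 'n. (f has_derivative (\<lambda>h. \<Sum>i\<in>UNIV. a $ i * h $ i)) (at x))"

definition holo_map_on ::
  "(complex ^ 'n \<Rightarrow> complex ^ 'm) \<Rightarrow> (complex ^ 'n) set \<Rightarrow> bool" where
  "holo_map_on \<phi> U \<longleftrightarrow> (\<forall>j. holo_on (\<lambda>x. \<phi> x $ j) U)"

definition biholomorphic_between ::
  "(complex ^ 'n) set \<Rightarrow> (complex ^ 'n) set \<Rightarrow> (complex ^ 'n \<Rightarrow> complex ^ 'n) \<Rightarrow> bool" where
  "biholomorphic_between U V \<phi> \<longleftrightarrow> open U \<and> open V \<and> holo_map_on \<phi> U \<and>
     (\<exists>\<psi>. holo_map_on \<psi> V \<and> homeomorphism U V \<phi> \<psi>)"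

text \<open>Isomorphism of the complex space germs at the origin defined by \<open>f\<close> and \<open>g\<close>: up to a local
  change of coordinates, \<open>f\<close> and \<open>g\<close> generate the same ideal, i.e. differ by a unit \<open>u\<close>.\<close>

definition germ_iso :: "(complex ^ 'n \<Rightarrow> complex) \<Rightarrow> (complex ^ 'n \<Rightarrow> complex) \<Rightarrow> bool" where
  "germ_iso f g \<longleftrightarrow>
     (\<exists>U V \<phi> u. 0 \<in> U \<and> biholomorphic_between U V \<phi> \<and> \<phi> 0 = 0 \<and>
        holo_on u U \<and> (\<forall>x\<in>U. u x \<noteq> 0 \<and> f x = u x * g (\<phi> x)))"

text \<open>The index is meant to satisfy \<open>k \<ge> 1\<close> for type A and \<open>k \<ge> 4\<close> for type D.\<close>

datatype sing_type = Type_A nat | Type_D nat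

fun normal_form :: "sing_type \<Rightarrow> complex ^ 3 \<Rightarrow> complex" where
  "normal_form (Type_A k) v = (v $ 1) ^ 2 + (v $ 2) ^ 2 + (v $ 3) ^ (k + 1)"
| "normal_form (Type_D k) v = (v $ 1) ^ 2 + (v $ 2) ^ 2 * v $ 3 + (v $ 3) ^ (k - 1)"

section \<open>Singular points of hyperplane sections\<close>

text \<open>Points of projective space are the lines through the origin of \<open>\<complex>\<^sup>5\<close>. If \<open>p, b 1, b 2, b 3\<close>
  is a basis of the four-dimensional space \<open>H\<close> (automatic when they span it), then
  \<open>x \<mapsto> [p + x\<^sub>1 b\<^sub>1 + x\<^sub>2 b\<^sub>2 + x\<^sub>3 b\<^sub>3]\<close> is an affine chart of the projective space \<open>\<P>(H)\<close> centred
  at \<open>[p]\<close>, and \<open>f\<close> below is the equation of the section \<open>{F = 0} \<inter> H\<close> in this chart.\<close>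

definition local_equation ::
  "(complex ^ 5 \<Rightarrow> complex) \<Rightarrow> (complex ^ 5) set \<Rightarrow> (complex ^ 5) set \<Rightarrow>
     (complex ^ 3 \<Rightarrow> complex) \<Rightarrow> bool" where
  "local_equation F H P f \<longleftrightarrow>
     (\<exists>p (b :: 3 \<Rightarrow> complex ^ 5). P = vec.span {p} \<and> vec.span (insert p (range b)) = H \<and>
        f = (\<lambda>x. F (p + (\<Sum>i\<in>UNIV. x $ i *s b i))))"

definition section_sing ::
  "(complex ^ 5 \<Rightarrow> complex) \<Rightarrow> (complex ^ 5) set \<Rightarrow> (complex ^ 5) set set" where
  "section_sing F H = {P. \<exists>f. local_equation F H P f \<and> f 0 = 0 \<and> gradient f 0 = 0}"

definition has_sing_type ::
  "(complex ^ 5 \<Rightarrow> complex) \<Rightarrow> (complex ^ 5) set \<Rightarrow> (complex ^ 5) set \<Rightarrow> sing_type \<Rightarrow> bool" where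
  "has_sing_type F H P T \<longleftrightarrow> (\<exists>f. local_equation F H P f \<and> germ_iso f (normal_form T))"

definition has_singular_set ::
  "(complex ^ 5 \<Rightarrow> complex) \<Rightarrow> (complex ^ 5) set \<Rightarrow> sing_type multiset \<Rightarrow> bool" where
  "has_singular_set F H M \<longleftrightarrow>
     finite (section_sing F H) \<and>
     (\<exists>\<tau>. (\<forall>P \<in> section_sing F H. has_sing_type F H P (\<tau> P)) \<and>
          image_mset \<tau> (mset_set (section_sing F H)) = M)"

end

theory Submission
  imports Defs
begin

text \<open>Written in the elementary symmetric functions e1, ..., e5 of the coordinates, the
  equation of X is 128 e5 - 64 e4 e1 - 64 e3 e2 + 48 e3 e1^2 + 48 e2^2 e1 - 40 e2 e1^3 + 7 e1^5. The
  i-th partial derivative at v is then the value at v_i of a single quartic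
  \<open>grad_poly v\<close>, whose coefficients involve only e1, ..., e4. Every condition on the
  gradient becomes a condition on the values of one quartic at the five coordinates.

  Singular locus of X. If the gradient vanishes, all coordinates are roots of a quartic, so two of
  them agree, and elimination forces v onto one of the 15 lines v_i = 0, v_j = v_k, v_l = v_m
  (\<open>singular_quintic_on_cusp_line\<close>). Conversely X is singular along these lines, and
  away from their intersection points it is transversally an ordinary cusp. A hyperplane that avoids
  the intersection points therefore cuts the lines in 15 distinct points, each of type A_2 on the
  section (\<open>inj_on_span_cusp_point\<close>, \<open>has_sing_type_cusp_point\<close>).

  Remaining singular points. A point of the hyperplane with coefficient vector a is singular on the
  section exactly when the gradient there is l a for some scalar l. The case l = 0 gives the 15
  cusps; l nonzero gives the points where the hyperplane is tangent to X at a smooth point.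
  \<open>has_singular_setI\<close> turns this into a recipe: exhibit the points of tangency,
  determine their types, and show that there are no others.

  The recipe is applied to four hyperplanes. The given one, (3,-13,-13,7,7), is tangent at
  (0,2,-2,1,-1) and (0,2,-2,-1,1), both A_2. With q = sqrt 3, the hyperplane (-8,-8,1,6+3q,6-3q) is
  tangent at (9,9,0,6+4q,6-4q), again A_2. With r = sqrt 13 there are two more, one with two pairs
  of equal coefficients and an A_3, and one with three equal coefficients (and k = sqrt(-3)) and a
  D_4.

  Completeness of the list of tangency points (\<open>tangent_points_17A2\<close> and its analogues)
  is elimination theory: coordinates with equal coefficients in a take equal values under the
  quartic, so they either coincide or satisfy divided difference equations in their symmetric
  functions. In each case an explicit polynomial identity (\<open>tangency_17A2_distinct\<close> and
  its analogues) shows that l times a power of the desired relation vanishes.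

  Local types come from explicit charts. The local equation is rewritten exactly as a quadratic form
  in adapted coordinates plus a higher power (\<open>germ_iso_type_A\<close>), or as a square plus a
  binary cubic with one removable mixed term (\<open>germ_iso_type_D4\<close>); square and cube
  roots of units and the inverse function theorem then give the biholomorphism to the normal
  form.\<close>

section \<open>Monomial symmetric polynomials in five variables\<close>

lemma exhaust_5: fixes x :: 5 shows "x = 1 \<or> x = 2 \<or> x = 3 \<or> x = 4 \<or> x = 5"
proof (induct x)
  case (of_int z)
  then have "0 \<le> z" and "z < 5" by simp_all
  then have "z = 0 \<or> z = 1 \<or> z = 2 \<or> z = 3 \<or> z = 4" by arith
  then show ?case by auto
qed

lemma forall_5: "(\<forall>i::5. P i) \<longleftrightarrow> P 1 \<and> P 2 \<and> P 3 \<and> P 4 \<and> P 5"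
  by (metis exhaust_5)

lemma UNIV_5: "UNIV = {1, 2, 3, 4, 5::5}"
  using exhaust_5 by auto

lemma sum_5: "sum f (UNIV::5 set) = f 1 + f 2 + f 3 + f 4 + f 5"
  unfolding UNIV_5 by (simp add: ac_simps)

lemma prod_5: "prod f (UNIV::5 set) = f 1 * f 2 * f 3 * f 4 * f 5"
  unfolding UNIV_5 by (simp add: ac_simps)

lemma vector_5 [simp]:
  "(vector [x,y,z,w,t] :: 'a::zero^5) $ 1 = x"
  "(vector [x,y,z,w,t] :: 'a::zero^5) $ 2 = y"
  "(vector [x,y,z,w,t] :: 'a::zero^5) $ 3 = z"
  "(vector [x,y,z,w,t] :: 'a::zero^5) $ 4 = w"
  "(vector [x,y,z,w,t] :: 'a::zero^5) $ 5 = t"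
  unfolding vector_def by simp_all

lemma bij_5_iff: "bij (\<pi> :: 5 \<Rightarrow> 5) \<longleftrightarrow> distinct [\<pi> 1, \<pi> 2, \<pi> 3, \<pi> 4, \<pi> 5]"
proof -
  have "bij \<pi> \<longleftrightarrow> inj \<pi>"
    by (metis bij_def finite_UNIV_inj_surj finite)
  also have "\<dots> \<longleftrightarrow> (\<forall>i j. \<pi> i = \<pi> j \<longrightarrow> i = j)"
    by (auto simp: inj_def)
  also have "\<dots> \<longleftrightarrow> distinct [\<pi> 1, \<pi> 2, \<pi> 3, \<pi> 4, \<pi> 5]"
    unfolding forall_5 by auto
  finally show ?thesis .
qed

lemma sum_bij_5:
  fixes h :: "5 \<Rightarrow> 5 \<Rightarrow> 5 \<Rightarrow> 5 \<Rightarrow> 5 \<Rightarrow> 'b::comm_monoid_add"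
  shows "(\<Sum>\<pi> | bij (\<pi>::5\<Rightarrow>5). h (\<pi> 1) (\<pi> 2) (\<pi> 3) (\<pi> 4) (\<pi> 5)) =
    (\<Sum>a\<in>UNIV. \<Sum>b\<in>UNIV-{a}. \<Sum>c\<in>UNIV-{a,b}. \<Sum>d\<in>UNIV-{a,b,c}. \<Sum>e\<in>UNIV-{a,b,c,d}. h a b c d e)"
proof -
  let ?T = "SIGMA a:UNIV. SIGMA b:UNIV-{a}. SIGMA c:UNIV-{a,b}. SIGMA d:UNIV-{a,b,c}. UNIV-{a,b,c,d}"
  let ?j = "\<lambda>\<pi>::5\<Rightarrow>5. (\<pi> 1, \<pi> 2, \<pi> 3, \<pi> 4, \<pi> 5)"
  let ?k = "\<lambda>(a,b,c,d,e) (i::5). if i = 1 then a else if i = 2 then b else if i = 3 then c else if i = 4 then d else (e::5)"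
  have "bij_betw ?j {\<pi>. bij \<pi>} ?T"
  proof (rule bij_betwI[where g = ?k])
    show "?j \<in> {\<pi>. bij \<pi>} \<rightarrow> ?T" by (auto simp: bij_5_iff)
    show "?k \<in> ?T \<rightarrow> {\<pi>. bij \<pi>}" by (auto simp: bij_5_iff)
    show "?k (?j \<pi>) = \<pi>" for \<pi> using exhaust_5 by fastforce
    show "?j (?k y) = y" for y by (auto split: prod.splits)
  qed
  then have "(\<Sum>\<pi> | bij (\<pi>::5\<Rightarrow>5). h (\<pi> 1) (\<pi> 2) (\<pi> 3) (\<pi> 4) (\<pi> 5)) = (\<Sum>(a,b,c,d,e)\<in>?T. h a b c d e)"
    using sum.reindex_bij_betw[of ?j _ ?T "\<lambda>(a,b,c,d,e). h a b c d e"] by simp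
  also have "\<dots> = (\<Sum>a\<in>UNIV. \<Sum>b\<in>UNIV-{a}. \<Sum>c\<in>UNIV-{a,b}. \<Sum>d\<in>UNIV-{a,b,c}. \<Sum>e\<in>UNIV-{a,b,c,d}. h a b c d e)"
    by (simp add: sum.Sigma split_def)
  finally show ?thesis .
qed

text \<open>Orbit-stabilizer: each rearrangement of \<open>\<alpha>\<close> arises from as many
  permutations as fix \<open>\<alpha>\<close>. The sum over distinct rearrangements, awkward to
  enumerate, is thereby traded for a sum over all permutations.\<close>

lemma card_stabilizer_monomial_sym:
  fixes \<alpha> :: "nat ^ 'n"
  shows "of_nat (card {\<rho>. bij \<rho> \<and> (\<forall>i. \<alpha> $ \<rho> i = \<alpha> $ i)}) * monomial_sym \<alpha> v =
    (\<Sum>\<pi> | bij \<pi>. \<Prod>i\<in>UNIV. (v $ i) ^ (\<alpha> $ \<pi> i))"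
proof -
  let ?r = "\<lambda>\<pi>::'n\<Rightarrow>'n. \<chi> i. \<alpha> $ \<pi> i"
  let ?S = "{\<rho>. bij \<rho> \<and> (\<forall>i. \<alpha> $ \<rho> i = \<alpha> $ i)}"
  have fib: "card {\<pi>. bij \<pi> \<and> ?r \<pi> = \<beta>} = card ?S" if \<beta>: "\<beta> \<in> ?r ` {\<pi>. bij \<pi>}" for \<beta>
  proof -
    obtain \<sigma> where s: "bij \<sigma>" "\<beta> = ?r \<sigma>" using \<beta> by auto
    \<comment> \<open>The fibre over a rearrangement is a coset of the stabilizer.\<close>
    have "bij_betw (\<lambda>\<rho>. \<rho> \<circ> \<sigma>) ?S {\<pi>. bij \<pi> \<and> ?r \<pi> = \<beta>}"
    proof (rule bij_betwI[where g = "\<lambda>\<pi>. \<pi> \<circ> inv \<sigma>"])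
      show "(\<lambda>\<rho>. \<rho> \<circ> \<sigma>) \<in> ?S \<rightarrow> {\<pi>. bij \<pi> \<and> ?r \<pi> = \<beta>}"
        using s by (auto simp: bij_comp vec_eq_iff)
      show "(\<lambda>\<pi>. \<pi> \<circ> inv \<sigma>) \<in> {\<pi>. bij \<pi> \<and> ?r \<pi> = \<beta>} \<rightarrow> ?S"
        using s by (auto simp: bij_comp bij_imp_bij_inv vec_eq_iff bij_is_surj surj_f_inv_f)
      show "(\<rho> \<circ> \<sigma>) \<circ> inv \<sigma> = \<rho>" for \<rho> :: "'n \<Rightarrow> 'n"
        using s by (simp add: fun_eq_iff bij_is_surj surj_f_inv_f)
      show "(\<pi> \<circ> inv \<sigma>) \<circ> \<sigma> = \<pi>" for \<pi> :: "'n \<Rightarrow> 'n"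
        using s by (simp add: fun_eq_iff bij_is_inj)
    qed
    then show ?thesis by (simp add: bij_betw_same_card)
  qed
  have "(\<Sum>\<pi> | bij \<pi>. \<Prod>i\<in>UNIV. (v $ i) ^ (\<alpha> $ \<pi> i)) = 
     (\<Sum>\<beta>\<in>?r ` {\<pi>. bij \<pi>}. \<Sum>\<pi> | \<pi> \<in> {\<pi>. bij \<pi>} \<and> ?r \<pi> = \<beta>. \<Prod>i\<in>UNIV. (v $ i) ^ (\<alpha> $ \<pi> i))"
    by (rule sum.image_gen) simp
  also have "\<dots> = (\<Sum>\<beta>\<in>?r ` {\<pi>. bij \<pi>}. \<Sum>\<pi> | bij \<pi> \<and> ?r \<pi> = \<beta>. \<Prod>i\<in>UNIV. (v $ i) ^ (\<beta> $ i))"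
    by (intro sum.cong refl) auto
  also have "\<dots> = (\<Sum>\<beta>\<in>?r ` {\<pi>. bij \<pi>}. of_nat (card ?S) * (\<Prod>i\<in>UNIV. (v $ i) ^ (\<beta> $ i)))"
    by (intro sum.cong refl) (simp add: fib)
  also have "\<dots> = of_nat (card ?S) * monomial_sym \<alpha> v"
    unfolding monomial_sym_def sum_distrib_left
    by (rule sum.cong) auto
  finally show ?thesis by simp
qed

lemma sum_monomials_5:
  "(\<Sum>\<pi> | bij (\<pi>::5\<Rightarrow>5). \<Prod>i\<in>UNIV. (v $ i) ^ (vector [a,b,c,d,e] $ (\<pi> i :: 5))) =
   (\<Sum>\<pi> | bij (\<pi>::5\<Rightarrow>5). v $ \<pi> 1 ^ a * v $ \<pi> 2 ^ b * v $ \<pi> 3 ^ c * v $ \<pi> 4 ^ d * (v $ \<pi> 5 ^ e :: complex))"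
proof -
  have "(\<Sum>\<pi> | bij (\<pi>::5\<Rightarrow>5). \<Prod>i\<in>UNIV. (v $ i) ^ (vector [a,b,c,d,e] $ (\<pi> i :: 5))) =
    (\<Sum>\<pi> | bij (\<pi>::5\<Rightarrow>5). \<Prod>i\<in>UNIV. (v $ i) ^ (vector [a,b,c,d,e] $ (inv \<pi> i :: 5)))"
    by (rule sum.reindex_bij_witness[where i = inv and j = inv])
       (auto simp: bij_imp_bij_inv inv_inv_eq)
  also have "\<dots> = (\<Sum>\<pi> | bij (\<pi>::5\<Rightarrow>5). \<Prod>i\<in>UNIV. (v $ \<pi> i) ^ (vector [a,b,c,d,e] $ i))"
  proof (intro sum.cong refl)
    fix \<pi> :: "5 \<Rightarrow> 5" assume "\<pi> \<in> {\<pi>. bij \<pi>}"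
    then have b: "bij \<pi>" by simp
    show "(\<Prod>i\<in>UNIV. (v $ i) ^ (vector [a,b,c,d,e] $ (inv \<pi> i))) = (\<Prod>i\<in>UNIV. (v $ \<pi> i) ^ (vector [a,b,c,d,e] $ i))"
      using prod.reindex_bij_betw[OF b, of "\<lambda>i. (v $ i) ^ (vector [a,b,c,d,e] $ (inv \<pi> i))"] b
      by (simp add: bij_is_inj)
  qed
  finally show ?thesis by (simp add: prod_5)
qed

lemma sums_over_5:
  fixes f :: "5 \<Rightarrow> 'b::comm_monoid_add"
  shows "(\<Sum>x\<in>UNIV-A. f x) = (if 1 \<in> A then 0 else f 1) + (if 2 \<in> A then 0 else f 2) + (if 3 \<in> A then 0 else f 3)
    + (if 4 \<in> A then 0 else f 4) + (if 5 \<in> A then 0 else f 5)"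
proof -
  have "(\<Sum>x\<in>UNIV-A. f x) = (\<Sum>x\<in>UNIV. if x \<in> A then 0 else f x)"
    by (rule sum.mono_neutral_cong_left) auto
  then show ?thesis by (simp add: sum_5)
qed

text \<open>The order of the stabilizer is itself written as a 0/1 sum over permutations, so that
  both sides can be evaluated by the same unrolling into nested sums over distinct indices.\<close>

lemma monomial_sym_5:
  "of_nat (\<Sum>\<pi> | bij (\<pi>::5\<Rightarrow>5). if vector [a,b,c,d,e] $ \<pi> 1 = a \<and> vector [a,b,c,d,e] $ \<pi> 2 = b \<and> vector [a,b,c,d,e] $ \<pi> 3 = c
     \<and> vector [a,b,c,d,e] $ \<pi> 4 = d \<and> vector [a,b,c,d,e] $ \<pi> 5 = e then 1 else 0)
    * monomial_sym (vector [a,b,c,d,e] :: nat^5) v =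
   (\<Sum>\<pi> | bij (\<pi>::5\<Rightarrow>5). v $ \<pi> 1 ^ a * v $ \<pi> 2 ^ b * v $ \<pi> 3 ^ c * v $ \<pi> 4 ^ d * v $ \<pi> 5 ^ e)"
  unfolding sum_monomials_5[symmetric] card_stabilizer_monomial_sym[symmetric]
  by (simp add: forall_5 sum.If_cases Collect_conj_eq[symmetric])


lemmas monomial_sym_5_nested = monomial_sym_5[unfolded
  sum_bij_5[of "\<lambda>p q r s t. (v $ p) ^ a * (v $ q) ^ b * (v $ r) ^ c * (v $ s) ^ d * (v $ t :: complex) ^ e" for v :: "complex^5" and a b c d e]
  sum_bij_5[of "\<lambda>p q r s t. if (w::nat^5) $ p = a \<and> w $ q = b \<and> w $ r = c \<and> w $ s = d \<and> w $ t = e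
    then 1 else (0::nat)" for w a b c d e]]

text \<open>Used as a congruence rule: it keeps the simplifier out of a summand until the index set
  has been expanded, so nested sums unroll from the outside in.\<close>

lemma sum_weak_cong: "A = B \<Longrightarrow> sum f A = sum f B"
  by simp

section \<open>The quintic in elementary symmetric functions and its gradient\<close>

definition el1 :: "complex^5 \<Rightarrow> complex" where
  "el1 v = v $ 1 + v $ 2 + v $ 3 + v $ 4 + v $ 5"
definition el2 :: "complex^5 \<Rightarrow> complex" where
  "el2 v = v $ 1 * v $ 2 + v $ 1 * v $ 3 + v $ 1 * v $ 4 + v $ 1 * v $ 5 + v $ 2 * v $ 3 + v $ 2 * v $ 4 + v $ 2 * v $ 5 + v $ 3 * v $ 4 + v $ 3 * v $ 5 + v $ 4 * v $ 5"
definition el3 :: "complex^5 \<Rightarrow> complex" where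
  "el3 v = v $ 1 * v $ 2 * v $ 3 + v $ 1 * v $ 2 * v $ 4 + v $ 1 * v $ 2 * v $ 5 + v $ 1 * v $ 3 * v $ 4 + v $ 1 * v $ 3 * v $ 5 + v $ 1 * v $ 4 * v $ 5 + v $ 2 * v $ 3 * v $ 4 + v $ 2 * v $ 3 * v $ 5 + v $ 2 * v $ 4 * v $ 5 + v $ 3 * v $ 4 * v $ 5"
definition el4 :: "complex^5 \<Rightarrow> complex" where
  "el4 v = v $ 1 * v $ 2 * v $ 3 * v $ 4 + v $ 1 * v $ 2 * v $ 3 * v $ 5 + v $ 1 * v $ 2 * v $ 4 * v $ 5 + v $ 1 * v $ 3 * v $ 4 * v $ 5 + v $ 2 * v $ 3 * v $ 4 * v $ 5"
definition el5 :: "complex^5 \<Rightarrow> complex" where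
  "el5 v = v $ 1 * v $ 2 * v $ 3 * v $ 4 * v $ 5"

lemma monomial_sym_50000:
  "monomial_sym (vector [5,0,0,0,0]) (v::complex^5) = v $ 1 ^ 5 + v $ 2 ^ 5 + v $ 3 ^ 5 + v $ 4 ^ 5 + v $ 5 ^ 5"
  using monomial_sym_5_nested[of 5 0 0 0 0 v]
  by (simp add: sums_over_5 sum_5 cong: sum_weak_cong; algebra)

lemma monomial_sym_41000:
  "monomial_sym (vector [4,1,0,0,0]) (v::complex^5) = v $ 1 ^ 4 * v $ 2 + v $ 1 ^ 4 * v $ 3 + v $ 1 ^ 4 * v $ 4 + v $ 1 ^ 4 * v $ 5 + v $ 1 * v $ 2 ^ 4 + v $ 1 * v $ 3 ^ 4 + v $ 1 * v $ 4 ^ 4 + v $ 1 * v $ 5 ^ 4 + v $ 2 ^ 4 * v $ 3 + v $ 2 ^ 4 * v $ 4 + v $ 2 ^ 4 * v $ 5 + v $ 2 * v $ 3 ^ 4 + v $ 2 * v $ 4 ^ 4 + v $ 2 * v $ 5 ^ 4 + v $ 3 ^ 4 * v $ 4 + v $ 3 ^ 4 * v $ 5 + v $ 3 * v $ 4 ^ 4 + v $ 3 * v $ 5 ^ 4 + v $ 4 ^ 4 * v $ 5 + v $ 4 * v $ 5 ^ 4"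
  using monomial_sym_5_nested[of 4 1 0 0 0 v]
  by (simp add: sums_over_5 sum_5 cong: sum_weak_cong; algebra)

lemma monomial_sym_32000:
  "monomial_sym (vector [3,2,0,0,0]) (v::complex^5) = v $ 1 ^ 3 * v $ 2 ^ 2 + v $ 1 ^ 3 * v $ 3 ^ 2 + v $ 1 ^ 3 * v $ 4 ^ 2 + v $ 1 ^ 3 * v $ 5 ^ 2 + v $ 1 ^ 2 * v $ 2 ^ 3 + v $ 1 ^ 2 * v $ 3 ^ 3 + v $ 1 ^ 2 * v $ 4 ^ 3 + v $ 1 ^ 2 * v $ 5 ^ 3 + v $ 2 ^ 3 * v $ 3 ^ 2 + v $ 2 ^ 3 * v $ 4 ^ 2 + v $ 2 ^ 3 * v $ 5 ^ 2 + v $ 2 ^ 2 * v $ 3 ^ 3 + v $ 2 ^ 2 * v $ 4 ^ 3 + v $ 2 ^ 2 * v $ 5 ^ 3 + v $ 3 ^ 3 * v $ 4 ^ 2 + v $ 3 ^ 3 * v $ 5 ^ 2 + v $ 3 ^ 2 * v $ 4 ^ 3 + v $ 3 ^ 2 * v $ 5 ^ 3 + v $ 4 ^ 3 * v $ 5 ^ 2 + v $ 4 ^ 2 * v $ 5 ^ 3"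
  using monomial_sym_5_nested[of 3 2 0 0 0 v]
  by (simp add: sums_over_5 sum_5 cong: sum_weak_cong; algebra)

lemma monomial_sym_31100:
  "monomial_sym (vector [3,1,1,0,0]) (v::complex^5) = v $ 1 ^ 3 * v $ 2 * v $ 3 + v $ 1 ^ 3 * v $ 2 * v $ 4 + v $ 1 ^ 3 * v $ 2 * v $ 5 + v $ 1 ^ 3 * v $ 3 * v $ 4 + v $ 1 ^ 3 * v $ 3 * v $ 5 + v $ 1 ^ 3 * v $ 4 * v $ 5 + v $ 1 * v $ 2 ^ 3 * v $ 3 + v $ 1 * v $ 2 ^ 3 * v $ 4 + v $ 1 * v $ 2 ^ 3 * v $ 5 + v $ 1 * v $ 2 * v $ 3 ^ 3 + v $ 1 * v $ 2 * v $ 4 ^ 3 + v $ 1 * v $ 2 * v $ 5 ^ 3 + v $ 1 * v $ 3 ^ 3 * v $ 4 + v $ 1 * v $ 3 ^ 3 * v $ 5 + v $ 1 * v $ 3 * v $ 4 ^ 3 + v $ 1 * v $ 3 * v $ 5 ^ 3 + v $ 1 * v $ 4 ^ 3 * v $ 5 + v $ 1 * v $ 4 * v $ 5 ^ 3 + v $ 2 ^ 3 * v $ 3 * v $ 4 + v $ 2 ^ 3 * v $ 3 * v $ 5 + v $ 2 ^ 3 * v $ 4 * v $ 5 + v $ 2 * v $ 3 ^ 3 * v $ 4 + v $ 2 * v $ 3 ^ 3 * v $ 5 + v $ 2 * v $ 3 * v $ 4 ^ 3 + v $ 2 * v $ 3 * v $ 5 ^ 3 + v $ 2 * v $ 4 ^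 3 * v $ 5 + v $ 2 * v $ 4 * v $ 5 ^ 3 + v $ 3 ^ 3 * v $ 4 * v $ 5 + v $ 3 * v $ 4 ^ 3 * v $ 5 + v $ 3 * v $ 4 * v $ 5 ^ 3"
  using monomial_sym_5_nested[of 3 1 1 0 0 v]
  by (simp add: sums_over_5 sum_5 cong: sum_weak_cong; algebra)

lemma monomial_sym_22100:
  "monomial_sym (vector [2,2,1,0,0]) (v::complex^5) = v $ 1 ^ 2 * v $ 2 ^ 2 * v $ 3 + v $ 1 ^ 2 * v $ 2 ^ 2 * v $ 4 + v $ 1 ^ 2 * v $ 2 ^ 2 * v $ 5 + v $ 1 ^ 2 * v $ 2 * v $ 3 ^ 2 + v $ 1 ^ 2 * v $ 2 * v $ 4 ^ 2 + v $ 1 ^ 2 * v $ 2 * v $ 5 ^ 2 + v $ 1 ^ 2 * v $ 3 ^ 2 * v $ 4 + v $ 1 ^ 2 * v $ 3 ^ 2 * v $ 5 + v $ 1 ^ 2 * v $ 3 * v $ 4 ^ 2 + v $ 1 ^ 2 * v $ 3 * v $ 5 ^ 2 + v $ 1 ^ 2 * v $ 4 ^ 2 * v $ 5 + v $ 1 ^ 2 * v $ 4 * v $ 5 ^ 2 + v $ 1 * v $ 2 ^ 2 * v $ 3 ^ 2 + v $ 1 * v $ 2 ^ 2 * v $ 4 ^ 2 + v $ 1 * v $ 2 ^ 2 * v $ 5 ^ 2 + v $ 1 * v $ 3 ^ 2 * v $ 4 ^ 2 + v $ 1 * v $ 3 ^ 2 * v $ 5 ^ 2 + v $ 1 * v $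 4 ^ 2 * v $ 5 ^ 2 + v $ 2 ^ 2 * v $ 3 ^ 2 * v $ 4 + v $ 2 ^ 2 * v $ 3 ^ 2 * v $ 5 + v $ 2 ^ 2 * v $ 3 * v $ 4 ^ 2 + v $ 2 ^ 2 * v $ 3 * v $ 5 ^ 2 + v $ 2 ^ 2 * v $ 4 ^ 2 * v $ 5 + v $ 2 ^ 2 * v $ 4 * v $ 5 ^ 2 + v $ 2 * v $ 3 ^ 2 * v $ 4 ^ 2 + v $ 2 * v $ 3 ^ 2 * v $ 5 ^ 2 + v $ 2 * v $ 4 ^ 2 * v $ 5 ^ 2 + v $ 3 ^ 2 * v $ 4 ^ 2 * v $ 5 + v $ 3 ^ 2 * v $ 4 * v $ 5 ^ 2 + v $ 3 * v $ 4 ^ 2 * v $ 5 ^ 2"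
  using monomial_sym_5_nested[of 2 2 1 0 0 v]
  by (simp add: sums_over_5 sum_5 cong: sum_weak_cong; algebra)

lemma monomial_sym_21110:
  "monomial_sym (vector [2,1,1,1,0]) (v::complex^5) = v $ 1 ^ 2 * v $ 2 * v $ 3 * v $ 4 + v $ 1 ^ 2 * v $ 2 * v $ 3 * v $ 5 + v $ 1 ^ 2 * v $ 2 * v $ 4 * v $ 5 + v $ 1 ^ 2 * v $ 3 * v $ 4 * v $ 5 + v $ 1 * v $ 2 ^ 2 * v $ 3 * v $ 4 + v $ 1 * v $ 2 ^ 2 * v $ 3 * v $ 5 + v $ 1 * v $ 2 ^ 2 * v $ 4 * v $ 5 + v $ 1 * v $ 2 * v $ 3 ^ 2 * v $ 4 + v $ 1 * v $ 2 * v $ 3 ^ 2 * v $ 5 + v $ 1 * v $ 2 * v $ 3 * v $ 4 ^ 2 + v $ 1 * v $ 2 * v $ 3 * v $ 5 ^ 2 + v $ 1 * v $ 2 * v $ 4 ^ 2 * v $ 5 + v $ 1 * v $ 2 * v $ 4 * v $ 5 ^ 2 + v $ 1 * v $ 3 ^ 2 * v $ 4 * v $ 5 + v $ 1 * v $ 3 * v $ 4 ^ 2 * v $ 5 + v $ 1 * v $ 3 * v $ 4 * v $ 5 ^ 2 + v $ 2 ^ 2 * v $ 3 * v $ 4 * v $ 5 + v $ 2 * v $ 3 ^ 2 * v $ 4 * v $ 5 + v $ 2 * v $ 3 * v $ 4 ^ 2 * v $ 5 + v $ 2 * v $ 3 * v $ 4 * v $ 5 ^ 2"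
  using monomial_sym_5_nested[of 2 1 1 1 0 v]
  by (simp add: sums_over_5 sum_5 cong: sum_weak_cong; algebra)

lemma monomial_sym_11111:
  "monomial_sym (vector [1,1,1,1,1]) (v::complex^5) = v $ 1 * v $ 2 * v $ 3 * v $ 4 * v $ 5"
  using monomial_sym_5_nested[of 1 1 1 1 1 v]
  by (simp add: sums_over_5 sum_5 cong: sum_weak_cong; algebra)


lemma quintic_el:
  "quintic v = 128 * el5 v - 64 * el4 v * el1 v - 64 * el3 v * el2 v + 48 * el3 v * el1 v ^ 2 + 48 * el2 v ^ 2 * el1 v
     - 40 * el2 v * el1 v ^ 3 + 7 * el1 v ^ 5"
  unfolding quintic_def monomial_sym_50000 monomial_sym_41000 monomial_sym_32000 monomial_sym_31100 monomial_sym_22100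
    monomial_sym_21110 monomial_sym_11111 el1_def el2_def el3_def el4_def el5_def
  by algebra

text \<open>The quartic in T whose value at T = v_i is the i-th partial derivative of the quintic.
  It results from substituting de_k/dv_i = e_(k-1) - v_i e_(k-2) + v_i^2 e_(k-3) - ... and
  collecting powers of v_i; e5 itself drops out.\<close>

definition grad_poly :: "complex^5 \<Rightarrow> complex \<Rightarrow> complex" where
  "grad_poly v T = 128 * T ^ 4 - 64 * el1 v * T ^ 3 + (64 * el2 v - 16 * el1 v ^ 2) * T ^ 2
     - (64 * el3 v - 32 * el1 v * el2 v + 8 * el1 v ^ 3) * T
     + (64 * el4 v - 32 * el1 v * el3 v - 16 * el2 v ^ 2 + 24 * el1 v ^ 2 * el2 v - 5 * el1 v ^ 4)"

lemmas el_defs = el1_def el2_def el3_def el4_def el5_def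

lemma quintic_has_derivative_along:
  "((\<lambda>s. quintic (v + s *s b)) has_field_derivative (\<Sum>i\<in>UNIV. grad_poly v (v $ i) * b $ i)) (at 0)"
proof -
  define v1 v2 v3 v4 v5 where v: "v1 = v $ 1" "v2 = v $ 2" "v3 = v $ 3" "v4 = v $ 4" "v5 = v $ 5"
  define b1 b2 b3 b4 b5 where b: "b1 = b $ 1" "b2 = b $ 2" "b3 = b $ 3" "b4 = b $ 4" "b5 = b $ 5"
  \<comment> \<open>\<open>d1\<close>, ..., \<open>d5\<close> are the derivatives of e1, ..., e5 in
    the direction b; the chain rule then leaves one polynomial identity.\<close>
  define d1 where "d1 = b1 + b2 + b3 + b4 + b5"
  define d2 where "d2 = b1 * (v2 + v3 + v4 + v5) + b2 * (v1 + v3 + v4 + v5) + b3 * (v1 + v2 + v4 + v5)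
    + b4 * (v1 + v2 + v3 + v5) + b5 * (v1 + v2 + v3 + v4)"
  define d3 where "d3 = b1 * (v2* v3 + v2* v4 + v2* v5 + v3* v4 + v3* v5 + v4* v5) + b2 * (v1* v3 + v1* v4 + v1* v5 + v3* v4 + v3* v5 + v4* v5)
    + b3 * (v1* v2 + v1* v4 + v1* v5 + v2* v4 + v2* v5 + v4* v5) + b4 * (v1* v2 + v1* v3 + v1* v5 + v2* v3 + v2* v5 + v3* v5)
    + b5 * (v1* v2 + v1* v3 + v1* v4 + v2* v3 + v2* v4 + v3* v4)"
  define d4 where "d4 = b1 * (v2* v3* v4 + v2* v3* v5 + v2* v4* v5 + v3* v4* v5) + b2 * (v1* v3* v4 + v1* v3* v5 + v1* v4* v5 + v3* v4* v5)
    + b3 * (v1* v2* v4 + v1* v2* v5 + v1* v4* v5 + v2* v4* v5) + b4 * (v1* v2* v3 + v1* v2* v5 + v1* v3* v5 + v2* v3* v5)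
    + b5 * (v1* v2* v3 + v1* v2* v4 + v1* v3* v4 + v2* v3* v4)"
  define d5 where "d5 = b1 * (v2* v3* v4* v5) + b2 * (v1* v3* v4* v5) + b3 * (v1* v2* v4* v5) + b4 * (v1* v2* v3* v5) + b5 * (v1* v2* v3* v4)"
  note d = d1_def d2_def d3_def d4_def d5_def
  have comp: "(v + s *s b) $ i = v $ i + s * b $ i" for s i by simp
  have D1: "((\<lambda>s. el1 (v + s *s b)) has_field_derivative d1) (at 0)"
    unfolding el1_def comp v[symmetric] b[symmetric] d1_def by (auto intro!: derivative_eq_intros)
  have D2: "((\<lambda>s. el2 (v + s *s b)) has_field_derivative d2) (at 0)"
    unfolding el2_def comp v[symmetric] b[symmetric] d2_def by (auto intro!: derivative_eq_intros simp: algebra_simps)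
  have D3: "((\<lambda>s. el3 (v + s *s b)) has_field_derivative d3) (at 0)"
    unfolding el3_def comp v[symmetric] b[symmetric] d3_def by (auto intro!: derivative_eq_intros simp: algebra_simps)
  have D4: "((\<lambda>s. el4 (v + s *s b)) has_field_derivative d4) (at 0)"
    unfolding el4_def comp v[symmetric] b[symmetric] d4_def by (auto intro!: derivative_eq_intros simp: algebra_simps)
  have D5: "((\<lambda>s. el5 (v + s *s b)) has_field_derivative d5) (at 0)"
    unfolding el5_def comp v[symmetric] b[symmetric] d5_def by (auto intro!: derivative_eq_intros simp: algebra_simps)
  have "((\<lambda>s. quintic (v + s *s b)) has_field_derivative
     128 * d5 - 64 * (d4 * el1 v + el4 v * d1) - 64 * (d3 * el2 v + el3 v * d2) + 48 * (d3 * el1 v ^ 2 + el3 v * (2 * el1 v * d1))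
     + 48 * (2 * el2 v * d2 * el1 v + el2 v ^ 2 * d1) - 40 * (d2 * el1 v ^ 3 + el2 v * (3 * el1 v ^ 2 * d1)) + 35 * el1 v ^ 4 * d1) (at 0)"
    unfolding quintic_el by (rule derivative_eq_intros D1 D2 D3 D4 D5 refl | simp add: algebra_simps)+
  moreover have "128 * d5 - 64 * (d4 * el1 v + el4 v * d1) - 64 * (d3 * el2 v + el3 v * d2) + 48 * (d3 * el1 v ^ 2 + el3 v * (2 * el1 v * d1))
     + 48 * (2 * el2 v * d2 * el1 v + el2 v ^ 2 * d1) - 40 * (d2 * el1 v ^ 3 + el2 v * (3 * el1 v ^ 2 * d1)) + 35 * el1 v ^ 4 * d1
     = (\<Sum>i\<in>UNIV. grad_poly v (v $ i) * b $ i)"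
    unfolding sum_5 grad_poly_def d el_defs v[symmetric] b[symmetric] by algebra
  ultimately show ?thesis by simp
qed

lemma gradient_quintic: "gradient quintic v $ i = grad_poly v (v $ i)"
proof -
  have "(\<Sum>j\<in>UNIV. grad_poly v (v $ j) * axis i 1 $ j) = grad_poly v (v $ i)"
    by (simp add: axis_def if_distrib[of "\<lambda>x. _ * x"] cong: if_cong)
  then show ?thesis
    using DERIV_imp_deriv[OF quintic_has_derivative_along[of v "axis i 1"]]
    by (simp add: gradient_def partial_deriv_def)
qed

text \<open>Euler's relation for a form of degree 5. It places on X every point of a hyperplane at
  which the gradient is proportional to the coefficients of that hyperplane.\<close>

lemma euler_quintic: "(\<Sum>i\<in>UNIV. grad_poly v (v $ i) * v $ i) = 5 * quintic v"
  unfolding sum_5 grad_poly_def quintic_el el_defs by algebra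

lemma el_scale:
  "el1 (c *s v) = c * el1 v" "el2 (c *s v) = c ^ 2 * el2 v" "el3 (c *s v) = c ^ 3 * el3 v"
  "el4 (c *s v) = c ^ 4 * el4 v" "el5 (c *s v) = c ^ 5 * el5 v"
  by (simp_all add: el_defs algebra_simps power2_eq_square power3_eq_cube power4_eq_xxxx eval_nat_numeral)

lemma quintic_scale: "quintic (c *s v) = c ^ 5 * quintic v"
  unfolding quintic_el el_scale by algebra

lemma grad_poly_scale: "grad_poly (c *s v) (c * T) = c ^ 4 * grad_poly v T"
  unfolding grad_poly_def el_scale by algebra

section \<open>Singular points of a section: gradient proportional to the hyperplane\<close>

lemma subspace_hyperplane: "vec.subspace (hyperplane a)"
  by (auto simp: vec.subspace_def hyperplane_def sum.distrib algebra_simps sum_distrib_left[symmetric])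

lemma span_subset_hyperplane:
  fixes a :: "complex^'n"
  assumes "\<And>w. w \<in> S \<Longrightarrow> (\<Sum>i\<in>UNIV. a $ i * w $ i) = 0" and "w \<in> vec.span S"
  shows "(\<Sum>i\<in>UNIV. a $ i * w $ i) = 0"
proof -
  have "vec.span S \<subseteq> hyperplane a"
    by (rule vec.span_minimal) (use assms subspace_hyperplane in \<open>auto simp: hyperplane_def\<close>)
  then show ?thesis using assms by (auto simp: hyperplane_def)
qed

lemma sum_mult_axis: "(\<Sum>i\<in>UNIV. f i * axis k 1 $ i) = (f k :: 'a::semiring_1)"
  by (simp add: axis_def if_distrib[of "\<lambda>x. _ * x"] cong: if_cong)

lemma sum_mult_diff_scale:
  "(\<Sum>i\<in>UNIV. f i * (c *s u - d *s w) $ i) = c * (\<Sum>i\<in>UNIV. f i * u $ i) - d * (\<Sum>i\<in>UNIV. f i * (w $ i :: complex))"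
  by (simp add: right_diff_distrib sum_subtractf sum_distrib_left mult.left_commute)

text \<open>Otherwise the three vectors b would span the hyperplane, and together with one vector
  outside it four vectors would span the five-dimensional space. This makes the centre of a chart an
  honest projective point.\<close>

lemma span_hyperplane_nonzero:
  assumes "a \<noteq> (0 :: complex^5)" and "vec.span (insert p (range (b :: 3 \<Rightarrow> complex^5))) = hyperplane a"
  shows "p \<noteq> 0"
proof
  assume "p = 0"
  then have sp: "vec.span (range b) = hyperplane a"
    using assms(2) by simp
  obtain k where k: "a $ k \<noteq> 0" using assms(1) by (auto simp: vec_eq_iff)
  \<comment> \<open>Since a_k is nonzero, subtracting a multiple of the k-th basis vector moves any
    w into the hyperplane.\<close>
  have "w \<in> vec.span (insert (axis k 1) (range b))" for w
  proof -
    let ?c = "(\<Sum>i\<in>UNIV. a $ i * w $ i) / a $ k"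
    have "(\<Sum>i\<in>UNIV. a $ i * (w - ?c *s axis k 1) $ i) = (\<Sum>i\<in>UNIV. a $ i * w $ i) - ?c * a $ k"
      using sum_mult_diff_scale[of "\<lambda>i. a $ i" 1 w ?c "axis k 1"] by (simp only: sum_mult_axis) simp
    then have "w - ?c *s axis k 1 \<in> hyperplane a"
      using k by (simp add: hyperplane_def)
    then have "w - ?c *s axis k 1 \<in> vec.span (insert (axis k 1) (range b))"
      using sp vec.span_mono[of "range b" "insert (axis k 1) (range b)"] by auto
    moreover have "?c *s axis k 1 \<in> vec.span (insert (axis k 1) (range b))"
      by (intro vec.span_scale vec.span_base) simp
    ultimately have "(w - ?c *s axis k 1) + ?c *s axis k 1 \<in> vec.span (insert (axis k 1) (range b))"
      by (rule vec.span_add)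
    then show ?thesis by simp
  qed
  then have "vec.dim (UNIV :: (complex^5) set) \<le> card (insert (axis k 1) (range b))"
    by (intro vec.dim_le_card) auto
  also have "\<dots> \<le> 4"
    using card_image_le[of "UNIV :: 3 set" b] card_insert_le_m1[of 4 "range b" "axis k 1"] by simp
  finally show False by (simp add: card_cart_basis)
qed

lemma partial_deriv_local_equation:
  "partial_deriv k (\<lambda>x :: complex^3. quintic (p + (\<Sum>i\<in>UNIV. x $ i *s b i))) 0
     = (\<Sum>i\<in>UNIV. grad_poly p (p $ i) * b k $ i)"
proof -
  have "(\<Sum>i\<in>UNIV. (s *s axis k 1) $ i *s b i) = s *s b k" for s
  proof -
    have "(\<Sum>i\<in>UNIV. (s *s axis k 1) $ i *s b i) = (\<Sum>i\<in>UNIV. if i = k then s *s b k else 0)"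
      by (intro sum.cong refl) (auto simp: axis_def)
    then show ?thesis by simp
  qed
  then have "(\<lambda>s. quintic (p + (\<Sum>i\<in>UNIV. (0 + s *s axis k 1) $ i *s b i))) = (\<lambda>s. quintic (p + s *s b k))"
    by (simp add: fun_eq_iff)
  then show ?thesis
    unfolding partial_deriv_def using DERIV_imp_deriv[OF quintic_has_derivative_along[of p "b k"]] by simp
qed

text \<open>The partials of the local equation are the gradient of the quintic paired with the b_k,
  and Euler's relation handles p; so the gradient kills the whole hyperplane and must be a multiple
  of a.\<close>

lemma section_sing_quintic_parallel:
  assumes a: "a \<noteq> 0" and P: "P \<in> section_sing quintic (hyperplane a)"
  obtains v l where "P = vec.span {v}" "v \<noteq> 0" "v \<in> hyperplane a" "\<And>i. grad_poly v (v $ i) = l * a $ i"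
proof -
  obtain p and b :: "3 \<Rightarrow> complex^5" and f where *: "P = vec.span {p}" "vec.span (insert p (range b)) = hyperplane a"
    "f = (\<lambda>x. quintic (p + (\<Sum>i\<in>UNIV. x $ i *s b i)))" "f 0 = 0" "gradient f 0 = 0"
    using P by (auto simp: section_sing_def local_equation_def)
  have 0: "quintic p = 0" using *(3,4) by simp
  have b0: "(\<Sum>i\<in>UNIV. grad_poly p (p $ i) * b k $ i) = 0" for k
  proof -
    have "partial_deriv k f 0 = 0" using *(5) by (simp add: gradient_def vec_eq_iff)
    then show ?thesis unfolding *(3) partial_deriv_local_equation .
  qed
  have van: "(\<Sum>i\<in>UNIV. grad_poly p (p $ i) * w $ i) = 0" if "w \<in> hyperplane a" for w
    using span_subset_hyperplane[of "insert p (range b)" "\<chi> i. grad_poly p (p $ i)" w] b0 euler_quintic[of p] 0 that *(2)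
    by auto
  obtain k where k: "a $ k \<noteq> 0" using a by (auto simp: vec_eq_iff)
  have "grad_poly p (p $ i) = (grad_poly p (p $ k) / a $ k) * a $ i" for i
  proof -
    \<comment> \<open>These vectors lie in the hyperplane; evaluating the gradient on them yields
      proportionality with factor fixed by a coordinate k where a is nonzero.\<close>
    have "a $ k *s axis i 1 - a $ i *s axis k 1 \<in> hyperplane a"
      by (simp only: hyperplane_def mem_Collect_eq sum_mult_diff_scale sum_mult_axis) simp
    from van[OF this] have "a $ k * grad_poly p (p $ i) - a $ i * grad_poly p (p $ k) = 0"
      by (simp only: sum_mult_diff_scale sum_mult_axis)
    then show ?thesis using k by (simp add: field_simps)
  qed
  moreover have "p \<in> hyperplane a" using *(2) vec.span_base by blast
  ultimately show ?thesis
    using that *(1) span_hyperplane_nonzero[OF a *(2)] by blast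
qed

text \<open>Converse direction. That a chart centred at the point exists is taken as a hypothesis;
  it is later supplied by the proof of the singularity type.\<close>

lemma parallel_in_section_sing:
  assumes v: "v \<in> hyperplane a" "\<And>i. grad_poly v (v $ i) = l * a $ i"
    and f: "local_equation quintic (hyperplane a) (vec.span {v}) f"
  shows "vec.span {v} \<in> section_sing quintic (hyperplane a)"
proof -
  obtain p and b :: "3 \<Rightarrow> complex^5" where *: "vec.span {v} = vec.span {p}" "vec.span (insert p (range b)) = hyperplane a"
    "f = (\<lambda>x. quintic (p + (\<Sum>i\<in>UNIV. x $ i *s b i)))"
    using f by (auto simp: local_equation_def)
  have av: "(\<Sum>i\<in>UNIV. a $ i * v $ i) = 0" using v(1) by (simp add: hyperplane_def)
  have "p \<in> vec.span {v}" unfolding *(1) by (simp add: vec.span_base)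
  then obtain c where c: "p = c *s v" by (auto simp: vec.span_singleton)
  have "5 * quintic v = (\<Sum>i\<in>UNIV. l * (a $ i * v $ i))"
    unfolding euler_quintic[symmetric] v(2) by (simp add: ac_simps)
  then have "quintic v = 0" using av by (simp add: sum_distrib_left[symmetric])
  then have "f 0 = 0" unfolding *(3) by (simp add: c quintic_scale)
  moreover have "partial_deriv k f 0 = 0" for k
  proof -
    have "b k \<in> hyperplane a" using vec.span_base[of "b k" "insert p (range b)"] *(2) by simp
    then have bk: "(\<Sum>i\<in>UNIV. a $ i * b k $ i) = 0" by (simp add: hyperplane_def)
    have "partial_deriv k f 0 = (\<Sum>i\<in>UNIV. c ^ 4 * l * (a $ i * b k $ i))"
      unfolding *(3) partial_deriv_local_equation c by (simp add: grad_poly_scale v(2) ac_simps)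
    then show ?thesis using bk by (simp add: sum_distrib_left[symmetric])
  qed
  ultimately show ?thesis using f by (auto simp: section_sing_def gradient_def vec_eq_iff)
qed

section \<open>Invariance under permutations of the coordinates\<close>

definition permute_coords :: "('n \<Rightarrow> 'n) \<Rightarrow> complex^'n \<Rightarrow> complex^'n" where
  "permute_coords \<pi> v = (\<chi> i. v $ \<pi> i)"

lemma monomial_sym_permute_coords:
  fixes \<pi> :: "'n::finite \<Rightarrow> 'n"
  assumes "bij \<pi>"
  shows "monomial_sym \<alpha> (permute_coords \<pi> v) = monomial_sym \<alpha> v"
proof -
  let ?S = "{(\<chi> i. \<alpha> $ \<rho> i) | \<rho> :: 'n \<Rightarrow> 'n. bij \<rho>}"
  have bi: "bij (inv \<pi>)" using assms by (rule bij_imp_bij_inv)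
  have sf: "\<pi> (inv \<pi> i) = i" "inv \<pi> (\<pi> i) = i" for i
    using assms by (simp_all add: bij_is_surj surj_f_inv_f bij_is_inj)
  show ?thesis
    unfolding monomial_sym_def
  proof (rule sum.reindex_bij_witness[where i = "\<lambda>\<beta>. \<chi> i. \<beta> $ \<pi> i" and j = "\<lambda>\<beta>. \<chi> i. \<beta> $ inv \<pi> i"])
    fix \<beta> assume \<beta>: "\<beta> \<in> ?S"
    show "(\<chi> i. (\<chi> i. \<beta> $ inv \<pi> i) $ \<pi> i) = \<beta>" "(\<chi> i. (\<chi> i. \<beta> $ \<pi> i) $ inv \<pi> i) = \<beta>"
      by (simp_all add: sf vec_eq_iff)
    obtain \<rho> :: "'n \<Rightarrow> 'n" where \<rho>: "bij \<rho>" "\<beta> = (\<chi> i. \<alpha> $ \<rho> i)" using \<beta> by auto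
    show "(\<chi> i. \<beta> $ inv \<pi> i) \<in> ?S"
      using bij_comp[OF bi \<rho>(1)] \<rho>(2) by (intro CollectI exI[of _ "\<rho> \<circ> inv \<pi>"]) simp
    show "(\<chi> i. \<beta> $ \<pi> i) \<in> ?S"
      using bij_comp[OF assms \<rho>(1)] \<rho>(2) by (intro CollectI exI[of _ "\<rho> \<circ> \<pi>"]) simp
    show "(\<Prod>i\<in>UNIV. v $ i ^ (\<chi> i. \<beta> $ inv \<pi> i) $ i) = (\<Prod>i\<in>UNIV. permute_coords \<pi> v $ i ^ \<beta> $ i)"
      unfolding permute_coords_def
      using prod.reindex_bij_betw[OF assms, of "\<lambda>i. v $ i ^ (\<beta> $ inv \<pi> i)"] by (simp add: sf)
  qed
qed

lemma quintic_permute_coords: "bij \<pi> \<Longrightarrow> quintic (permute_coords \<pi> v) = quintic v"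
  by (simp add: quintic_def monomial_sym_permute_coords)

lemma linear_permute_coords: "Vector_Spaces.linear (*s) (*s) (permute_coords \<pi>)"
  by unfold_locales (simp_all add: permute_coords_def vec_eq_iff algebra_simps)

lemma permute_coords_inv:
  assumes "bij \<pi>" shows "permute_coords \<pi> (permute_coords (inv \<pi>) v) = v" "permute_coords (inv \<pi>) (permute_coords \<pi> v) = v"
  using assms by (simp_all add: permute_coords_def vec_eq_iff bij_is_surj surj_f_inv_f bij_is_inj)

lemma permute_coords_hyperplane:
  assumes "bij \<pi>" shows "permute_coords \<pi> ` hyperplane a = hyperplane (permute_coords \<pi> a)"
proof -
  have "permute_coords \<pi> v \<in> hyperplane (permute_coords \<pi> a) \<longleftrightarrow> v \<in> hyperplane a" for v
    using sum.reindex_bij_betw[OF assms, of "\<lambda>i. a $ i * v $ i"]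
    by (simp add: hyperplane_def permute_coords_def)
  then show ?thesis
    using permute_coords_inv[OF assms] by (auto simp: image_iff) (metis)
qed

text \<open>A permutation carries a chart to a chart with literally the same local equation, because
  the quintic is symmetric. This reduces all 15 lines to one of them, and one tangency point of the
  17 A_2 section to the other.\<close>

lemma has_sing_type_permute_coords:
  assumes \<pi>: "bij \<pi>" and "has_sing_type quintic (hyperplane a) (vec.span {v}) T"
  shows "has_sing_type quintic (hyperplane (permute_coords \<pi> a)) (vec.span {permute_coords \<pi> v}) T"
proof -
  let ?Q = "permute_coords \<pi>"
  interpret Q: Vector_Spaces.linear "(*s)" "(*s)" ?Q by (rule linear_permute_coords)
  obtain p and b :: "3 \<Rightarrow> complex^5" and f where *: "vec.span {v} = vec.span {p}" "vec.span (insert p (range b)) = hyperplane a"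
    "f = (\<lambda>x. quintic (p + (\<Sum>i\<in>UNIV. x $ i *s b i)))" "germ_iso f (normal_form T)"
    using assms(2) by (auto simp: has_sing_type_def local_equation_def)
  have "vec.span {?Q v} = ?Q ` vec.span {v}" using Q.span_image[of "{v}"] by simp
  also have "\<dots> = vec.span {?Q p}" using Q.span_image[of "{p}"] *(1) by simp
  finally have 1: "vec.span {?Q v} = vec.span {?Q p}" .
  have 2: "vec.span (insert (?Q p) (range (\<lambda>i. ?Q (b i)))) = hyperplane (?Q a)"
    unfolding permute_coords_hyperplane[OF \<pi>, symmetric] *(2)[symmetric] Q.span_image[symmetric]
    by (simp add: image_image)
  have "f = (\<lambda>x. quintic (?Q p + (\<Sum>i\<in>UNIV. x $ i *s ?Q (b i))))"
  proof
    fix x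
    have "?Q p + (\<Sum>i\<in>UNIV. x $ i *s ?Q (b i)) = ?Q (p + (\<Sum>i\<in>UNIV. x $ i *s b i))"
      by (simp add: Q.add Q.sum Q.scale)
    then show "f x = quintic (?Q p + (\<Sum>i\<in>UNIV. x $ i *s ?Q (b i)))"
      unfolding *(3) by (simp add: quintic_permute_coords[OF \<pi>])
  qed
  then have "local_equation quintic (hyperplane (?Q a)) (vec.span {?Q v}) f"
    unfolding local_equation_def using 1 2 by blast
  then show ?thesis using *(4) by (auto simp: has_sing_type_def)
qed

section \<open>Holomorphic coordinate changes and the normal forms A_k and D_4\<close>

text \<open>The complex gradient A is carried along and required to be continuous, because the
  inverse function theorem needs a continuous derivative and the Jacobian at 0 must be computed
  explicitly.\<close>

definition c1_holo :: "(complex ^ 'n \<Rightarrow> complex) \<Rightarrow> (complex ^ 'n \<Rightarrow> complex ^ 'n) \<Rightarrow> (complex ^ 'n) set \<Rightarrow> bool" where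
  "c1_holo f A N \<longleftrightarrow> (\<forall>x\<in>N. (f has_derivative (\<lambda>h. \<Sum>i\<in>UNIV. A x $ i * h $ i)) (at x)) \<and> continuous_on N A"

lemma c1_holo_subset: "c1_holo f A N \<Longrightarrow> N' \<subseteq> N \<Longrightarrow> c1_holo f A N'"
  by (auto simp: c1_holo_def intro: continuous_on_subset)

lemma c1_holo_imp_holo_on: "c1_holo f A N \<Longrightarrow> holo_on f N"
  unfolding c1_holo_def holo_on_def by blast

lemma c1_holo_imp_continuous_on: "c1_holo f A N \<Longrightarrow> continuous_on N f"
  unfolding c1_holo_def using has_derivative_continuous continuous_at_imp_continuous_on by blast

lemma c1_holo_const: "c1_holo (\<lambda>x. c) (\<lambda>x. 0) N"
  by (auto simp: c1_holo_def)

lemma has_derivative_vec_lambda: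
  fixes f :: "'a::real_normed_vector \<Rightarrow> 'n::finite \<Rightarrow> 'b::euclidean_space"
  assumes "\<And>j. ((\<lambda>x. f x j) has_derivative (\<lambda>h. f' h j)) (at x)"
  shows "((\<lambda>x. \<chi> j. f x j) has_derivative (\<lambda>h. \<chi> j. f' h j)) (at x)"
  using assms
  by (subst has_derivative_componentwise_within) (auto simp: Basis_vec_def inner_axis intro: has_derivative_inner_left)

lemma c1_holo_nth:
  fixes N :: "(complex ^ 'n) set"
  shows "c1_holo (\<lambda>x. x $ k) (\<lambda>x. axis k 1) N"
proof -
  have "(\<lambda>h. \<Sum>i\<in>UNIV. axis k 1 $ i * h $ i) = (\<lambda>h::complex^'n. h $ k)"
    by (simp add: axis_def if_distrib[of "\<lambda>x. x * _"] cong: if_cong)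
  then show ?thesis by (auto simp: c1_holo_def intro!: bounded_linear_imp_has_derivative bounded_linear_vec_nth)
qed

lemma c1_holo_add:
  assumes "c1_holo f A N" "c1_holo g B N"
  shows "c1_holo (\<lambda>x. f x + g x) (\<lambda>x. A x + B x) N"
  using assms unfolding c1_holo_def
  by (auto intro!: continuous_intros has_derivative_eq_rhs[OF has_derivative_add] simp: sum.distrib algebra_simps)

lemma continuous_on_scale_vec:
  fixes f :: "'a::topological_space \<Rightarrow> complex" and A :: "'a \<Rightarrow> complex ^ 'n"
  assumes "continuous_on N f" "continuous_on N A"
  shows "continuous_on N (\<lambda>x. f x *s A x)"
  unfolding continuous_on_componentwise vector_scalar_mult_def
  using assms by (auto intro!: continuous_intros continuous_on_vec_lambda)

lemma c1_holo_mult: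
  assumes "c1_holo f A N" "c1_holo g B N"
  shows "c1_holo (\<lambda>x. f x * g x) (\<lambda>x. f x *s B x + g x *s A x) N"
  unfolding c1_holo_def
proof
  show "\<forall>x\<in>N. ((\<lambda>x. f x * g x) has_derivative (\<lambda>h. \<Sum>i\<in>UNIV. (f x *s B x + g x *s A x) $ i * h $ i)) (at x)"
  proof
    fix x assume x: "x \<in> N"
    have "((\<lambda>x. f x * g x) has_derivative (\<lambda>h. f x * (\<Sum>i\<in>UNIV. B x $ i * h $ i) + (\<Sum>i\<in>UNIV. A x $ i * h $ i) * g x)) (at x)"
      using assms x unfolding c1_holo_def by (intro has_derivative_mult) auto
    then show "((\<lambda>x. f x * g x) has_derivative (\<lambda>h. \<Sum>i\<in>UNIV. (f x *s B x + g x *s A x) $ i * h $ i)) (at x)"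
      by (rule has_derivative_eq_rhs) (simp add: fun_eq_iff sum.distrib sum_distrib_left algebra_simps)
  qed
  show "continuous_on N (\<lambda>x. f x *s B x + g x *s A x)"
    using assms c1_holo_imp_continuous_on[OF assms(1)] c1_holo_imp_continuous_on[OF assms(2)]
    by (auto simp: c1_holo_def intro!: continuous_intros continuous_on_scale_vec)
qed

lemma c1_holo_compose:
  assumes f: "c1_holo f A N" and g: "\<And>x. x \<in> N \<Longrightarrow> (g has_field_derivative g' (f x)) (at (f x))"
    and g': "continuous_on (f ` N) g'"
  shows "c1_holo (\<lambda>x. g (f x)) (\<lambda>x. g' (f x) *s A x) N"
  unfolding c1_holo_def
proof
  show "\<forall>x\<in>N. ((\<lambda>x. g (f x)) has_derivative (\<lambda>h. \<Sum>i\<in>UNIV. (g' (f x) *s A x) $ i * h $ i)) (at x)"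
  proof
    fix x assume x: "x \<in> N"
    have "((\<lambda>x. g (f x)) has_derivative (\<lambda>h. g' (f x) * (\<Sum>i\<in>UNIV. A x $ i * h $ i))) (at x)"
      using has_derivative_compose[of f "\<lambda>h. \<Sum>i\<in>UNIV. A x $ i * h $ i" x UNIV g "\<lambda>y. g' (f x) * y"] f x g[OF x]
      by (auto simp: c1_holo_def has_field_derivative_def)
    then show "((\<lambda>x. g (f x)) has_derivative (\<lambda>h. \<Sum>i\<in>UNIV. (g' (f x) *s A x) $ i * h $ i)) (at x)"
      by (rule has_derivative_eq_rhs) (simp add: fun_eq_iff sum_distrib_left algebra_simps)
  qed
  have "continuous_on N (\<lambda>x. g' (f x))"
    using continuous_on_compose[OF c1_holo_imp_continuous_on[OF f] g'] by (simp add: o_def)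
  then show "continuous_on N (\<lambda>x. g' (f x) *s A x)"
    using f by (auto simp: c1_holo_def intro!: continuous_on_scale_vec)
qed

text \<open>Near 0 the quotient f / f 0 stays in the right half plane, where the principal logarithm
  is holomorphic, so an n-th root of the unit f exists there.\<close>

lemma c1_holo_root:
  assumes N0: "open N0" "0 \<in> N0" and f: "c1_holo f A N0" and f0: "f 0 \<noteq> 0" and n: "n > 0"
  obtains N r B where "open N" "0 \<in> N" "N \<subseteq> N0" "c1_holo r B N" "\<And>x. x \<in> N \<Longrightarrow> r x ^ n = f x" "\<And>x. x \<in> N \<Longrightarrow> r x \<noteq> 0"
proof -
  define N where "N = {x \<in> N0. Re (f x / f 0) > 0}"
  obtain c where c: "c ^ n = f 0" "c \<noteq> 0"
  proof
    show "exp (Ln (f 0) / of_nat n) ^ n = f 0"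
      using n f0 by (simp add: exp_of_nat_mult[symmetric])
  qed simp
  define r where "r = (\<lambda>x. c * exp (Ln (f x / f 0) / of_nat n))"
  have cf: "continuous_on N0 f" by (rule c1_holo_imp_continuous_on[OF f])
  have "continuous_on N0 (\<lambda>x. Re (f x / f 0))"
    by (intro continuous_on_Re continuous_on_divide cf continuous_on_const) (simp add: f0)
  then have "open (N0 \<inter> (\<lambda>x. Re (f x / f 0)) -` {0<..})"
    by (intro continuous_open_preimage N0 open_greaterThan)
  moreover have "N = N0 \<inter> (\<lambda>x. Re (f x / f 0)) -` {0<..}" by (auto simp: N_def)
  ultimately have "open N" by simp
  moreover have "0 \<in> N" "N \<subseteq> N0" using f0 N0 by (auto simp: N_def)
  moreover
  let ?g = "\<lambda>z. c * exp (Ln (z / f 0) / of_nat n)"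
  let ?g' = "\<lambda>z. c * exp (Ln (z / f 0) / of_nat n) * (1 / (z * of_nat n))"
  have nz: "z / f 0 \<notin> \<real>\<^sub>\<le>\<^sub>0" "z \<noteq> 0" if "0 < Re (z / f 0)" for z
    using that by (auto simp: complex_nonpos_Reals_iff)
  have "c1_holo (\<lambda>x. ?g (f x)) (\<lambda>x. ?g' (f x) *s A x) N"
  proof (rule c1_holo_compose)
    show "c1_holo f A N" using f by (rule c1_holo_subset) (auto simp: N_def)
    show "(?g has_field_derivative ?g' (f x)) (at (f x))" if "x \<in> N" for x
      using nz[of "f x"] that f0 n by (auto intro!: derivative_eq_intros simp: N_def field_simps)
    have nz': "z / f 0 \<notin> \<real>\<^sub>\<le>\<^sub>0" "z \<noteq> 0" if "z \<in> f ` N" for z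
      using that nz by (auto simp: N_def)
    show "continuous_on (f ` N) ?g'"
      by (intro continuous_on_mult continuous_on_const continuous_on_exp continuous_on_divide continuous_on_Ln'
            continuous_on_id ballI)
         (use nz' f0 n in auto)
  qed
  moreover have "?g (f x) ^ n = f x" if "x \<in> N" for x
    using nz[of "f x"] that n f0 by (simp add: N_def power_mult_distrib c exp_of_nat_mult[symmetric])
  moreover have "?g (f x) \<noteq> 0" for x using c by simp
  ultimately show ?thesis using that by blast
qed

text \<open>The functions u_j form a local coordinate system by the inverse function theorem, and f
  is g in these coordinates; the unit in \<open>germ_iso\<close> is 1.\<close>

lemma germ_iso_of_coordinates:
  fixes u :: "'n::finite \<Rightarrow> complex ^ 'n \<Rightarrow> complex"
  assumes N: "open N" "0 \<in> N" and u: "\<And>j. c1_holo (u j) (A j) N" and u0: "\<And>j. u j 0 = 0"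
    and inv: "invertible (\<chi> j. A j 0)"
    and f: "\<And>x. x \<in> N \<Longrightarrow> f x = g (\<chi> j. u j x)"
  shows "germ_iso f g"
proof -
  let ?\<Phi> = "\<lambda>x. \<chi> j. u j x" and ?M = "\<lambda>x. \<chi> j. A j x"
  let ?D = "\<lambda>x. Blinfun ((*v) (?M x))"
  have app: "blinfun_apply (Blinfun ((*v) (B :: complex^'n^'n))) = (*v) B" for B
    by (rule bounded_linear_Blinfun_apply) simp
  have mv: "?M x *v h = (\<chi> j. \<Sum>i\<in>UNIV. A j x $ i * h $ i)" for x h
    by (simp add: matrix_vector_mult_def)
  have der: "(?\<Phi> has_derivative blinfun_apply (?D x)) (at x)" if "x \<in> N" for x
    unfolding app mv using u that
    by (auto simp: c1_holo_def intro!: has_derivative_vec_lambda)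
  have cont: "continuous_on N ?D"
  proof (rule continuous_on_blinfun_componentwise)
    fix h :: "complex ^ 'n"
    have "continuous_on N (A j)" for j using u by (simp add: c1_holo_def)
    then show "continuous_on N (\<lambda>x. blinfun_apply (?D x) h)"
      unfolding app mv by (intro continuous_on_vec_lambda continuous_intros)
  qed
  obtain B0 where B0: "B0 ** ?M 0 = mat 1" using inv by (auto simp: invertible_def)
  have inv0: "Blinfun ((*v) B0) o\<^sub>L ?D 0 = id_blinfun"
    by (rule blinfun_eqI) (simp add: app matrix_vector_mul_assoc B0)
  obtain U' V g' D' where *: "open U'" "U' \<subseteq> N" "0 \<in> U'" "open V" "?\<Phi> 0 \<in> V" "homeomorphism U' V ?\<Phi> g'"
    "\<And>y. y \<in> V \<Longrightarrow> (g' has_derivative (D' y)) (at y)"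
    "\<And>y. y \<in> V \<Longrightarrow> D' y = inv (blinfun_apply (?D (g' y)))"
    "\<And>y. y \<in> V \<Longrightarrow> bij (blinfun_apply (?D (g' y)))"
    using inverse_function_theorem[OF N(1) der cont N(2) inv0] by blast
  have "holo_map_on ?\<Phi> U'"
    unfolding holo_map_on_def using u *(2) by (auto intro: c1_holo_imp_holo_on c1_holo_subset)
  \<comment> \<open>The inverse function theorem is a real statement; the inverse map is holomorphic
    because its derivative is the inverse of a complex matrix.\<close>
  moreover have "holo_map_on g' V"
    unfolding holo_map_on_def holo_on_def
  proof (intro allI ballI)
    fix j y assume y: "y \<in> V"
    let ?B = "?M (g' y)"
    have b: "bij ((*v) ?B)" using *(9)[OF y] by (simp add: app)
    then have iB: "invertible ?B"
      using matrix_left_invertible_injective[of ?B] invertible_left_inverse bij_is_inj by blast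
    then obtain C where C: "?B ** C = mat 1" "C ** ?B = mat 1" by (auto simp: invertible_def)
    have "inv ((*v) ?B) = (*v) C"
      by (rule inv_unique_comp) (simp_all add: fun_eq_iff matrix_vector_mul_assoc C)
    then have "(g' has_derivative (*v) C) (at y)"
      using *(7,8)[OF y] by (simp add: app)
    then have "((\<lambda>y. g' y $ j) has_derivative (\<lambda>h. (C *v h) $ j)) (at y)"
      by (rule bounded_linear.has_derivative[OF bounded_linear_vec_nth])
    then show "\<exists>a. ((\<lambda>x. g' x $ j) has_derivative (\<lambda>h. \<Sum>i\<in>UNIV. a $ i * h $ i)) (at y)"
      unfolding matrix_vector_mult_def by (intro exI[of _ "C $ j"]) simp
  qed
  ultimately have "biholomorphic_between U' V ?\<Phi>"
    unfolding biholomorphic_between_def using * by blast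
  moreover have "holo_on (\<lambda>x. 1) U'"
    by (rule c1_holo_imp_holo_on[OF c1_holo_const])
  moreover have "?\<Phi> 0 = 0" by (simp add: vec_eq_iff u0)
  ultimately show ?thesis
    unfolding germ_iso_def using *(2,3) f
    by (intro exI[of _ U'] exI[of _ V] exI[of _ ?\<Phi>] exI[of _ "\<lambda>x. 1"]) auto
qed

definition c1_entire :: "(complex ^ 'n \<Rightarrow> complex) \<Rightarrow> bool" where
  "c1_entire f \<longleftrightarrow> (\<exists>A. c1_holo f A UNIV)"

lemma c1_entire_const: "c1_entire (\<lambda>x. c)"
  unfolding c1_entire_def using c1_holo_const by blast

lemma c1_entire_nth: "c1_entire (\<lambda>x. x $ k)"
  unfolding c1_entire_def using c1_holo_nth by blast

lemma c1_entire_add: "c1_entire f \<Longrightarrow> c1_entire g \<Longrightarrow> c1_entire (\<lambda>x. f x + g x)"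
  unfolding c1_entire_def using c1_holo_add by blast

lemma c1_entire_mult: "c1_entire f \<Longrightarrow> c1_entire g \<Longrightarrow> c1_entire (\<lambda>x. f x * g x)"
  unfolding c1_entire_def using c1_holo_mult by blast

lemma c1_entire_minus: "c1_entire f \<Longrightarrow> c1_entire (\<lambda>x. - f x)"
  using c1_entire_mult[OF c1_entire_const[of "- 1"]] by fastforce

lemma c1_entire_diff: "c1_entire f \<Longrightarrow> c1_entire g \<Longrightarrow> c1_entire (\<lambda>x. f x - g x)"
  using c1_entire_add[OF _ c1_entire_minus, of f g] by simp

lemma c1_entire_power: "c1_entire f \<Longrightarrow> c1_entire (\<lambda>x. f x ^ n)"
  by (induction n) (auto intro: c1_entire_const c1_entire_mult)

lemma c1_entire_divide: "c1_entire f \<Longrightarrow> c1_entire (\<lambda>x. f x / c)"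
  using c1_entire_mult[OF _ c1_entire_const[of "inverse c"], of f] by (simp add: divide_inverse)

lemmas c1_entire_intros = c1_entire_const c1_entire_nth c1_entire_add c1_entire_mult c1_entire_minus c1_entire_diff
  c1_entire_power c1_entire_divide

lemma c1_entire_root:
  assumes "c1_entire f" and "f 0 \<noteq> 0" and "n > 0"
  obtains N r B where "open N" "0 \<in> N" "c1_holo r B N" "\<And>x. x \<in> N \<Longrightarrow> r x ^ n = f x" "\<And>x. x \<in> N \<Longrightarrow> r x \<noteq> 0"
proof -
  obtain A where "c1_holo f A UNIV" using assms(1) by (auto simp: c1_entire_def)
  then show ?thesis using c1_holo_root[of UNIV f A n] assms(2,3) that by auto
qed

lemma c1_holo_inverse:
  assumes "c1_holo f A N" "\<forall>x\<in>N. f x \<noteq> 0"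
  shows "c1_holo (\<lambda>x. inverse (f x)) (\<lambda>x. (- (inverse (f x) * inverse (f x))) *s A x) N"
proof (rule c1_holo_compose[OF assms(1), where g = inverse and g' = "\<lambda>z. - (inverse z * inverse z)"])
  show "(inverse has_field_derivative - (inverse (f x) * inverse (f x))) (at (f x))" if "x \<in> N" for x
    using DERIV_inverse'[OF DERIV_ident, of "f x" UNIV] assms(2) that by simp
  show "continuous_on (f ` N) (\<lambda>z. - (inverse z * inverse z))"
    using assms(2) by (intro continuous_on_minus continuous_on_mult continuous_on_inverse continuous_on_id) auto
qed

lemma germ_iso_3:
  fixes u1 u2 u3 :: "complex ^ 3 \<Rightarrow> complex"
  assumes N: "open N" "0 \<in> N" and u: "c1_holo u1 A1 N" "c1_holo u2 A2 N" "c1_holo u3 A3 N"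
    and u0: "u1 0 = 0" "u2 0 = 0" "u3 0 = 0"
    and det: "det (vector [A1 0, A2 0, A3 0] :: complex^3^3) \<noteq> 0"
    and f: "\<And>x. x \<in> N \<Longrightarrow> f x = g (vector [u1 x, u2 x, u3 x])"
  shows "germ_iso f g"
proof (rule germ_iso_of_coordinates[where u = "\<lambda>j. if j = 1 then u1 else if j = 2 then u2 else u3" and
      A = "\<lambda>j. if j = 1 then A1 else if j = 2 then A2 else A3", OF N])
  have "(\<chi> j. (if j = 1 then A1 else if j = 2 then A2 else A3) 0) = (vector [A1 0, A2 0, A3 0] :: complex^3^3)"
    by (simp add: vec_eq_iff[of _ "vector _"] forall_3)
  then show "invertible (\<chi> j. (if j = 1 then A1 else if j = 2 then A2 else A3) 0 :: complex^3^3)"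
    using det by (simp add: invertible_det_nz)
  have "(\<chi> j. (if j = 1 then u1 else if j = 2 then u2 else u3) x) = (vector [u1 x, u2 x, u3 x] :: complex^3)" for x
    by (simp add: vec_eq_iff[of _ "vector _"] forall_3)
  then show "f x = g (\<chi> j. (if j = 1 then u1 else if j = 2 then u2 else u3) x :: complex^3)" if "x \<in> N" for x
    using f[OF that] by simp
qed (use u u0 in auto)

text \<open>With U and V the shifted first two coordinates, complete the square: a U^2 + b U V + c
  V^2 is the sum of the squares of r U + b V/(2r) and s V/(2r), where r^2 = a and s^2 = 4ac - b^2.
  The last coordinate is x3 times a (k+1)-st root of d. All coefficients are functions, so higher
  order terms can be hidden in them.\<close>

lemma germ_iso_type_A:
  fixes a b c d :: "complex ^ 3 \<Rightarrow> complex"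
  assumes ent: "c1_entire a" "c1_entire b" "c1_entire c" "c1_entire d"
    and nz: "a 0 \<noteq> 0" "4 * a 0 * c 0 \<noteq> b 0 ^ 2" "d 0 \<noteq> 0"
    and f: "\<And>x. f x = a x * (x $ 1 + \<alpha> * (x $ 3) ^ 2) ^ 2
        + b x * (x $ 1 + \<alpha> * (x $ 3) ^ 2) * (x $ 2 + \<beta> * (x $ 3) ^ 2)
        + c x * (x $ 2 + \<beta> * (x $ 3) ^ 2) ^ 2 + d x * (x $ 3) ^ (k + 1)"
  shows "germ_iso f (normal_form (Type_A k))"
proof -
  obtain N1 r R where r: "open N1" "0 \<in> N1" "c1_holo r R N1" "\<And>x. x \<in> N1 \<Longrightarrow> r x ^ 2 = a x" "\<And>x. x \<in> N1 \<Longrightarrow> r x \<noteq> 0"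
    using c1_entire_root[OF ent(1) nz(1), of 2] by auto
  have entD: "c1_entire (\<lambda>x. 4 * a x * c x - b x ^ 2)" by (intro c1_entire_intros ent)
  obtain N2 s S where s: "open N2" "0 \<in> N2" "c1_holo s S N2" "\<And>x. x \<in> N2 \<Longrightarrow> s x ^ 2 = 4 * a x * c x - b x ^ 2"
      "\<And>x. x \<in> N2 \<Longrightarrow> s x \<noteq> 0"
    using c1_entire_root[OF entD, of 2] nz(2) by auto
  obtain N3 t T where t: "open N3" "0 \<in> N3" "c1_holo t T N3" "\<And>x. x \<in> N3 \<Longrightarrow> t x ^ (k + 1) = d x" "\<And>x. x \<in> N3 \<Longrightarrow> t x \<noteq> 0"
    using c1_entire_root[OF ent(4) nz(3), of "k + 1"] by auto
  obtain B where B: "c1_holo b B UNIV" using ent(2) by (auto simp: c1_entire_def)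
  define N where "N = N1 \<inter> N2 \<inter> N3"
  have N: "open N" "0 \<in> N" using r s t by (auto simp: N_def)
  have sub: "c1_holo r R N" "c1_holo s S N" "c1_holo t T N" "c1_holo b B N"
    using r s t B by (auto simp: N_def intro: c1_holo_subset)
  have r0: "\<forall>x\<in>N. r x \<noteq> 0" using r by (auto simp: N_def)
  note i = c1_holo_inverse[OF sub(1) r0]
  note sq = c1_holo_mult[OF c1_holo_nth[of 3 N] c1_holo_nth[of 3 N]]
  note U = c1_holo_add[OF c1_holo_nth[of 1 N] c1_holo_mult[OF c1_holo_const[of \<alpha>] sq]]
  note V = c1_holo_add[OF c1_holo_nth[of 2 N] c1_holo_mult[OF c1_holo_const[of \<beta>] sq]]
  note u1 = c1_holo_add[OF c1_holo_mult[OF sub(1) U] c1_holo_mult[OF c1_holo_mult[OF c1_holo_const[of "1/2"] c1_holo_mult[OF sub(4) i]] V]]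
  note u2 = c1_holo_mult[OF c1_holo_mult[OF c1_holo_const[of "1/2"] c1_holo_mult[OF sub(2) i]] V]
  note u3 = c1_holo_mult[OF sub(3) c1_holo_nth[of 3]]
  show ?thesis
  proof (rule germ_iso_3[OF N u1 u2 u3], goal_cases)
    case 4
    show ?case using r s t N by (simp add: det_3 axis_def N_def)
  next
    case (5 x)
    then have x: "x \<in> N1" "x \<in> N2" "x \<in> N3" by (auto simp: N_def)
    define U V where UV: "U = x $ 1 + \<alpha> * (x $ 3 * x $ 3)" "V = x $ 2 + \<beta> * (x $ 3 * x $ 3)"
    define i where "i = inverse (r x)"
    have i: "r x * i = 1" using r(5)[OF x(1)] by (simp add: i_def)
    have "(r x * U + 1 / 2 * (b x * i) * V) ^ 2 + (1 / 2 * (s x * i) * V) ^ 2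
      = r x ^ 2 * U ^ 2 + r x * i * b x * U * V + (b x ^ 2 + s x ^ 2) * i ^ 2 / 4 * V ^ 2"
      by (simp add: power2_eq_square algebra_simps)
    also have "(b x ^ 2 + s x ^ 2) * i ^ 2 / 4 = c x"
      using i unfolding s(4)[OF x(2)] r(4)[OF x(1), symmetric] by (simp add: power2_eq_square algebra_simps) algebra
    finally have "f x = (r x * U + 1 / 2 * (b x * i) * V) ^ 2 + (1 / 2 * (s x * i) * V) ^ 2 + (t x * x $ 3) ^ (k + 1)"
      unfolding f UV using i r(4)[OF x(1)] t(4)[OF x(3)] by (simp only: power_mult_distrib power2_eq_square[of "x $ 3"]) simp
    then show ?case by (simp add: UV i_def)
  qed (simp_all add: axis_def)
qed

text \<open>After the square is split off, the mixed term e x2^2 x3^2 is absorbed by replacing x2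
  with x2 + s x3^2, where 3 b s = e. What remains is V^3 + W^3, three distinct lines, which is
  linearly equivalent to the cubic part of the D_4 normal form.\<close>

lemma germ_iso_type_D4:
  fixes a b c e :: "complex ^ 3 \<Rightarrow> complex"
  assumes ent: "c1_entire a" "c1_entire b" "c1_entire c" "c1_entire e"
    and nz: "a 0 \<noteq> 0" "b 0 \<noteq> 0" "c 0 \<noteq> 0"
    and f: "\<And>x. f x = a x * (x $ 1 + \<alpha> * (x $ 2 * x $ 3)) ^ 2
        + b x * (x $ 2) ^ 3 + e x * (x $ 2) ^ 2 * (x $ 3) ^ 2 + c x * (x $ 3) ^ 3"
  shows "germ_iso f (normal_form (Type_D 4))"
proof -
  obtain N1 r R where r: "open N1" "0 \<in> N1" "c1_holo r R N1" "\<And>x. x \<in> N1 \<Longrightarrow> r x ^ 2 = a x" "\<And>x. x \<in> N1 \<Longrightarrow> r x \<noteq> 0"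
    using c1_entire_root[OF ent(1) nz(1), of 2] by auto
  obtain N2 p P where p: "open N2" "0 \<in> N2" "c1_holo p P N2" "\<And>x. x \<in> N2 \<Longrightarrow> p x ^ 3 = b x" "\<And>x. x \<in> N2 \<Longrightarrow> p x \<noteq> 0"
    using c1_entire_root[OF ent(2) nz(2), of 3] by auto
  obtain C E where C: "c1_holo c C UNIV" and E: "c1_holo e E UNIV" using ent(3,4) by (auto simp: c1_entire_def)
  have C2: "c1_holo c C N2" and E2: "c1_holo e E N2" using C E by (auto intro: c1_holo_subset)
  have p0: "\<forall>x\<in>N2. p x \<noteq> 0" using p by auto
  \<comment> \<open>This is e/(3b), written with the inverse of p because b = p^3 near 0.\<close>
  define s where "s = (\<lambda>x. 1 / 3 * e x * (inverse (p x) * (inverse (p x) * inverse (p x))))"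
  note i = c1_holo_inverse[OF p(3) p0]
  obtain S where S: "c1_holo s S N2"
    unfolding s_def using c1_holo_mult[OF c1_holo_mult[OF c1_holo_const[of "1/3"] E2] c1_holo_mult[OF i c1_holo_mult[OF i i]]] that by blast
  have s: "3 * b x * s x = e x" if "x \<in> N2" for x
    using p(5)[OF that] unfolding s_def p(4)[OF that, symmetric] by (simp add: field_simps power3_eq_cube)
  \<comment> \<open>Expanding b (x2 + s x3^2)^3 creates the extra terms 3 b s^2 x2 x3^4 and b s^3
    x3^6. Both are divisible by x3^3; with 3 b s = e they amount to the correction subtracted from
    c.\<close>
  let ?c = "\<lambda>x. c x + (- 1) * (e x * s x * (x $ 2 * x $ 3 + 1 / 3 * s x * (x $ 3 * (x $ 3 * x $ 3))))"
  note n3 = c1_holo_nth[of 3 N2]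
  obtain C' where C': "c1_holo ?c C' N2"
    using c1_holo_add[OF C2 c1_holo_mult[OF c1_holo_const[of "- 1"] c1_holo_mult[OF c1_holo_mult[OF E2 S]
       c1_holo_add[OF c1_holo_mult[OF c1_holo_nth[of 2] n3] c1_holo_mult[OF c1_holo_mult[OF c1_holo_const[of "1/3"] S] c1_holo_mult[OF n3 c1_holo_mult[OF n3 n3]]]]]]] that
    by blast
  have "?c 0 \<noteq> 0" using nz(3) by simp
  then obtain N3 q Q where q: "open N3" "0 \<in> N3" "N3 \<subseteq> N2" "c1_holo q Q N3" "\<And>x. x \<in> N3 \<Longrightarrow> q x ^ 3 = ?c x" "\<And>x. x \<in> N3 \<Longrightarrow> q x \<noteq> 0"
    using c1_holo_root[OF p(1,2) C', of 3] by auto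
  define N where "N = N1 \<inter> N2 \<inter> N3"
  have N: "open N" "0 \<in> N" using r p q by (auto simp: N_def)
  have sub: "c1_holo r R N" "c1_holo p P N" "c1_holo q Q N" "c1_holo s S N"
    using r p q S by (auto simp: N_def intro: c1_holo_subset)
  \<comment> \<open>The constants come from V^3 + W^3 = (V + W) (3/4 (V - W)^2 + 1/4 (V + W)^2): one
    needs \<open>\<kappa>\<close>^3 = 1/4 and \<open>\<mu>\<close>^2 \<open>\<kappa>\<close> =
    3/4.\<close>
  define \<kappa> where "\<kappa> = complex_of_real (root 3 (1/4))"
  have \<kappa>: "4 * \<kappa> ^ 3 = 1" unfolding \<kappa>_def of_real_power[symmetric] by simp
  then have "\<kappa> \<noteq> 0" by auto
  define \<mu> where "\<mu> = csqrt (3 / (4 * \<kappa>))"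
  have \<mu>: "4 * \<mu> ^ 2 * \<kappa> = 3" using \<open>\<kappa> \<noteq> 0\<close> by (simp add: \<mu>_def)
  then have "\<mu> \<noteq> 0" by auto
  note sq = c1_holo_mult[OF c1_holo_nth[of 3 N] c1_holo_nth[of 3 N]]
  note U = c1_holo_add[OF c1_holo_nth[of 1 N] c1_holo_mult[OF c1_holo_const[of \<alpha>] c1_holo_mult[OF c1_holo_nth[of 2 N] c1_holo_nth[of 3 N]]]]
  note V = c1_holo_add[OF c1_holo_nth[of 2 N] c1_holo_mult[OF sub(4) sq]]
  note pV = c1_holo_mult[OF sub(2) V]
  note qW = c1_holo_mult[OF sub(3) c1_holo_nth[of 3]]
  note u1 = c1_holo_mult[OF sub(1) U]
  note u2 = c1_holo_mult[OF c1_holo_const[of \<mu>] c1_holo_add[OF pV c1_holo_mult[OF c1_holo_const[of "-1"] qW]]]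
  note u3 = c1_holo_mult[OF c1_holo_const[of \<kappa>] c1_holo_add[OF pV qW]]
  show ?thesis
  proof (rule germ_iso_3[OF N u1 u2 u3], goal_cases)
    case 4
    have "r 0 \<noteq> 0" "p 0 \<noteq> 0" "q 0 \<noteq> 0" using r p q by auto
    then show ?case using \<open>\<kappa> \<noteq> 0\<close> \<open>\<mu> \<noteq> 0\<close> by (simp add: det_3 axis_def)
  next
    case (5 x)
    then have x: "x \<in> N1" "x \<in> N2" "x \<in> N3" by (auto simp: N_def)
    define V W where VW: "V = p x * (x $ 2 + s x * (x $ 3 * x $ 3))" "W = q x * x $ 3"
    have "(\<mu> * (V + - 1 * W)) ^ 2 * (\<kappa> * (V + W)) + (\<kappa> * (V + W)) ^ 3 = V ^ 3 + W ^ 3"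
      using \<kappa> \<mu> by algebra
    also have "\<dots> = b x * (x $ 2 + s x * (x $ 3 * x $ 3)) ^ 3 + ?c x * (x $ 3) ^ 3"
      unfolding VW power_mult_distrib p(4)[OF x(2)] q(5)[OF x(3)] by simp
    also have "\<dots> = b x * (x $ 2) ^ 3 + e x * (x $ 2) ^ 2 * (x $ 3) ^ 2 + c x * (x $ 3) ^ 3"
      unfolding s[OF x(2), symmetric] by algebra
    finally have "f x = (r x * (x $ 1 + \<alpha> * (x $ 2 * x $ 3))) ^ 2
      + ((\<mu> * (V + - 1 * W)) ^ 2 * (\<kappa> * (V + W)) + (\<kappa> * (V + W)) ^ 3)"
      unfolding f power_mult_distrib r(4)[OF x(1)] by (simp add: add.assoc)
    then show ?case by (simp add: VW)
  qed (simp_all add: axis_def)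
qed

section \<open>The 15 singular lines of the quintic\<close>

lemma double_root_singular:
  fixes x y z p :: complex
  defines "v \<equiv> vector [x, y, z, p, p] :: complex^5"
  assumes "grad_poly v x = 0" "grad_poly v y = 0" "grad_poly v z = 0" "grad_poly v p = 0"
  shows "x * (x - y - z) = 0"
proof -
  \<comment> \<open>Elimination certificate: the cube of the target lies in the ideal generated by
    the four distinct partial derivatives.\<close>
  have "2880 * (x * (x - y - z)) ^ 3 =
     (88*x^2 + (-80)*x*y + (-80)*x*z + (-20)*y^2 + 40*y*z + (-20)*z^2) * grad_poly v x
   + (25*x^2 + 118*x*y + 130*x*z + (-155)*y^2 + (-170)*y*z + (-155)*z^2) * grad_poly v y
   + (25*x^2 + 130*x*y + 118*x*z + (-155)*y^2 + (-170)*y*z + (-155)*z^2) * grad_poly v z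
   + ((-10)*x^2 + 560*x*y + 560*x*z + (-624)*x*p + (-910)*y^2 + (-1060)*y*z + 960*y*p + (-910)*z^2 + 960*z*p) * grad_poly v p"
    unfolding grad_poly_def el_defs v_def vector_5 by algebra
  then show ?thesis using assms by simp
qed

lemma grad_poly_cong:
  assumes "el1 v = el1 w" "el2 v = el2 w" "el3 v = el3 w" "el4 v = el4 w"
  shows "grad_poly v = grad_poly w"
  using assms by (simp add: grad_poly_def fun_eq_iff)

text \<open>The roles of x, y, z are interchangeable. The three relations x(x-y-z) = y(y-x-z) =
  z(z-x-y) = 0 cannot hold with x, y, z all nonzero, and once one of them is 0 the other two
  agree.\<close>

lemma double_root_singular_cases:
  fixes x y z p :: complex
  defines "v \<equiv> vector [x, y, z, p, p] :: complex^5"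
  assumes g: "grad_poly v x = 0" "grad_poly v y = 0" "grad_poly v z = 0" "grad_poly v p = 0"
  shows "x = 0 \<and> y = z \<or> y = 0 \<and> x = z \<or> z = 0 \<and> x = y"
proof -
  have "grad_poly v = grad_poly (vector [y, x, z, p, p])" "grad_poly v = grad_poly (vector [z, x, y, p, p])"
    unfolding v_def by (rule grad_poly_cong; simp add: el_defs algebra_simps)+
  then have "x * (x - y - z) = 0" "y * (y - x - z) = 0" "z * (z - x - y) = 0"
    using double_root_singular[of x y z p] double_root_singular[of y x z p] double_root_singular[of z x y p] g
    by (simp_all add: v_def)
  then show ?thesis by auto
qed

text \<open>The quartic has leading coefficient 128, so it has at most four roots and the five
  coordinates of a singular point cannot all differ.\<close>

lemma quartic_no_five_distinct_roots:
  assumes "\<And>i :: 5. grad_poly v (v $ i) = 0"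
  shows "\<not> inj (\<lambda>i. v $ i)"
proof
  assume inj: "inj (\<lambda>i. v $ i)"
  define P where "P = [:64 * el4 v - 32 * el1 v * el3 v - 16 * el2 v ^ 2 + 24 * el1 v ^ 2 * el2 v - 5 * el1 v ^ 4,
    - (64 * el3 v - 32 * el1 v * el2 v + 8 * el1 v ^ 3), 64 * el2 v - 16 * el1 v ^ 2, - 64 * el1 v, 128:]"
  have P: "poly P T = grad_poly v T" for T
    unfolding P_def grad_poly_def by simp algebra
  have "P \<noteq> 0" "degree P = 4" by (simp_all add: P_def)
  then have "card {T. poly P T = 0} \<le> 4" "finite {T. poly P T = 0}"
    using card_poly_roots_bound[of P] poly_roots_finite[of P] by auto
  moreover have "range (\<lambda>i. v $ i) \<subseteq> {T. poly P T = 0}" using assms by (auto simp: P)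
  ultimately have "card (range (\<lambda>i. v $ i)) \<le> 4" using card_mono order_trans by blast
  then show False using card_image[OF inj] by simp
qed

text \<open>The 15 lines \<open>v\<^sub>i = 0, v\<^sub>j = v\<^sub>k, v\<^sub>l = v\<^sub>m\<close>.\<close>

definition cusp_lines :: "(5 \<times> 5 \<times> 5 \<times> 5 \<times> 5) set" where
  "cusp_lines = {(1,2,3,4,5), (1,2,4,3,5), (1,2,5,3,4), (2,1,3,4,5), (2,1,4,3,5), (2,1,5,3,4),
    (3,1,2,4,5), (3,1,4,2,5), (3,1,5,2,4), (4,1,2,3,5), (4,1,3,2,5), (4,1,5,2,3),
    (5,1,2,3,4), (5,1,3,2,4), (5,1,4,2,3)}"

lemma card_cusp_lines: "card cusp_lines = 15"
  by (simp add: cusp_lines_def)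

lemma singular_quintic_on_cusp_line:
  assumes g: "\<And>i :: 5. grad_poly v (v $ i) = 0"
  obtains i j k l m where "(i, j, k, l, m) \<in> cusp_lines" "v $ i = 0" "v $ j = v $ k" "v $ l = v $ m"
proof -
  \<comment> \<open>\<open>grad_poly\<close> depends on v only through symmetric functions, so any
    pair of equal coordinates may be moved to the last two places.\<close>
  have pair: "x = 0 \<and> y = z \<or> y = 0 \<and> x = z \<or> z = 0 \<and> x = y"
    if "grad_poly v x = 0" "grad_poly v y = 0" "grad_poly v z = 0" "grad_poly v p = 0"
      "grad_poly v = grad_poly (vector [x, y, z, p, p])" for x y z p
    using double_root_singular_cases[of x y z p] that by metis
  have pair45: "v $ 4 = v $ 5 \<Longrightarrow> v $ 1 = 0 \<and> v $ 2 = v $ 3 \<or> v $ 2 = 0 \<and> v $ 1 = v $ 3 \<or> v $ 3 = 0 \<and> v $ 1 = v $ 2"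
    by (rule pair[of _ _ _ "v $ 5"]) (auto simp: g intro!: grad_poly_cong simp: el_defs algebra_simps)
  have pair12: "v $ 1 = v $ 2 \<Longrightarrow> v $ 3 = 0 \<and> v $ 4 = v $ 5 \<or> v $ 4 = 0 \<and> v $ 3 = v $ 5 \<or> v $ 5 = 0 \<and> v $ 3 = v $ 4"
    by (rule pair[of _ _ _ "v $ 2"]) (auto simp: g intro!: grad_poly_cong simp: el_defs algebra_simps)
  have pair13: "v $ 1 = v $ 3 \<Longrightarrow> v $ 2 = 0 \<and> v $ 4 = v $ 5 \<or> v $ 4 = 0 \<and> v $ 2 = v $ 5 \<or> v $ 5 = 0 \<and> v $ 2 = v $ 4"
    by (rule pair[of _ _ _ "v $ 3"]) (auto simp: g intro!: grad_poly_cong simp: el_defs algebra_simps)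
  have pair14: "v $ 1 = v $ 4 \<Longrightarrow> v $ 2 = 0 \<and> v $ 3 = v $ 5 \<or> v $ 3 = 0 \<and> v $ 2 = v $ 5 \<or> v $ 5 = 0 \<and> v $ 2 = v $ 3"
    by (rule pair[of _ _ _ "v $ 4"]) (auto simp: g intro!: grad_poly_cong simp: el_defs algebra_simps)
  have pair15: "v $ 1 = v $ 5 \<Longrightarrow> v $ 2 = 0 \<and> v $ 3 = v $ 4 \<or> v $ 3 = 0 \<and> v $ 2 = v $ 4 \<or> v $ 4 = 0 \<and> v $ 2 = v $ 3"
    by (rule pair[of _ _ _ "v $ 5"]) (auto simp: g intro!: grad_poly_cong simp: el_defs algebra_simps)
  have pair23: "v $ 2 = v $ 3 \<Longrightarrow> v $ 1 = 0 \<and> v $ 4 = v $ 5 \<or> v $ 4 = 0 \<and> v $ 1 = v $ 5 \<or> v $ 5 = 0 \<and> v $ 1 = v $ 4"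
    by (rule pair[of _ _ _ "v $ 3"]) (auto simp: g intro!: grad_poly_cong simp: el_defs algebra_simps)
  have pair24: "v $ 2 = v $ 4 \<Longrightarrow> v $ 1 = 0 \<and> v $ 3 = v $ 5 \<or> v $ 3 = 0 \<and> v $ 1 = v $ 5 \<or> v $ 5 = 0 \<and> v $ 1 = v $ 3"
    by (rule pair[of _ _ _ "v $ 4"]) (auto simp: g intro!: grad_poly_cong simp: el_defs algebra_simps)
  have pair25: "v $ 2 = v $ 5 \<Longrightarrow> v $ 1 = 0 \<and> v $ 3 = v $ 4 \<or> v $ 3 = 0 \<and> v $ 1 = v $ 4 \<or> v $ 4 = 0 \<and> v $ 1 = v $ 3"
    by (rule pair[of _ _ _ "v $ 5"]) (auto simp: g intro!: grad_poly_cong simp: el_defs algebra_simps)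
  have pair34: "v $ 3 = v $ 4 \<Longrightarrow> v $ 1 = 0 \<and> v $ 2 = v $ 5 \<or> v $ 2 = 0 \<and> v $ 1 = v $ 5 \<or> v $ 5 = 0 \<and> v $ 1 = v $ 2"
    by (rule pair[of _ _ _ "v $ 4"]) (auto simp: g intro!: grad_poly_cong simp: el_defs algebra_simps)
  have pair35: "v $ 3 = v $ 5 \<Longrightarrow> v $ 1 = 0 \<and> v $ 2 = v $ 4 \<or> v $ 2 = 0 \<and> v $ 1 = v $ 4 \<or> v $ 4 = 0 \<and> v $ 1 = v $ 2"
    by (rule pair[of _ _ _ "v $ 5"]) (auto simp: g intro!: grad_poly_cong simp: el_defs algebra_simps)
  obtain i j where ij: "v $ i = v $ j" "i \<noteq> j"
    using quartic_no_five_distinct_roots[OF g] by (auto simp: inj_def)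
  have ex: "v $ 1 = v $ 2 \<or> v $ 1 = v $ 3 \<or> v $ 1 = v $ 4 \<or> v $ 1 = v $ 5 \<or> v $ 2 = v $ 3 \<or> v $ 2 = v $ 4 \<or> v $ 2 = v $ 5
     \<or> v $ 3 = v $ 4 \<or> v $ 3 = v $ 5 \<or> v $ 4 = v $ 5"
    using exhaust_5[of i] exhaust_5[of j] ij by (elim disjE) auto
  have "\<exists>(i, j, k, l, m)\<in>cusp_lines. v $ i = 0 \<and> v $ j = v $ k \<and> v $ l = v $ m"
    unfolding cusp_lines_def using ex
    by (elim disjE) (use pair12 pair13 pair14 pair15 pair23 pair24 pair25 pair34 pair35 pair45 in \<open>auto\<close>)
  then show ?thesis using that by blast
qed

section \<open>Intersection of the singular lines with a hyperplane\<close>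

text \<open>On the line with coordinates 0, (s,s), (t,t) the hyperplane equation is (a_j + a_k) s +
  (a_l + a_m) t = 0; this picks the solution s = a_l + a_m, t = -(a_j + a_k).\<close>

definition cusp_point :: "complex^5 \<Rightarrow> 5 \<times> 5 \<times> 5 \<times> 5 \<times> 5 \<Rightarrow> complex^5" where
  "cusp_point a = (\<lambda>(i, j, k, l, m). \<chi> n. if n = i then 0 else if n = j \<or> n = k then a $ l + a $ m else - (a $ j + a $ k))"

text \<open>The three inequalities say that on each line the cusp point has s nonzero, t nonzero and
  s different from t. The excluded positions, such as (0,0,0,1,1) and (0,1,1,1,1), are the points
  where three of the lines meet.\<close>

definition transversal_to_cusp_lines :: "complex^5 \<Rightarrow> bool" where
  "transversal_to_cusp_lines a \<longleftrightarrow> (\<forall>(i, j, k, l, m)\<in>cusp_lines.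
     a $ j + a $ k \<noteq> 0 \<and> a $ l + a $ m \<noteq> 0 \<and> a $ j + a $ k + a $ l + a $ m \<noteq> 0)"

lemma cusp_lines_distinct:
  assumes "(i, j, k, l, m) \<in> cusp_lines" shows "distinct [i, j, k, l, m]"
  using assms unfolding cusp_lines_def by auto

lemma cusp_lines_cover:
  assumes "(i, j, k, l, m) \<in> cusp_lines"
  shows "UNIV = {i, j, k, l, m}"
proof -
  have "card {i, j, k, l, m} = CARD(5)" using cusp_lines_distinct[OF assms] by simp
  then show ?thesis by (metis card_subset_eq finite subset_UNIV)
qed

lemma cusp_lines_sum:
  assumes "(i, j, k, l, m) \<in> cusp_lines"
  shows "(\<Sum>n\<in>UNIV. f n) = (f i + f j + f k + f l + f m :: complex)"
  unfolding cusp_lines_cover[OF assms] using cusp_lines_distinct[OF assms] by (simp add: add.assoc)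

lemma cusp_point_in_hyperplane:
  assumes "t \<in> cusp_lines" shows "cusp_point a t \<in> hyperplane a"
proof -
  obtain i j k l m where t: "t = (i, j, k, l, m)" by (cases t) auto
  show ?thesis
    using cusp_lines_distinct[OF assms[unfolded t]]
    by (auto simp: hyperplane_def cusp_lines_sum[OF assms[unfolded t]] t cusp_point_def algebra_simps)
qed

lemma span_scale_singleton:
  fixes v :: "complex^'n"
  assumes "c \<noteq> 0" shows "vec.span {c *s v} = vec.span {v}"
proof -
  have "(1 / c) *s (c *s v) \<in> vec.span {c *s v}" by (intro vec.span_scale vec.span_base) simp
  then have "v \<in> vec.span {c *s v}" using assms by simp
  moreover have "c *s v \<in> vec.span {v}" by (intro vec.span_scale vec.span_base) simp
  ultimately show ?thesis by (simp add: vec.span_eq)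
qed

lemma singular_point_is_cusp_point:
  assumes a: "transversal_to_cusp_lines a" and v: "v \<in> hyperplane a" "v \<noteq> 0"
    and g: "\<And>i. grad_poly v (v $ i) = 0"
  obtains t where "t \<in> cusp_lines" "vec.span {v} = vec.span {cusp_point a t}"
proof -
  obtain i j k l m where t: "(i, j, k, l, m) \<in> cusp_lines" "v $ i = 0" "v $ j = v $ k" "v $ l = v $ m"
    using singular_quintic_on_cusp_line[OF g] by blast
  have cov: "n = i \<or> n = j \<or> n = k \<or> n = l \<or> n = m" for n
    using cusp_lines_cover[OF t(1)] by auto
  have nz: "a $ j + a $ k \<noteq> 0" "a $ l + a $ m \<noteq> 0" using a t(1) by (auto simp: transversal_to_cusp_lines_def)
  have H: "(a $ j + a $ k) * v $ k + (a $ l + a $ m) * v $ m = 0"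
    using v(1) t by (simp add: hyperplane_def cusp_lines_sum[OF t(1)] algebra_simps)
  \<comment> \<open>The scale factor between v and the cusp point is read off at a coordinate where
    the latter is known to be nonzero.\<close>
  define c where "c = v $ k / (a $ l + a $ m)"
  have vk: "v $ k = c * (a $ l + a $ m)" using nz by (simp add: c_def)
  then have "(a $ l + a $ m) * (c * (a $ j + a $ k) + v $ m) = 0" using H by (simp add: algebra_simps)
  then have vm: "v $ m = - c * (a $ j + a $ k)" using nz by (simp add: eq_neg_iff_add_eq_0 add.commute)
  have vc: "v = c *s cusp_point a (i, j, k, l, m)"
  proof (rule vec_eq_iff[THEN iffD2], rule allI)
    fix n
    show "v $ n = (c *s cusp_point a (i, j, k, l, m)) $ n"
      using cusp_lines_distinct[OF t(1)] cov[of n] t(2-4) vk vm by (auto simp: cusp_point_def algebra_simps)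
  qed
  then have "c \<noteq> 0" using v(2) by auto
  have "vec.span {v} = vec.span {cusp_point a (i, j, k, l, m)}"
    unfolding vc by (rule span_scale_singleton[OF \<open>c \<noteq> 0\<close>])
  then show ?thesis using that t(1) by blast
qed

text \<open>For coordinates 0, p, p, q, q the quartic factors as 128 T^2 (T - p) (T - q), so it
  vanishes at every coordinate.\<close>

lemma cusp_point_singular:
  assumes "t \<in> cusp_lines" shows "grad_poly (cusp_point a t) (cusp_point a t $ n) = 0"
proof -
  have *: "grad_poly w 0 = 0 \<and> grad_poly w p = 0 \<and> grad_poly w q = 0"
    if "el1 w = 2 * p + 2 * q" "el2 w = p ^ 2 + q ^ 2 + 4 * p * q" "el3 w = 2 * p ^ 2 * q + 2 * q ^ 2 * p" "el4 w = p ^ 2 * q ^ 2"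
    for w p q
    unfolding grad_poly_def that by (simp add: algebra_simps power2_eq_square power3_eq_cube power4_eq_xxxx)
  obtain i j k l m where t: "t = (i, j, k, l, m)" by (cases t) auto
  have "el1 (cusp_point a t) = 2 * (a $ l + a $ m) + 2 * - (a $ j + a $ k)"
     "el2 (cusp_point a t) = (a $ l + a $ m) ^ 2 + (- (a $ j + a $ k)) ^ 2 + 4 * (a $ l + a $ m) * - (a $ j + a $ k)"
     "el3 (cusp_point a t) = 2 * (a $ l + a $ m) ^ 2 * - (a $ j + a $ k) + 2 * (- (a $ j + a $ k)) ^ 2 * (a $ l + a $ m)"
     "el4 (cusp_point a t) = (a $ l + a $ m) ^ 2 * (- (a $ j + a $ k)) ^ 2"
    using assms unfolding t cusp_lines_def by (elim insertE emptyE; simp add: el_defs cusp_point_def power2_eq_square algebra_simps)+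
  from *[OF this] show ?thesis unfolding t by (auto simp: cusp_point_def)
qed

text \<open>The line can be recovered from the projective point: i is the only vanishing coordinate,
  and the pairs {j,k} and {l,m} are the classes of equal coordinates.\<close>

lemma inj_on_span_cusp_point:
  assumes a: "transversal_to_cusp_lines a"
  shows "inj_on (\<lambda>t. vec.span {cusp_point a t}) cusp_lines"
proof (rule inj_onI)
  fix t t' assume t: "t \<in> cusp_lines" "t' \<in> cusp_lines" and eq: "vec.span {cusp_point a t} = vec.span {cusp_point a t'}"
  obtain i j k l m where [simp]: "t = (i, j, k, l, m)" by (cases t) auto
  obtain i' j' k' l' m' where [simp]: "t' = (i', j', k', l', m')" by (cases t') auto
  let ?p = "cusp_point a t" and ?p' = "cusp_point a t'"
  have zero: "cusp_point a (i, j, k, l, m) $ n = 0 \<longleftrightarrow> n = i"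
    and pair: "cusp_point a (i, j, k, l, m) $ n = cusp_point a (i, j, k, l, m) $ j \<longleftrightarrow> n = j \<or> n = k"
    if "(i, j, k, l, m) \<in> cusp_lines" for i j k l m n
  proof -
    have *: "a $ j + a $ k \<noteq> 0" "a $ l + a $ m \<noteq> 0" "a $ j + a $ k + a $ l + a $ m \<noteq> 0"
      using a that by (auto simp: transversal_to_cusp_lines_def)
    then have "a $ l + a $ m \<noteq> - (a $ j + a $ k)" by (auto simp: eq_neg_iff_add_eq_0 add_ac)
    then show "cusp_point a (i, j, k, l, m) $ n = 0 \<longleftrightarrow> n = i"
      "cusp_point a (i, j, k, l, m) $ n = cusp_point a (i, j, k, l, m) $ j \<longleftrightarrow> n = j \<or> n = k"
      using * cusp_lines_distinct[OF that]
      by (auto simp: cusp_point_def neg_equal_0_iff_equal simp del: minus_add_distrib)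
  qed
  have "?p \<in> vec.span {?p'}" unfolding eq[symmetric] by (simp add: vec.span_base)
  then obtain c where c: "?p = c *s ?p'" by (auto simp: vec.span_singleton)
  have "c \<noteq> 0"
    using c zero[of i j k l m j] t cusp_lines_distinct[of i j k l m] by auto
  have "i = i'" using zero[of i j k l m i] zero[of i' j' k' l' m' i] t \<open>c \<noteq> 0\<close> arg_cong[OF c, of "\<lambda>v. v $ i"] by simp
  then have "j = j'" using t by (auto simp: cusp_lines_def)
  have "?p $ k = ?p $ j" using pair[of i j k l m k] t by simp
  then have "?p' $ k = ?p' $ j'" using c \<open>c \<noteq> 0\<close> \<open>j = j'\<close> by simp
  then have "k = k'"
    using pair[of i' j' k' l' m' k] t \<open>j = j'\<close> cusp_lines_distinct[of i j k l m] by auto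
  then show "t = t'" using t \<open>i = i'\<close> by (auto simp: cusp_lines_def)
qed

section \<open>Type A_2 at the cusp points\<close>

text \<open>To see that p, b1, b2, b3 span the hyperplane it is enough that they span everything
  together with one vector e outside it: the coefficient of e must vanish for a vector of the
  hyperplane.\<close>

lemma has_sing_typeI:
  fixes a :: "complex^5"
  assumes H: "p \<in> hyperplane a" "b1 \<in> hyperplane a" "b2 \<in> hyperplane a" "b3 \<in> hyperplane a"
    and e: "(\<Sum>i\<in>UNIV. a $ i * e $ i) \<noteq> 0"
    and span: "\<And>w. \<exists>c0 c1 c2 c3 s. w = c0 *s p + c1 *s b1 + c2 *s b2 + c3 *s b3 + s *s e"
    and germ: "germ_iso (\<lambda>x. quintic (p + (x $ 1 *s b1 + x $ 2 *s b2 + x $ 3 *s b3))) (normal_form T)"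
  shows "has_sing_type quintic (hyperplane a) (vec.span {p}) T"
proof -
  let ?b = "\<lambda>k :: 3. if k = 1 then b1 else if k = 2 then b2 else b3"
  have rb: "range ?b = {b1, b2, b3}"
    unfolding UNIV_3 by auto
  have "w \<in> vec.span {p, b1, b2, b3}" if w: "w \<in> hyperplane a" for w
  proof -
    obtain c0 c1 c2 c3 s where c: "w = c0 *s p + c1 *s b1 + c2 *s b2 + c3 *s b3 + s *s e" using span by blast
    let ?u = "c0 *s p + c1 *s b1 + c2 *s b2 + c3 *s b3"
    have u: "?u \<in> hyperplane a"
      using H subspace_hyperplane by (intro vec.subspace_add vec.subspace_scale) auto
    have "(\<Sum>i\<in>UNIV. a $ i * w $ i) = (\<Sum>i\<in>UNIV. a $ i * ?u $ i) + s * (\<Sum>i\<in>UNIV. a $ i * e $ i)"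
      unfolding c by (simp add: distrib_left sum.distrib sum_distrib_left mult.left_commute)
    then have "s = 0" using u w e by (simp add: hyperplane_def)
    then have "w = ?u" using c by simp
    moreover have "?u \<in> vec.span {p, b1, b2, b3}"
      by (intro vec.span_add vec.span_scale vec.span_base) simp_all
    ultimately show ?thesis by (rule ssubst)
  qed
  moreover have "vec.span {p, b1, b2, b3} \<subseteq> hyperplane a"
    by (rule vec.span_minimal) (use H subspace_hyperplane in auto)
  ultimately have "vec.span (insert p (range ?b)) = hyperplane a" unfolding rb by auto
  moreover have "(\<lambda>x. quintic (p + (x $ 1 *s b1 + x $ 2 *s b2 + x $ 3 *s b3))) = (\<lambda>x. quintic (p + (\<Sum>i\<in>UNIV. x $ i *s ?b i)))"
    by (simp add: sum_3)
  ultimately show ?thesis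
    unfolding has_sing_type_def local_equation_def using germ by blast
qed

text \<open>In the coordinates (X, A' + Y, A' - Y, B + Z, B - Z) the quintic is even in Y and in Z,
  and for Y = Z = 0 it is divisible by X^3. It therefore has the form a Y^2 + c Z^2 + d X^3 with
  coefficient functions that are nonzero at the cusp point.\<close>

lemma has_sing_type_cusp_12345:
  fixes a :: "complex^5"
  assumes nz: "a $ 2 + a $ 3 \<noteq> 0" "a $ 4 + a $ 5 \<noteq> 0" "a $ 2 + a $ 3 + a $ 4 + a $ 5 \<noteq> 0"
  shows "has_sing_type quintic (hyperplane a) (vec.span {cusp_point a (1,2,3,4,5)}) (Type_A 2)"
proof -
  define A where "A = a $ 4 + a $ 5"
  define B where "B = - (a $ 2 + a $ 3)"
  have "A - B = a $ 2 + a $ 3 + a $ 4 + a $ 5" by (simp add: A_def B_def)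
  then have "A - B \<noteq> 0" using nz(3) by metis
  moreover have "A \<noteq> 0" using nz(2) unfolding A_def .
  moreover have "B \<noteq> 0" using nz(1) unfolding B_def neg_equal_0_iff_equal .
  ultimately have AB: "A \<noteq> 0" "B \<noteq> 0" "A - B \<noteq> 0" by metis+
  \<comment> \<open>These slopes make the three chart directions lie in the hyperplane; the
    correction is put into the second and third coordinates, whose coefficients add up to
    -B.\<close>
  define k1 where "k1 = (a $ 2 - a $ 3) / B"
  define k2 where "k2 = (a $ 4 - a $ 5) / B"
  define k3 where "k3 = a $ 1 / B"
  have a_eq: "a $ 1 = k3 * B" "a $ 2 - a $ 3 = k1 * B" "a $ 4 - a $ 5 = k2 * B" "a $ 2 + a $ 3 = - B"
    using AB by (simp_all add: k1_def k2_def k3_def B_def)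
  let ?p = "vector [0, A, A, B, B] :: complex^5"
  let ?b1 = "vector [0, 1 + k1, k1 - 1, 0, 0] :: complex^5"
  let ?b2 = "vector [0, k2, k2, 1, - 1] :: complex^5"
  let ?b3 = "vector [1, k3, k3, 0, 0] :: complex^5"
  let ?e = "vector [0, 1, 1, 0, 0] :: complex^5"
  have p: "cusp_point a (1,2,3,4,5) = ?p"
    by (simp add: vec_eq_iff forall_5 cusp_point_def A_def B_def)
  let ?A = "\<lambda>x :: complex^3. A + k1 * x $ 1 + k2 * x $ 2 + k3 * x $ 3"
  let ?a = "\<lambda>x. - 8 * (x $ 3) ^ 3 - 16 * (x $ 3) ^ 2 * ?A x + 16 * (x $ 3) ^ 2 * B - 16 * x $ 3 * (x $ 1) ^ 2 + 32 * x $ 3 * (x $ 2) ^ 2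
    - 64 * x $ 3 * ?A x ^ 2 + 64 * x $ 3 * ?A x * B + 96 * (x $ 1) ^ 2 * ?A x - 32 * (x $ 1) ^ 2 * B - 64 * (x $ 2) ^ 2 * ?A x
    - 64 * (x $ 2) ^ 2 * B + 128 * ?A x ^ 3 - 128 * ?A x ^ 2 * B"
  let ?c = "\<lambda>x. - 8 * (x $ 3) ^ 3 + 16 * (x $ 3) ^ 2 * ?A x - 16 * (x $ 3) ^ 2 * B - 16 * x $ 3 * (x $ 2) ^ 2 + 64 * x $ 3 * ?A x * B
    - 64 * x $ 3 * B ^ 2 - 32 * (x $ 2) ^ 2 * ?A x + 96 * (x $ 2) ^ 2 * B - 128 * ?A x * B ^ 2 + 128 * B ^ 3"
  let ?d = "\<lambda>x. 7 * (x $ 3) ^ 2 - 10 * x $ 3 * ?A x - 10 * x $ 3 * B + 16 * ?A x * B"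
  show ?thesis unfolding p
  proof (rule has_sing_typeI[where e = ?e])
    show "?p \<in> hyperplane a" by (simp add: hyperplane_def sum_5 A_def B_def algebra_simps)
    show "?b1 \<in> hyperplane a" "?b2 \<in> hyperplane a" "?b3 \<in> hyperplane a"
      using a_eq by (simp_all add: hyperplane_def sum_5) algebra+
    show "(\<Sum>i\<in>UNIV. a $ i * ?e $ i) \<noteq> 0" using AB a_eq by (simp add: sum_5)
    fix w :: "complex^5"
    let ?c0 = "(w $ 4 + w $ 5) / (2 * B)" and ?c1 = "(w $ 2 - w $ 3) / 2" and ?c2 = "(w $ 4 - w $ 5) / 2"
    show "\<exists>c0 c1 c2 c3 s. w = c0 *s ?p + c1 *s ?b1 + c2 *s ?b2 + c3 *s ?b3 + s *s ?e"
      using AB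
      by (intro exI[of _ ?c0] exI[of _ ?c1] exI[of _ ?c2] exI[of _ "w $ 1"]
          exI[of _ "(w $ 2 + w $ 3) / 2 - ?c0 * A - ?c1 * k1 - ?c2 * k2 - w $ 1 * k3"])
        (simp add: vec_eq_iff forall_5 field_simps)
  next
    show "germ_iso (\<lambda>x. quintic (?p + (x $ 1 *s ?b1 + x $ 2 *s ?b2 + x $ 3 *s ?b3))) (normal_form (Type_A 2))"
    proof (rule germ_iso_type_A[where a = ?a and b = "\<lambda>x. 0" and c = ?c and d = ?d and \<alpha> = 0 and \<beta> = 0])
      show "c1_entire ?a" "c1_entire ?c" "c1_entire ?d" "c1_entire (\<lambda>x :: complex^3. 0)" by (intro c1_entire_intros)+
      \<comment> \<open>Here the three transversality conditions are exactly what makes the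
        coefficients nonzero at the origin.\<close>
      have 1: "?a 0 = 128 * A ^ 2 * (A - B)" "?c 0 = - 128 * B ^ 2 * (A - B)" "?d 0 = 16 * A * B"
        by (simp_all add: algebra_simps power2_eq_square power3_eq_cube)
      show "?a 0 \<noteq> 0" "?d 0 \<noteq> 0" "4 * ?a 0 * ?c 0 \<noteq> 0 ^ 2" unfolding 1 using AB by simp_all
      fix x :: "complex^3"
      define Y Z X where XYZ: "Y = x $ 1" "Z = x $ 2" "X = x $ 3"
      have "?p + (x $ 1 *s ?b1 + x $ 2 *s ?b2 + x $ 3 *s ?b3) = vector [X, A + k1 * Y + k2 * Z + k3 * X + Y, A + k1 * Y + k2 * Z + k3 * X - Y, B + Z, B - Z]"
        unfolding XYZ by (simp add: vec_eq_iff forall_5 algebra_simps)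
      then have "quintic (?p + (x $ 1 *s ?b1 + x $ 2 *s ?b2 + x $ 3 *s ?b3)) = quintic (vector [X, A + k1 * Y + k2 * Z + k3 * X + Y, A + k1 * Y + k2 * Z + k3 * X - Y, B + Z, B - Z])"
        by simp
      also have "\<dots> = ?a x * Y ^ 2 + ?c x * Z ^ 2 + ?d x * X ^ 3"
        unfolding quintic_el el_defs vector_5 XYZ[symmetric] by algebra
      finally show "quintic (?p + (x $ 1 *s ?b1 + x $ 2 *s ?b2 + x $ 3 *s ?b3)) = ?a x * (x $ 1 + 0 * (x $ 3) ^ 2) ^ 2
        + 0 * (x $ 1 + 0 * (x $ 3) ^ 2) * (x $ 2 + 0 * (x $ 3) ^ 2) + ?c x * (x $ 2 + 0 * (x $ 3) ^ 2) ^ 2 + ?d x * (x $ 3) ^ (2 + 1)"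
        by (simp add: XYZ)
    qed
  qed
qed

lemma has_sing_type_cusp_point:
  assumes a: "transversal_to_cusp_lines a" and t: "t \<in> cusp_lines"
  shows "has_sing_type quintic (hyperplane a) (vec.span {cusp_point a t}) (Type_A 2)"
proof -
  obtain i j k l m where tt: "t = (i, j, k, l, m)" by (cases t) auto
  have t': "(i, j, k, l, m) \<in> cusp_lines" using t tt by simp
  note d = cusp_lines_distinct[OF t']
  have cov: "n = i \<or> n = j \<or> n = k \<or> n = l \<or> n = m" for n
    using cusp_lines_cover[OF t'] by auto
  \<comment> \<open>\<open>\<sigma>\<close> carries the given line to the one with vanishing first
    coordinate and pairs {2,3} and {4,5}.\<close>
  define \<sigma> :: "5 \<Rightarrow> 5" where "\<sigma> = (\<lambda>n. if n = i then 1 else if n = j then 2 else if n = k then 3 else if n = l then 4 else 5)"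
  have s: "\<sigma> i = 1" "\<sigma> j = 2" "\<sigma> k = 3" "\<sigma> l = 4" "\<sigma> m = 5" using d by (auto simp: \<sigma>_def)
  have "surj \<sigma>" unfolding surj_def
    by (metis exhaust_5 s)
  then have b: "bij \<sigma>" by (simp add: bij_def finite_UNIV_surj_inj)
  let ?a = "vector [a $ i, a $ j, a $ k, a $ l, a $ m] :: complex^5"
  have 1: "permute_coords \<sigma> ?a = a"
  proof (rule vec_eq_iff[THEN iffD2], rule allI)
    fix n show "permute_coords \<sigma> ?a $ n = a $ n" using cov[of n] s by (auto simp: permute_coords_def)
  qed
  have 2: "permute_coords \<sigma> (cusp_point ?a (1,2,3,4,5)) = cusp_point a t"
  proof (rule vec_eq_iff[THEN iffD2], rule allI)
    fix n show "permute_coords \<sigma> (cusp_point ?a (1,2,3,4,5)) $ n = cusp_point a t $ n"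
      using cov[of n] s d by (auto simp: permute_coords_def cusp_point_def tt)
  qed
  have "has_sing_type quintic (hyperplane ?a) (vec.span {cusp_point ?a (1,2,3,4,5)}) (Type_A 2)"
    using a t' by (intro has_sing_type_cusp_12345) (auto simp: transversal_to_cusp_lines_def)
  from has_sing_type_permute_coords[OF b this] show ?thesis unfolding 1 2 .
qed

section \<open>Elimination identities for the points of tangency\<close>

text \<open>The quartic \<open>grad_poly\<close>, with the symmetric functions as independent
  arguments so that they can be expressed in whatever unknowns suit the case.\<close>

definition gradp :: "complex \<Rightarrow> complex \<Rightarrow> complex \<Rightarrow> complex \<Rightarrow> complex \<Rightarrow> complex" where
  "gradp e1 e2 e3 e4 T = 128 * T ^ 4 - 64 * e1 * T ^ 3 + (64 * e2 - 16 * e1 ^ 2) * T ^ 2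
     - (64 * e3 - 32 * e1 * e2 + 8 * e1 ^ 3) * T
     + (64 * e4 - 32 * e1 * e3 - 16 * e2 ^ 2 + 24 * e1 ^ 2 * e2 - 5 * e1 ^ 4)"

text \<open>First divided difference of the quartic at two points with sum S and product m. Together
  with \<open>rem2\<close> it gives the remainder T \<open>dd2\<close> + \<open>rem2\<close> modulo
  T^2 - S T + m.\<close>

definition dd2 :: "complex \<Rightarrow> complex \<Rightarrow> complex \<Rightarrow> complex \<Rightarrow> complex \<Rightarrow> complex" where
  "dd2 e1 e2 e3 S m = 128 * (S ^ 3 - 2 * S * m) - 64 * e1 * (S ^ 2 - m) + (64 * e2 - 16 * e1 ^ 2) * S
     - (64 * e3 - 32 * e1 * e2 + 8 * e1 ^ 3)"

definition rem2 :: "complex \<Rightarrow> complex \<Rightarrow> complex \<Rightarrow> complex \<Rightarrow> complex \<Rightarrow> complex \<Rightarrow> complex" where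
  "rem2 e1 e2 e3 e4 S m = (64 * e4 - 32 * e1 * e3 - 16 * e2 ^ 2 + 24 * e1 ^ 2 * e2 - 5 * e1 ^ 4)
     - m * (128 * (S ^ 2 - m) - 64 * e1 * S + (64 * e2 - 16 * e1 ^ 2))"

text \<open>For q^2 = d the value of the quartic at u + q w is \<open>tw0\<close> + q
  \<open>tw1\<close>, and at u - q w it is \<open>tw0\<close> - q \<open>tw1\<close>.\<close>

definition tw0 :: "complex \<Rightarrow> complex \<Rightarrow> complex \<Rightarrow> complex \<Rightarrow> complex \<Rightarrow> complex \<Rightarrow> complex \<Rightarrow> complex" where
  "tw0 e1 e2 e3 e4 d u w = 128 * (u ^ 4 + 6 * d * u ^ 2 * w ^ 2 + d ^ 2 * w ^ 4) - 64 * e1 * (u ^ 3 + 3 * d * u * w ^ 2)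
     + (64 * e2 - 16 * e1 ^ 2) * (u ^ 2 + d * w ^ 2) - (64 * e3 - 32 * e1 * e2 + 8 * e1 ^ 3) * u
     + (64 * e4 - 32 * e1 * e3 - 16 * e2 ^ 2 + 24 * e1 ^ 2 * e2 - 5 * e1 ^ 4)"

definition tw1 :: "complex \<Rightarrow> complex \<Rightarrow> complex \<Rightarrow> complex \<Rightarrow> complex \<Rightarrow> complex \<Rightarrow> complex \<Rightarrow> complex" where
  "tw1 e1 e2 e3 e4 d u w = 128 * (4 * u ^ 3 * w + 4 * d * u * w ^ 3) - 64 * e1 * (3 * u ^ 2 * w + d * w ^ 3)
     + (64 * e2 - 16 * e1 ^ 2) * (2 * u * w) - (64 * e3 - 32 * e1 * e2 + 8 * e1 ^ 3) * w"

text \<open>\<open>quad3\<close>, \<open>lin3\<close> and \<open>const3\<close> are the coefficients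
  of the remainder of the quartic modulo T^3 - S T^2 + m T - n, the cubic whose roots are three
  given coordinates.\<close>

definition quad3 :: "complex \<Rightarrow> complex \<Rightarrow> complex \<Rightarrow> complex \<Rightarrow> complex" where
  "quad3 e1 e2 S m = 128 * (S ^ 2 - m) - 64 * e1 * S + (64 * e2 - 16 * e1 ^ 2)"

definition lin3 :: "complex \<Rightarrow> complex \<Rightarrow> complex \<Rightarrow> complex \<Rightarrow> complex \<Rightarrow> complex \<Rightarrow> complex" where
  "lin3 e1 e2 e3 S m n = 128 * (n - S * m) + 64 * e1 * m - (64 * e3 - 32 * e1 * e2 + 8 * e1 ^ 3)"

definition const3 :: "complex \<Rightarrow> complex \<Rightarrow> complex \<Rightarrow> complex \<Rightarrow> complex \<Rightarrow> complex \<Rightarrow> complex" where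
  "const3 e1 e2 e3 e4 S n = 128 * S * n - 64 * e1 * n
     + (64 * e4 - 32 * e1 * e3 - 16 * e2 ^ 2 + 24 * e1 ^ 2 * e2 - 5 * e1 ^ 4)"

text \<open>Model for all the elimination lemmas. The hyperplane equation removes x;
  cross-multiplying the gradient equations removes l; and a certificate writes (a gradient value)
  times (a power of the target) as a combination of expressions that vanish. The gradient value is a
  nonzero multiple of l, so the target is 0. Here S, m and T, n are sum and product of the two pairs
  of distinct coordinates.\<close>

lemma tangency_17A2_distinct:
  fixes S T m n l x :: complex
  assumes elim: "x = (13 * S - 7 * T) / 3"
  defines "e1 \<equiv> x + S + T" and "e2 \<equiv> m + n + x * (S + T) + S * T" and "e3 \<equiv> x * (m + n + S * T) + m * T + n * S" and "e4 \<equiv> m * n + x * (m * T + n * S)"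
  assumes dd: "dd2 e1 e2 e3 S m = 0" "dd2 e1 e2 e3 T n = 0"
    and g: "rem2 e1 e2 e3 e4 S m = l * (- 13)" "rem2 e1 e2 e3 e4 T n = l * 7" "gradp e1 e2 e3 e4 x = l * 3"
    and "l \<noteq> 0"
  shows "S = 0" "T = 0" "m - 4 * n = 0"
proof -
  \<comment> \<open>The combinations of the gradient equations in which l cancels.\<close>
  have r: "7 * rem2 e1 e2 e3 e4 S m - (- 13) * rem2 e1 e2 e3 e4 T n = 0" "7 * gradp e1 e2 e3 e4 x - 3 * rem2 e1 e2 e3 e4 T n = 0"
    unfolding g by algebra+
  have "380700 * (rem2 e1 e2 e3 e4 T n * (S) ^ 2) =
        (4315164 * S ^ 3 + (-11053455) * S ^ 2 * T + 8868657 * S * T ^ 2 + 64197 * S * m + (-530082) * S * n + (-2180640) * T ^ 3 + (-122220) * T * m + 308007 * T * n) * (dd2 e1 e2 e3 S m)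
      + ((-2930165) * S ^ 3 + 1986453 * S ^ 2 * T + 884499 * S * T ^ 2 + (-585522) * S * m + 119637 * S * n + (-544075) * T ^ 3 + 185787 * T * m) * (dd2 e1 e2 e3 T n)
      + ((-203973) * S ^ 2 + 294195 * S * T + (-84525) * T ^ 2 + (-6345) * m + 6345 * n) * (7 * rem2 e1 e2 e3 e4 S m - (- 13) * rem2 e1 e2 e3 e4 T n)
      + ((-49158) * S ^ 2 + 22482 * S * T + (-12690) * m + 12690 * n) * (7 * gradp e1 e2 e3 e4 x - 3 * rem2 e1 e2 e3 e4 T n)"
    unfolding dd2_def rem2_def gradp_def tw0_def tw1_def quad3_def lin3_def const3_def e1_def e2_def e3_def e4_def elim(1-1) by algebra
  then have "rem2 e1 e2 e3 e4 T n * (S) ^ 2 = 0"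
    unfolding dd r by simp
  then show "S = 0"
    using \<open>l \<noteq> 0\<close> unfolding g by simp
  have "380700 * (rem2 e1 e2 e3 e4 T n * (T) ^ 2) =
        ((-289191) * S ^ 3 + (-3560865) * S ^ 2 * T + 4176417 * S * T ^ 2 + (-173943) * S * m + (-572607) * S * n + (-867090) * T ^ 3 + (-8820) * T * m + 84042 * T * n) * (dd2 e1 e2 e3 S m)
      + ((-5434415) * S ^ 3 + 5432553 * S ^ 2 * T + (-1133391) * S * T ^ 2 + (-741447) * S * m + (-5103) * S * n + 109550 * T ^ 3 + 75222 * T * m) * (dd2 e1 e2 e3 T n)
      + ((-243663) * S ^ 2 + 232905 * S * T + (-2175) * T ^ 2 + (-6345) * m + 6345 * n) * (7 * rem2 e1 e2 e3 e4 S m - (- 13) * rem2 e1 e2 e3 e4 T n)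
      + ((-122598) * S ^ 2 + 58662 * S * T + (-12690) * m + 12690 * n) * (7 * gradp e1 e2 e3 e4 x - 3 * rem2 e1 e2 e3 e4 T n)"
    unfolding dd2_def rem2_def gradp_def tw0_def tw1_def quad3_def lin3_def const3_def e1_def e2_def e3_def e4_def elim(1-1) by algebra
  then have "rem2 e1 e2 e3 e4 T n * (T) ^ 2 = 0"
    unfolding dd r by simp
  then show "T = 0"
    using \<open>l \<noteq> 0\<close> unfolding g by simp
  have "126900 * (rem2 e1 e2 e3 e4 T n * (m - 4 * n)) =
        (9426508 * S ^ 3 + (-19101075) * S ^ 2 * T + 13765941 * S * T ^ 2 + 1114974 * S * m + (-606501) * S * n + (-3564820) * T ^ 3 + (-1006110) * T * m + 650916 * T * n) * (dd2 e1 e2 e3 S m)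
      + ((-1812720) * S ^ 3 + 1004829 * S ^ 2 * T + 1377663 * S * T ^ 2 + 310779 * S * m + 197694 * S * n + (-886725) * T ^ 3 + (-355194) * T * m) * (dd2 e1 e2 e3 T n)
      + ((-263256) * S ^ 2 + 381135 * S * T + (-138075) * T ^ 2 + (-19035) * m + (-44415) * n) * (7 * rem2 e1 e2 e3 e4 S m - (- 13) * rem2 e1 e2 e3 e4 T n)
      + ((-126) * S ^ 2 + 4149 * S * T + (-6345) * m + 6345 * n) * (7 * gradp e1 e2 e3 e4 x - 3 * rem2 e1 e2 e3 e4 T n)"
    unfolding dd2_def rem2_def gradp_def tw0_def tw1_def quad3_def lin3_def const3_def e1_def e2_def e3_def e4_def elim(1-1) by algebra
  then have "rem2 e1 e2 e3 e4 T n * (m - 4 * n) = 0"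
    unfolding dd r by simp
  then show "m - 4 * n = 0"
    using \<open>l \<noteq> 0\<close> unfolding g by simp
qed

text \<open>Degenerate case with both pairs of coordinates equal. The certificate has the square of
  a gradient value as its target, so l would be 0; the next two lemmas exclude the cases with
  exactly one equal pair in the same way.\<close>

lemma tangency_17A2_equal:
  fixes p q l x :: complex
  assumes elim: "x = (26 * p - 14 * q) / 3"
  defines "e1 \<equiv> x + 2 * p + 2 * q" and "e2 \<equiv> p ^ 2 + q ^ 2 + 2 * x * (p + q) + 4 * p * q" and "e3 \<equiv> x * (p ^ 2 + q ^ 2 + 4 * p * q) + 2 * p ^ 2 * q + 2 * q ^ 2 * p" and "e4 \<equiv> p ^ 2 * q ^ 2 + 2 * x * (p ^ 2 * q + q ^ 2 * p)"
  assumes g: "gradp e1 e2 e3 e4 p = l * (- 13)" "gradp e1 e2 e3 e4 q = l * 7" "gradp e1 e2 e3 e4 x = l * 3"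
    and "l \<noteq> 0"
  shows "False"
proof -
  have r: "7 * gradp e1 e2 e3 e4 p - (- 13) * gradp e1 e2 e3 e4 q = 0" "7 * gradp e1 e2 e3 e4 x - 3 * gradp e1 e2 e3 e4 q = 0"
    unfolding g by algebra+
  have "2222640 * ((gradp e1 e2 e3 e4 q) ^ 2) =
        ((-2360238959) * p ^ 4 + 5326005230 * p ^ 3 * q + (-4492711020) * p ^ 2 * q ^ 2 + 1680219800 * p * q ^ 3 + (-235298000) * q ^ 4) * (7 * gradp e1 e2 e3 e4 p - (- 13) * gradp e1 e2 e3 e4 q)
      + (3203226 * p ^ 4 + (-1724814) * p ^ 3 * q) * (7 * gradp e1 e2 e3 e4 x - 3 * gradp e1 e2 e3 e4 q)"
    unfolding dd2_def rem2_def gradp_def tw0_def tw1_def quad3_def lin3_def const3_def e1_def e2_def e3_def e4_def elim(1-1) by algebra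
  then have "(gradp e1 e2 e3 e4 q) ^ 2 = 0"
    unfolding r by simp
  then show "False"
    using \<open>l \<noteq> 0\<close> unfolding g by simp
qed

lemma tangency_17A2_distinct_equal:
  fixes S q m l x :: complex
  assumes elim: "x = (13 * S - 14 * q) / 3"
  defines "e1 \<equiv> x + S + 2 * q" and "e2 \<equiv> m + q ^ 2 + x * (S + 2 * q) + 2 * S * q" and "e3 \<equiv> x * (m + q ^ 2 + 2 * S * q) + 2 * m * q + q ^ 2 * S" and "e4 \<equiv> m * q ^ 2 + x * (2 * m * q + q ^ 2 * S)"
  assumes dd: "dd2 e1 e2 e3 S m = 0"
    and g: "rem2 e1 e2 e3 e4 S m = l * (- 13)" "gradp e1 e2 e3 e4 q = l * 7" "gradp e1 e2 e3 e4 x = l * 3"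
    and "l \<noteq> 0"
  shows "False"
proof -
  have r: "7 * rem2 e1 e2 e3 e4 S m - (- 13) * gradp e1 e2 e3 e4 q = 0" "7 * gradp e1 e2 e3 e4 x - 3 * gradp e1 e2 e3 e4 q = 0"
    unfolding g by algebra+
  have "251100 * ((gradp e1 e2 e3 e4 q) ^ 2) =
        (22967151375 * S ^ 5 + (-136145451253) * S ^ 4 * q + 303598714664 * S ^ 3 * q ^ 2 + 3108461118 * S ^ 3 * m + (-317492062062) * S ^ 2 * q ^ 3 + (-8424459603) * S ^ 2 * q * m + 153333622400 * S * q ^ 4 + 7164927000 * S * q ^ 2 * m + 38962350 * S * m ^ 2 + (-26235727000) * q ^ 5 + (-1748888400) * q ^ 3 * m + (-16405200) * q * m ^ 2) * (dd2 e1 e2 e3 S m)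
      + ((-1103248315) * S ^ 4 + 4061526917 * S ^ 3 * q + (-5428154340) * S ^ 2 * q ^ 2 + 13497597 * S ^ 2 * m + 3075080750 * S * q ^ 3 + (-600250000) * q ^ 4 + 502200 * m ^ 2) * (7 * rem2 e1 e2 e3 e4 S m - (- 13) * gradp e1 e2 e3 e4 q)
      + ((-131231625) * S ^ 4 + 257580141 * S ^ 3 * q + (-117545316) * S ^ 2 * q ^ 2 + 19211094 * S ^ 2 * m) * (7 * gradp e1 e2 e3 e4 x - 3 * gradp e1 e2 e3 e4 q)"
    unfolding dd2_def rem2_def gradp_def tw0_def tw1_def quad3_def lin3_def const3_def e1_def e2_def e3_def e4_def elim(1-1) by algebra
  then have "(gradp e1 e2 e3 e4 q) ^ 2 = 0"
    unfolding dd r by simp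
  then show "False"
    using \<open>l \<noteq> 0\<close> unfolding g by simp
qed

lemma tangency_17A2_equal_distinct:
  fixes S q m l x :: complex
  assumes elim: "x = (26 * q - 7 * S) / 3"
  defines "e1 \<equiv> x + S + 2 * q" and "e2 \<equiv> m + q ^ 2 + x * (S + 2 * q) + 2 * S * q" and "e3 \<equiv> x * (m + q ^ 2 + 2 * S * q) + 2 * m * q + q ^ 2 * S" and "e4 \<equiv> m * q ^ 2 + x * (2 * m * q + q ^ 2 * S)"
  assumes dd: "dd2 e1 e2 e3 S m = 0"
    and g: "rem2 e1 e2 e3 e4 S m = l * 7" "gradp e1 e2 e3 e4 q = l * (- 13)" "gradp e1 e2 e3 e4 x = l * 3"
    and "l \<noteq> 0"
  shows "False"
proof -
  have r: "7 * gradp e1 e2 e3 e4 q - (- 13) * rem2 e1 e2 e3 e4 S m = 0" "7 * gradp e1 e2 e3 e4 x - 3 * rem2 e1 e2 e3 e4 S m = 0"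
    unfolding g by algebra+
  have "234835200 * ((rem2 e1 e2 e3 e4 S m) ^ 2) =
        (30575001875 * S ^ 5 + (-423116580764) * S ^ 4 * q + 2021454902012 * S ^ 3 * q ^ 2 + 4946660694 * S ^ 3 * m + (-4455850749961) * S ^ 2 * q ^ 3 + 3016466406 * S ^ 2 * q * m + 4697727230950 * S * q ^ 4 + (-246973708800) * S * q ^ 2 * m + 4660011000 * S * m ^ 2 + (-2139858666400) * q ^ 5 + 690198163200 * q ^ 3 * m + 21370003200 * q * m ^ 2) * (dd2 e1 e2 e3 S m)
      + ((-2466966195) * S ^ 4 + 20830041522 * S ^ 3 * q + (-112474854513) * S ^ 2 * q ^ 2 + 1688658516 * S ^ 2 * m + 280996542450 * S * q ^ 3 + (-232972178400) * q ^ 4 + 1056758400 * m ^ 2) * (7 * gradp e1 e2 e3 e4 q - (- 13) * rem2 e1 e2 e3 e4 S m)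
      + ((-536909625) * S ^ 4 + (-526623237) * S ^ 3 * q + 3203189262 * S ^ 2 * q ^ 2 + 1395895032 * S ^ 2 * m) * (7 * gradp e1 e2 e3 e4 x - 3 * rem2 e1 e2 e3 e4 S m)"
    unfolding dd2_def rem2_def gradp_def tw0_def tw1_def quad3_def lin3_def const3_def e1_def e2_def e3_def e4_def elim(1-1) by algebra
  then have "(rem2 e1 e2 e3 e4 S m) ^ 2 = 0"
    unfolding dd r by simp
  then show "False"
    using \<open>l \<noteq> 0\<close> unfolding g by simp
qed

text \<open>The unknowns are p (twice), x and the conjugate pair u + q w, u - q w with q^2 = 3;
  working with u and w keeps all coefficients rational. The two conclusions leave the single
  projective point p : u : w = 9 : 6 : 4.\<close>

lemma tangency_16A2_equal:
  fixes p u w l x :: complex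
  assumes elim: "x = 16 * p - 12 * u - 18 * w"
  defines "e1 \<equiv> x + 2 * p + 2 * u" and "e2 \<equiv> p ^ 2 + (u ^ 2 - 3 * w ^ 2) + 2 * x * (p + u) + 4 * p * u" and "e3 \<equiv> x * (p ^ 2 + (u ^ 2 - 3 * w ^ 2) + 4 * p * u) + 2 * p ^ 2 * u + 2 * (u ^ 2 - 3 * w ^ 2) * p" and "e4 \<equiv> p ^ 2 * (u ^ 2 - 3 * w ^ 2) + 2 * x * (p ^ 2 * u + (u ^ 2 - 3 * w ^ 2) * p)"
  assumes g: "gradp e1 e2 e3 e4 p = l * (- 8)" "gradp e1 e2 e3 e4 x = l * 1" "tw0 e1 e2 e3 e4 3 u w = l * 6" "tw1 e1 e2 e3 e4 3 u w = l * 3"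
    and "l \<noteq> 0"
  shows "2 * p - 3 * u = 0" "2 * u - 3 * w = 0"
proof -
  have r: "1 * gradp e1 e2 e3 e4 p - (- 8) * gradp e1 e2 e3 e4 x = 0" "1 * tw0 e1 e2 e3 e4 3 u w - 6 * gradp e1 e2 e3 e4 x = 0" "1 * tw1 e1 e2 e3 e4 3 u w - 3 * gradp e1 e2 e3 e4 x = 0"
    unfolding g by algebra+
  have "47843730 * (gradp e1 e2 e3 e4 x * (2 * p - 3 * u) ^ 3) =
        ((-39707415496) * p ^ 3 + 95544037186 * p ^ 2 * u + 139955269638 * p ^ 2 * w + (-76456929661) * p * u ^ 2 + (-222287429781) * p * u * w + (-167116873158) * p * w ^ 2 + 20341632945 * u ^ 3 + 88020483504 * u ^ 2 * w + 131654737998 * u * w ^ 2 + 67323195576 * w ^ 3) * (1 * gradp e1 e2 e3 e4 p - (- 8) * gradp e1 e2 e3 e4 x)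
      + ((-52371104000) * p ^ 3 + 123777763190 * p ^ 2 * u + 183557104608 * p ^ 2 * w + (-97593073823) * p * u ^ 2 + (-286905342726) * p * u * w + (-216846510066) * p * w ^ 2 + 25678639443 * u ^ 3 + 112062883353 * u ^ 2 * w + 168476258538 * u * w ^ 2 + 86082847578 * w ^ 3) * (1 * tw0 e1 e2 e3 e4 3 u w - 6 * gradp e1 e2 e3 e4 x)
      + (3181588992 * p ^ 3 + (-2641067424) * p ^ 2 * u + (-9480243006) * p ^ 2 * w + (-1407330288) * p * u ^ 2 + 5136455097 * p * u * w + 6494472270 * p * w ^ 2 + 1198865286 * u ^ 3 + 1292742261 * u ^ 2 * w) * (1 * tw1 e1 e2 e3 e4 3 u w - 3 * gradp e1 e2 e3 e4 x)"
    unfolding dd2_def rem2_def gradp_def tw0_def tw1_def quad3_def lin3_def const3_def e1_def e2_def e3_def e4_def elim(1-1) by algebra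
  then have "gradp e1 e2 e3 e4 x * (2 * p - 3 * u) ^ 3 = 0"
    unfolding r by simp
  then show "2 * p - 3 * u = 0"
    using \<open>l \<noteq> 0\<close> unfolding g by simp
  have "191374920 * (gradp e1 e2 e3 e4 x * (2 * u - 3 * w) ^ 3) =
        (395131200064 * p ^ 3 + (-967563602968) * p ^ 2 * u + (-1405915664880) * p ^ 2 * w + 788077999624 * p * u ^ 2 + 2264982328206 * p * u * w + 1699072779168 * p * w ^ 2 + (-213467384190) * u ^ 3 + (-910147569189) * u ^ 2 * w + (-1353667918338) * u * w ^ 2 + (-693727270416) * w ^ 3) * (1 * gradp e1 e2 e3 e4 p - (- 8) * gradp e1 e2 e3 e4 x)
      + (527567736320 * p ^ 3 + (-1259658301952) * p ^ 2 * u + (-1861026047328) * p ^ 2 * w + 1003830745136 * p * u ^ 2 + 2934629788104 * p * u * w + 2214811942776 * p * w ^ 2 + (-267094650810) * u ^ 3 + (-1156981662033) * u ^ 2 * w + (-1733947726788) * u * w ^ 2 + (-886194064638) * w ^ 3) * (1 * tw0 e1 e2 e3 e4 3 u w - 6 * gradp e1 e2 e3 e4 x)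
      + ((-46064691072) * p ^ 3 + 45210999744 * p ^ 2 * u + 130325074560 * p ^ 2 * w + 9917666568 * p * u ^ 2 + (-75357735228) * p * u * w + (-86893363656) * p * w ^ 2 + (-13435895736) * u ^ 3 + (-14688437292) * u ^ 2 * w) * (1 * tw1 e1 e2 e3 e4 3 u w - 3 * gradp e1 e2 e3 e4 x)"
    unfolding dd2_def rem2_def gradp_def tw0_def tw1_def quad3_def lin3_def const3_def e1_def e2_def e3_def e4_def elim(1-1) by algebra
  then have "gradp e1 e2 e3 e4 x * (2 * u - 3 * w) ^ 3 = 0"
    unfolding r by simp
  then show "2 * u - 3 * w = 0"
    using \<open>l \<noteq> 0\<close> unfolding g by simp
qed

lemma tangency_16A2_distinct:
  fixes S u w m l x :: complex
  assumes elim: "x = 8 * S - 12 * u - 18 * w"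
  defines "e1 \<equiv> x + S + 2 * u" and "e2 \<equiv> m + (u ^ 2 - 3 * w ^ 2) + x * (S + 2 * u) + 2 * S * u" and "e3 \<equiv> x * (m + (u ^ 2 - 3 * w ^ 2) + 2 * S * u) + 2 * m * u + (u ^ 2 - 3 * w ^ 2) * S" and "e4 \<equiv> m * (u ^ 2 - 3 * w ^ 2) + x * (2 * m * u + (u ^ 2 - 3 * w ^ 2) * S)"
  assumes dd: "dd2 e1 e2 e3 S m = 0"
    and g: "rem2 e1 e2 e3 e4 S m = l * (- 8)" "gradp e1 e2 e3 e4 x = l * 1" "tw0 e1 e2 e3 e4 3 u w = l * 6" "tw1 e1 e2 e3 e4 3 u w = l * 3"
    and "l \<noteq> 0"
  shows "False"
proof -
  have r: "1 * rem2 e1 e2 e3 e4 S m - (- 8) * gradp e1 e2 e3 e4 x = 0" "1 * tw0 e1 e2 e3 e4 3 u w - 6 * gradp e1 e2 e3 e4 x = 0" "1 * tw1 e1 e2 e3 e4 3 u w - 3 * gradp e1 e2 e3 e4 x = 0"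
    unfolding g by algebra+
  have "4632585521850 * ((gradp e1 e2 e3 e4 x) ^ 2) =
        (4927861465014541109 * S ^ 5 + (-37257675735638745078) * S ^ 4 * u + (-52669964578253713812) * S ^ 4 * w + 112460178227734790128 * S ^ 3 * u ^ 2 + 317585370624266534832 * S ^ 3 * u * w + 223653497899932131376 * S ^ 3 * w ^ 2 + 69827790540929432 * S ^ 3 * m + (-169396428598262863488) * S ^ 2 * u ^ 3 + (-716641430007941951328) * S ^ 2 * u ^ 2 * w + (-1008005412334706140800) * S ^ 2 * u * w ^ 2 + (-303408206894288816) * S ^ 2 * u * m + (-471293288758818649152) * S ^ 2 * w ^ 3 + (-403393603812158304) * S ^ 2 * w * m + 127325169969045801984 * S * u ^ 4 + 717213521751365310336 * S * u ^ 3 * w + 1510990875142122224064 * S * u ^ 2 * w ^ 2 + 438911810057994944 * S * u ^ 2 * m + 1410729254662607038080 * S * u * w ^ 3 + 1166394320715253824 * S * u * w * m + 492385365397468992384 * S * w ^ 4 + 769785945381949248 * S * w ^ 2 * m + (-213304826694960) * S * m ^ 2 + (-38202883348521116160) * u ^ 5 + (-268586576162295446016) * u ^ 4 * w + (-753243217954695112320) * u ^ 3 * w ^ 2 + (-211235048058857472) * u ^ 3 * m + (-1053072645112711911168) * u ^ 2 * w ^ 3 + (-840696675570311040) * u ^ 2 * w * m + (-733748016584748522240) * u * w ^ 4 + (-1107435187554508800) * u * w ^ 2 * m + 278366916690720 * u * m ^ 2 + (-203794038981874598400) * w ^ 5 + (-483180883037798400) * w ^ 3 * m + 326134020738240 *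 w * m ^ 2) * (dd2 e1 e2 e3 S m)
      + (219965595322794286 * S ^ 4 + (-1348819841277646800) * S ^ 3 * u + (-1944541013127665472) * S ^ 3 * w + 3100113695239128032 * S ^ 2 * u ^ 2 + 8950824743590166400 * S ^ 2 * u * w + 6446126806052485632 * S ^ 2 * w ^ 2 + 376741500845392 * S ^ 2 * m + (-3165874518204407808) * S * u ^ 3 + (-13730882903232516864) * S * u ^ 2 * w + (-19803827287860958464) * S * u * w ^ 2 + (-542237590359616) * S * u * m + (-9501987789920172672) * S * w ^ 3 + 1212192418145679360 * u ^ 4 + 7020085964117211648 * u ^ 3 * w + 15207750080290704768 * u ^ 2 * w ^ 2 + 154241207416192 * u ^ 2 * m + 14613009866616814848 * u * w ^ 3 + 5255863956988519680 * w ^ 4 + (-14824273669920) * m ^ 2) * (1 * rem2 e1 e2 e3 e4 S m - (- 8) * gradp e1 e2 e3 e4 x)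
      + (153012739738038880 * S ^ 4 + (-933378623027444112) * S ^ 3 * u + (-1343814719922028800) * S ^ 3 * w + 2133941627909288192 * S ^ 2 * u ^ 2 + 6153705293095297728 * S ^ 2 * u * w + 4425155401167668544 * S ^ 2 * w ^ 2 + 292180475221120 * S ^ 2 * m + (-2167613043490430208) * S * u ^ 3 + (-9391084479991175040) * S * u ^ 2 * w + (-13526043842321822976) * S * u * w ^ 2 + (-426189589038400) * S * u * m + (-6479621137271013120) * S * w ^ 3 + 825531192601509888 * u ^ 4 + 4776408113214606336 * u ^ 3 * w + 10334310326705025024 * u ^ 2 * w ^ 2 + 129204656329216 * u ^ 2 * m + 9915480937249864704 * u * w ^ 3 + 3560499612891786240 * w ^ 4) * (1 * tw0 e1 e2 e3 e4 3 u w - 6 * gradp e1 e2 e3 e4 x)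
      + ((-409365197279640) * S ^ 4 + 1931202536240304 * S ^ 3 * u + 2285196620697792 * S ^ 3 * w + (-3062630899565568) * S ^ 2 * u ^ 2 + (-7223205452775552) * S ^ 2 * u * w + (-3940168008761280) * S ^ 2 * w ^ 2 + (-444604330080) * S ^ 2 * m + 1637194965928704 * S * u ^ 3 + 5773124958762240 * S * u ^ 2 * w + 6226464934485504 * S * u * w ^ 2 + (-3443013691200) * S * u * m + 2013138806000256 * S * w ^ 3) * (1 * tw1 e1 e2 e3 e4 3 u w - 3 * gradp e1 e2 e3 e4 x)"
    unfolding dd2_def rem2_def gradp_def tw0_def tw1_def quad3_def lin3_def const3_def e1_def e2_def e3_def e4_def elim(1-1) by algebra
  then have "(gradp e1 e2 e3 e4 x) ^ 2 = 0"
    unfolding dd r by simp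
  then show "False"
    using \<open>l \<noteq> 0\<close> unfolding g by simp
qed

text \<open>Solving the hyperplane equation for the second pair means dividing by 6 (r - 2), whose
  inverse is (r + 2)/54; the parameters a and b absorb this denominator. In the certificates for r =
  sqrt 13 the letter r is an indeterminate, and the multiple of r^2 - 13 accounts for the
  relation.\<close>

lemma tangency_A3_equal:
  fixes a b r l p x q :: complex
  assumes elim: "p = 27 * a" "x = 108 * b" "q = (17 + 4 * r) * a - (19 * r - 7) * b" "r ^ 2 = 13"
  defines "e1 \<equiv> x + 2 * p + 2 * q" and "e2 \<equiv> p ^ 2 + q ^ 2 + 2 * x * (p + q) + 4 * p * q" and "e3 \<equiv> x * (p ^ 2 + q ^ 2 + 4 * p * q) + 2 * p ^ 2 * q + 2 * q ^ 2 * p" and "e4 \<equiv> p ^ 2 * q ^ 2 + 2 * x * (p ^ 2 * q + q ^ 2 * p)"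
  assumes g: "gradp e1 e2 e3 e4 p = l * (- 4 - 2 * r)" "gradp e1 e2 e3 e4 q = l * (- 12 + 6 * r)" "gradp e1 e2 e3 e4 x = l * (29 - 5 * r)"
    and "l \<noteq> 0"
  shows "(13 - r) * p - (9 + 3 * r) * q = 0"
proof -
  \<comment> \<open>The norm of 29 - 5r is 516, hence the gradient value at x is a nonzero multiple
    of l.\<close>
  have "516 = (29 - 5 * r) * (29 + 5 * r) + 25 * (r ^ 2 - 13)"
    by algebra
  then have pivot: "29 - 5 * r \<noteq> 0"
    using elim by auto
  have r: "(29 - 5 * r) * gradp e1 e2 e3 e4 p - (- 4 - 2 * r) * gradp e1 e2 e3 e4 x = 0" "(29 - 5 * r) * gradp e1 e2 e3 e4 q - (- 12 + 6 * r) * gradp e1 e2 e3 e4 x = 0"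
    unfolding g by algebra+
  have "4314 * (gradp e1 e2 e3 e4 x * ((13 - r) * p - (9 + 3 * r) * q)) =
        (15840 * a * r + (-197523) * a + (-31380) * b * r + 672720 * b) * ((29 - 5 * r) * gradp e1 e2 e3 e4 p - (- 4 - 2 * r) * gradp e1 e2 e3 e4 x)
      + ((-4430) * a * r + 17825 * a) * ((29 - 5 * r) * gradp e1 e2 e3 e4 q - (- 12 + 6 * r) * gradp e1 e2 e3 e4 x)
      + (r ^ 2 - 13) * ((-6652972412928) * a ^ 3 * b ^ 2 * r + (-28275132754944) * a ^ 3 * b ^ 2 + 75634176715776 * a ^ 2 * b ^ 3 * r + 226195650316800 * a ^ 2 * b ^ 3 + (-277690641182208) * a * b ^ 4 * r + (-467565801463296) * a * b ^ 4 + 325545961282560 * b ^ 5 * r + 89829004561920 * b ^ 5)"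
    unfolding dd2_def rem2_def gradp_def tw0_def tw1_def quad3_def lin3_def const3_def e1_def e2_def e3_def e4_def elim(1-3) by algebra
  then have "gradp e1 e2 e3 e4 x * ((13 - r) * p - (9 + 3 * r) * q) = 0"
    unfolding r elim(4) by simp
  then show "(13 - r) * p - (9 + 3 * r) * q = 0"
    using \<open>l \<noteq> 0\<close> pivot unfolding g by simp
qed

text \<open>The conclusion is the vanishing of the discriminant of the pair with sum S and product
  m, contradicting that the two coordinates are distinct.\<close>

lemma tangency_A3_distinct_equal:
  fixes a b m r l S x q :: complex
  assumes elim: "S = 54 * a" "x = 108 * b" "q = (17 + 4 * r) * a - (19 * r - 7) * b" "r ^ 2 = 13"
  defines "e1 \<equiv> x + S + 2 * q" and "e2 \<equiv> m + q ^ 2 + x * (S + 2 * q) + 2 * S * q" and "e3 \<equiv> x * (m + q ^ 2 + 2 * S * q) + 2 * m * q + q ^ 2 * S" and "e4 \<equiv> m * q ^ 2 + x * (2 * m * q + q ^ 2 * S)"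
  assumes dd: "dd2 e1 e2 e3 S m = 0"
    and g: "rem2 e1 e2 e3 e4 S m = l * (- 4 - 2 * r)" "gradp e1 e2 e3 e4 q = l * (- 12 + 6 * r)" "gradp e1 e2 e3 e4 x = l * (29 - 5 * r)"
    and "l \<noteq> 0"
  shows "S ^ 2 - 4 * m = 0"
proof -
  have "516 = (29 - 5 * r) * (29 + 5 * r) + 25 * (r ^ 2 - 13)"
    by algebra
  then have pivot: "29 - 5 * r \<noteq> 0"
    using elim by auto
  have r: "(29 - 5 * r) * rem2 e1 e2 e3 e4 S m - (- 4 - 2 * r) * gradp e1 e2 e3 e4 x = 0" "(29 - 5 * r) * gradp e1 e2 e3 e4 q - (- 12 + 6 * r) * gradp e1 e2 e3 e4 x = 0"
    unfolding g by algebra+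
  have "3915 * (gradp e1 e2 e3 e4 x * (S ^ 2 - 4 * m)) =
        ((-254543472) * a ^ 3 * r + (-674202528) * a ^ 3 + 2183901750 * a ^ 2 * b * r + 6217805754 * a ^ 2 * b + (-5066170920) * a * b ^ 2 * r + (-18257630040) * a * b ^ 2 + (-108336) * a * m * r + (-254424) * a * m + 15229655640 * b ^ 3 * r + 54688559400 * b ^ 3 + 946590 * b * m * r + 4001082 * b * m) * (dd2 e1 e2 e3 S m)
      + ((-1064727) * a ^ 2 * r + (-3648033) * a ^ 2 + 9260550 * a * b * r + 32422554 * a * b + (-4745340) * b ^ 2 * r + (-16900740) * b ^ 2 + 85 * m * r + 415 * m) * ((29 - 5 * r) * rem2 e1 e2 e3 e4 S m - (- 4 - 2 * r) * gradp e1 e2 e3 e4 x)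
      + ((-858078) * a ^ 2 * r + (-2622150) * a ^ 2 + 5829642 * a * b * r + 18180198 * a * b + (-8640828) * b ^ 2 * r + (-27442116) * b ^ 2) * ((29 - 5 * r) * gradp e1 e2 e3 e4 q - (- 12 + 6 * r) * gradp e1 e2 e3 e4 x)
      + (r ^ 2 - 13) * ((-42037340228352) * a ^ 6 * r + 310435001900784 * a ^ 6 + 539138227051584 * a ^ 5 * b * r + (-2264506856876736) * a ^ 5 * b + (-2321438320055808) * a ^ 4 * b ^ 2 * r + 358914968777088 * a ^ 4 * b ^ 2 + (-14644634112) * a ^ 4 * m * r + (-170353136016) * a ^ 4 * m + 3635744167169280 * a ^ 3 * b ^ 3 * r + 25779193903362816 * a ^ 3 * b ^ 3 + 385190100864 * a ^ 3 * b * m * r + 213927060096 * a ^ 3 * b * m + (-4806193272141312) * a ^ 2 * b ^ 4 * r + (-57458456695312128) * a ^ 2 * b ^ 4 + (-2256912180864) * a ^ 2 * b ^ 2 * m * r + 1091613449088 * a ^ 2 * b ^ 2 * m + 4112640 * a ^ 2 * m ^ 2 * r + (-129620400) * a ^ 2 * m ^ 2 + 24362948069664768 * a * b ^ 5 * r + 88668415328587776 * a * b ^ 5 + 4563873932544 * a * b ^ 3 * m * r + (-13824180700416) * a * b ^ 3 * m + (-23060160) * a * b * m ^ 2 * r + 1130755392 * a * b * m ^ 2 + (-36006096758261760) * b ^ 6 * r + (-106882815304857600) * b ^ 6 + (-4583274181632) * b ^ 4 * m * r + 14331606628608 * b ^ 4 * m + 16744320 * b ^ 2 * m ^ 2 *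 r + 1264570368 * b ^ 2 * m ^ 2 + 23120 * m ^ 3)"
    unfolding dd2_def rem2_def gradp_def tw0_def tw1_def quad3_def lin3_def const3_def e1_def e2_def e3_def e4_def elim(1-3) by algebra
  then have "gradp e1 e2 e3 e4 x * (S ^ 2 - 4 * m) = 0"
    unfolding dd r elim(4) by simp
  then show "S ^ 2 - 4 * m = 0"
    using \<open>l \<noteq> 0\<close> pivot unfolding g by simp
qed

text \<open>Sum and product of the distinct pair both vanish, which would make the pair equal;
  \<open>tangency_A3_distinct\<close> serves the same end when both pairs are distinct.\<close>

lemma tangency_A3_equal_distinct:
  fixes a b m r l q x S :: complex
  assumes elim: "q = 27 * a" "x = 54 * b" "S = 2 * ((17 + 4 * r) * a) - (19 * r - 7) * b" "r ^ 2 = 13"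
  defines "e1 \<equiv> x + S + 2 * q" and "e2 \<equiv> m + q ^ 2 + x * (S + 2 * q) + 2 * S * q" and "e3 \<equiv> x * (m + q ^ 2 + 2 * S * q) + 2 * m * q + q ^ 2 * S" and "e4 \<equiv> m * q ^ 2 + x * (2 * m * q + q ^ 2 * S)"
  assumes dd: "dd2 e1 e2 e3 S m = 0"
    and g: "rem2 e1 e2 e3 e4 S m = l * (- 12 + 6 * r)" "gradp e1 e2 e3 e4 q = l * (- 4 - 2 * r)" "gradp e1 e2 e3 e4 x = l * (29 - 5 * r)"
    and "l \<noteq> 0"
  shows "S = 0" "m = 0"
proof -
  have "516 = (29 - 5 * r) * (29 + 5 * r) + 25 * (r ^ 2 - 13)"
    by algebra
  then have pivot: "29 - 5 * r \<noteq> 0"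
    using elim by auto
  have r: "(29 - 5 * r) * rem2 e1 e2 e3 e4 S m - (- 12 + 6 * r) * gradp e1 e2 e3 e4 x = 0" "(29 - 5 * r) * gradp e1 e2 e3 e4 q - (- 4 - 2 * r) * gradp e1 e2 e3 e4 x = 0"
    unfolding g by algebra+
  have "44160 * (gradp e1 e2 e3 e4 x * (S) ^ 2) =
        ((-35473450910) * a ^ 3 * r + (-127886055202) * a ^ 3 + 129143123886 * a ^ 2 * b * r + 466258398738 * a ^ 2 * b + (-143596487706) * a * b ^ 2 * r + (-509645926434) * a * b ^ 2 + 31571046 * a * m * r + 113672970 * a * m + 32279926486 * b ^ 3 * r + 98749511774 * b ^ 3 + (-17212662) * b * m * r + (-72070722) * b * m) * (dd2 e1 e2 e3 S m)
      + ((-78904604) * a ^ 2 * r + (-284353042) * a ^ 2 + 261853682 * a * b * r + 947475298 * a * b + (-241485023) * b ^ 2 * r + (-875576281) * b ^ 2 + 67704 * m * r + 240486 * m) * ((29 - 5 * r) * rem2 e1 e2 e3 e4 S m - (- 12 + 6 * r) * gradp e1 e2 e3 e4 x)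
      + ((-148202168) * a ^ 2 * r + (-535054546) * a ^ 2 + 460637054 * a * b * r + 1655762686 * a * b + (-394181429) * b ^ 2 * r + (-1401932179) * b ^ 2 + 130132 * m * r + 460310 * m) * ((29 - 5 * r) * gradp e1 e2 e3 e4 q - (- 4 - 2 * r) * gradp e1 e2 e3 e4 x)
      + (r ^ 2 - 13) * (26823288995840 * a ^ 6 * r ^ 4 + 323125264809984 * a ^ 6 * r ^ 3 + 1587675386738688 * a ^ 6 * r ^ 2 + 4222316677672960 * a ^ 6 * r + 5321169300206016 * a ^ 6 + (-341838246912000) * a ^ 5 * b * r ^ 4 + (-3195543052173312) * a ^ 5 * b * r ^ 3 + (-11412832948517376) * a ^ 5 * b * r ^ 2 + (-22280684159633664) * a ^ 5 * b * r + (-22330408799647872) * a ^ 5 * b + 1812755966476800 * a ^ 4 * b ^ 2 * r ^ 4 + 12282099506924544 * a ^ 4 * b ^ 2 * r ^ 3 + 27014345874855648 * a ^ 4 * b ^ 2 * r ^ 2 + 29620258947471264 * a ^ 4 * b ^ 2 * r + 10265253232071168 * a ^ 4 * b ^ 2 + (-23247667200) * a ^ 4 * m * r ^ 4 + (-279290757120) * a ^ 4 * m * r ^ 3 + (-2185899479040) * a ^ 4 * m * r ^ 2 + (-9586408000512) * a ^ 4 * m * r + (-22923091231680) * a ^ 4 * m + (-5126123505027200) * a ^ 3 * b ^ 3 * r ^ 4 + (-22213728196393728) * a ^ 3 * b ^ 3 * r ^ 3 + (-13675179425159040) * a ^ 3 * b ^ 3 * r ^ 2 + 31010516265247520 * a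 ^ 3 * b ^ 3 * r + 122820053295857184 * a ^ 3 * b ^ 3 + 220852838400 * a ^ 3 * b * m * r ^ 4 + 1853775759360 * a ^ 3 * b * m * r ^ 3 + 11879169672192 * a ^ 3 * b * m * r ^ 2 + 35113518146688 * a ^ 3 * b * m * r + 84548373885312 * a ^ 3 * b * m + 8166069443599500 * a ^ 2 * b ^ 4 * r ^ 4 + 16479480150062856 * a ^ 2 * b ^ 4 * r ^ 3 + (-35982039663847152) * a ^ 2 * b ^ 4 * r ^ 2 + (-113056171559252040) * a ^ 2 * b ^ 4 * r + (-337316223034457820) * a ^ 2 * b ^ 4 + (-786788236800) * a ^ 2 * b ^ 2 * m * r ^ 4 + (-3755905724160) * a ^ 2 * b ^ 2 * m * r ^ 3 + (-21048281391168) * a ^ 2 * b ^ 2 * m * r ^ 2 + (-24064179436800) * a ^ 2 * b ^ 2 * m * r + (-119630250199872) * a ^ 2 * b ^ 2 * m + 703641600 * a ^ 2 * m ^ 2 * r ^ 2 + 4974179328 * a ^ 2 * m ^ 2 * r + 10886289984 * a ^ 2 * m ^ 2 + (-6964034350506720) * a * b ^ 5 * r ^ 4 + 1329084004224456 * a * b ^ 5 * r ^ 3 + 50494088863176984 * a * b ^ 5 * r ^ 2 + 99403636094426328 * a * b ^ 5 * r + 374766329517270120 * a * b ^ 5 + 1245748041600 * a * b ^ 3 * m * r ^ 4 + 1437247567200 * a * b ^ 3 * m * r ^ 3 + 16094985176544 * a * b ^ 3 * m * r ^ 2 + (-27470047500480) * a * b ^ 3 * m * r + 65175199776960 * a * b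 ^ 3 * m + (-3342297600) * a * b * m ^ 2 * r ^ 2 + (-6178785408) * a * b * m ^ 2 * r + 3068158464 * a * b * m ^ 2 + 2491045372136900 * b ^ 6 * r ^ 4 + (-5820721961550000) * b ^ 6 * r ^ 3 + (-15796837346155176) * b ^ 6 * r ^ 2 + (-30357147840985136) * b ^ 6 * r + (-159811779810684924) * b ^ 6 + (-739662899700) * b ^ 4 * m * r ^ 4 + 1824211134840 * b ^ 4 * m * r ^ 3 + (-9091238960064) * b ^ 4 * m * r ^ 2 + 35588069600136 * b ^ 4 * m * r + (-5591843371596) * b ^ 4 * m + 3968978400 * b ^ 2 * m ^ 2 * r ^ 2 + (-13382864928) * b ^ 2 * m ^ 2 * r + (-15488284608) * b ^ 2 * m ^ 2 + 3503040 * m ^ 3)"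
    unfolding dd2_def rem2_def gradp_def tw0_def tw1_def quad3_def lin3_def const3_def e1_def e2_def e3_def e4_def elim(1-3) by algebra
  then have "gradp e1 e2 e3 e4 x * (S) ^ 2 = 0"
    unfolding dd r elim(4) by simp
  then show "S = 0"
    using \<open>l \<noteq> 0\<close> pivot unfolding g by simp
  have "23040 * (gradp e1 e2 e3 e4 x * (m)) =
        ((-4150395126) * a ^ 3 * r + (-14962530762) * a ^ 3 + 14661428166 * a ^ 2 * b * r + 52940705274 * a ^ 2 * b + (-15907995810) * a * b ^ 2 * r + (-56208021066) * a * b ^ 2 + 3839838 * a * m * r + 13835730 * a * m + 3057132942 * b ^ 3 * r + 11713016502 * b ^ 3 + (-1847982) * b * m * r + (-9989610) * b * m) * (dd2 e1 e2 e3 S m)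
      + ((-9015948) * a ^ 2 * r + (-32485050) * a ^ 2 + 28941786 * a * b * r + 104777226 * a * b + (-26259147) * b ^ 2 * r + (-94426317) * b ^ 2 + 8216 * m * r + 28574 * m) * ((29 - 5 * r) * rem2 e1 e2 e3 e4 S m - (- 12 + 6 * r) * gradp e1 e2 e3 e4 x)
      + ((-17413464) * a ^ 2 * r + (-62820474) * a ^ 2 + 52225878 * a * b * r + 187859670 * a * b + (-43710681) * b ^ 2 * r + (-154100751) * b ^ 2 + 15908 * m * r + 55310 * m) * ((29 - 5 * r) * gradp e1 e2 e3 e4 q - (- 4 - 2 * r) * gradp e1 e2 e3 e4 x)
      + (r ^ 2 - 13) * (3100995993600 * a ^ 6 * r ^ 4 + 37439197839360 * a ^ 6 * r ^ 3 + 185133541054464 * a ^ 6 * r ^ 2 + 497098148327424 * a ^ 6 * r + 631023910554816 * a ^ 6 + (-39188225433600) * a ^ 5 * b * r ^ 4 + (-366281750200320) * a ^ 5 * b * r ^ 3 + (-1312504894554624) * a ^ 5 * b * r ^ 2 + (-2576925960369408) * a ^ 5 * b * r + (-2577351527180928) * a ^ 5 * b + 205973831232000 * a ^ 4 * b ^ 2 * r ^ 4 + 1390874689981440 * a ^ 4 * b ^ 2 * r ^ 3 + 3050092701788256 * a ^ 4 * b ^ 2 * r ^ 2 + 3331408322412576 * a ^ 4 * b ^ 2 * r + 1083384015542784 * a ^ 4 * b ^ 2 + (-2828288000) * a ^ 4 * m * r ^ 4 + (-33789952000) * a ^ 4 * m * r ^ 3 + (-261453139968) * a ^ 4 * m *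 r ^ 2 + (-1141356657664) * a ^ 4 * m * r + (-2713064593088) * a ^ 4 * m + (-577139443344000) * a ^ 3 * b ^ 3 * r ^ 4 + (-2480480732862720) * a ^ 3 * b ^ 3 * r ^ 3 + (-1447568994925440) * a ^ 3 * b ^ 3 * r ^ 2 + 3654244460534688 * a ^ 3 * b ^ 3 * r + 14009321175002784 * a ^ 3 * b ^ 3 + 26868736000 * a ^ 3 * b * m * r ^ 4 + 223701002240 * a ^ 3 * b * m * r ^ 3 + 1399347778560 * a ^ 3 * b * m * r ^ 2 + 4098773909120 * a ^ 3 * b * m * r + 9674711076736 * a ^ 3 * b * m + 911086599253500 * a ^ 2 * b ^ 4 * r ^ 4 + 1802039338244520 * a ^ 2 * b ^ 4 * r ^ 3 + (-4178619795255984) * a ^ 2 * b ^ 4 * r ^ 2 + (-12883888050763752) * a ^ 2 * b ^ 4 * r + (-37620157497330060) * a ^ 2 * b ^ 4 + (-95719872000) * a ^ 2 * b ^ 2 * m * r ^ 4 + (-450290952960) * a ^ 2 * b ^ 2 * m * r ^ 3 + (-2393737121088) * a ^ 2 * b ^ 2 * m * r ^ 2 + (-2691682586880) * a ^ 2 * b ^ 2 * m * r + (-13190349255744) * a ^ 2 * b ^ 2 * m + 85923840 * a ^ 2 * m ^ 2 * r ^ 2 + 600425472 * a ^ 2 * m ^ 2 * r + 1377374016 * a ^ 2 * m ^ 2 + (-770442437224800) * a * b ^ 5 * r ^ 4 + 178210163036520 * a * b ^ 5 * r ^ 3 + 5762305150237944 * a * b ^ 5 * r ^ 2 + 11201178326865336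 * a * b ^ 5 * r + 41150118939313032 * a * b ^ 5 + 151556464000 * a * b ^ 3 * m * r ^ 4 + 164107885280 * a * b ^ 3 * m * r ^ 3 + 1700874752352 * a * b ^ 3 * m * r ^ 2 + (-3042783099328) * a * b ^ 3 * m * r + 6673307529664 * a * b ^ 3 * m + (-408138240) * a * b * m ^ 2 * r ^ 2 + (-724662912) * a * b * m ^ 2 * r + 191353344 * a * b * m ^ 2 + 273662801169300 * b ^ 6 * r ^ 4 + (-652271322219120) * b ^ 6 * r ^ 3 + (-1813148303520456) * b ^ 6 * r ^ 2 + (-3365777038474224) * b ^ 6 * r + (-17351187109145388) * b ^ 6 + (-89986650500) * b ^ 4 * m * r ^ 4 + 228442287320 * b ^ 4 * m * r ^ 3 + (-965181590976) * b ^ 4 * m * r ^ 2 + 3814367070248 * b ^ 4 * m * r + (-188710413500) * b ^ 4 * m + 484664160 * b ^ 2 * m ^ 2 * r ^ 2 + (-1665700512) * b ^ 2 * m ^ 2 * r + (-1737214656) * b ^ 2 * m ^ 2 + 419520 * m ^ 3)"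
    unfolding dd2_def rem2_def gradp_def tw0_def tw1_def quad3_def lin3_def const3_def e1_def e2_def e3_def e4_def elim(1-3) by algebra
  then have "gradp e1 e2 e3 e4 x * (m) = 0"
    unfolding dd r elim(4) by simp
  then show "m = 0"
    using \<open>l \<noteq> 0\<close> pivot unfolding g by simp
qed

lemma tangency_A3_distinct:
  fixes a b m n r l S x T :: complex
  assumes elim: "S = 27 * a" "x = 54 * b" "T = (17 + 4 * r) * a - (19 * r - 7) * b" "r ^ 2 = 13"
  defines "e1 \<equiv> x + S + T" and "e2 \<equiv> m + n + x * (S + T) + S * T" and "e3 \<equiv> x * (m + n + S * T) + m * T + n * S" and "e4 \<equiv> m * n + x * (m * T + n * S)"
  assumes dd: "dd2 e1 e2 e3 S m = 0" "dd2 e1 e2 e3 T n = 0"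
    and g: "rem2 e1 e2 e3 e4 S m = l * (- 4 - 2 * r)" "rem2 e1 e2 e3 e4 T n = l * (- 12 + 6 * r)" "gradp e1 e2 e3 e4 x = l * (29 - 5 * r)"
    and "l \<noteq> 0"
  shows "S = 0" "m = 0"
proof -
  have "516 = (29 - 5 * r) * (29 + 5 * r) + 25 * (r ^ 2 - 13)"
    by algebra
  then have pivot: "29 - 5 * r \<noteq> 0"
    using elim by auto
  have r: "(29 - 5 * r) * rem2 e1 e2 e3 e4 S m - (- 4 - 2 * r) * gradp e1 e2 e3 e4 x = 0" "(29 - 5 * r) * rem2 e1 e2 e3 e4 T n - (- 12 + 6 * r) * gradp e1 e2 e3 e4 x = 0"
    unfolding g by algebra+
  have "120 * (gradp e1 e2 e3 e4 x * (S) ^ 2) =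
        (1968204 * a ^ 3 * r + 8339838 * a ^ 3 + 2443410 * a ^ 2 * b * r + 10659690 * a ^ 2 * b + (-71477361) * a * b ^ 2 * r + (-252282771) * a * b ^ 2 + (-8556) * a * m * r + (-31800) * a * m + 7806 * a * n * r + 23766 * a * n + 200593842 * b ^ 3 * r + 719993694 * b ^ 3 + 32568 * b * m * r + 117300 * b * m + (-15168) * b * n * r + (-52584) * b * n) * (dd2 e1 e2 e3 S m)
      + (1715666 * a ^ 3 * r + 8772868 * a ^ 3 + 1478820 * a ^ 2 * b * r + 5274348 * a ^ 2 * b + (-29655849) * a * b ^ 2 * r + (-108769839) * a * b ^ 2 + (-8634) * a * m * r + (-35682) * a * m + 7884 * a * n * r + 27648 * a * n + 37675462 * b ^ 3 * r + 133378118 * b ^ 3 + 17400 * b * m * r + 64716 * b * m) * (dd2 e1 e2 e3 T n)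
      + (10009 * a ^ 2 * r + 37739 * a ^ 2 + (-53411) * a * b * r + (-191215) * a * b + 212620 * b ^ 2 * r + 765530 * b ^ 2) * ((29 - 5 * r) * rem2 e1 e2 e3 e4 S m - (- 4 - 2 * r) * gradp e1 e2 e3 e4 x)
      + (9517 * a ^ 2 * r + 36863 * a ^ 2 + (-34805) * a * b * r + (-126841) * a * b + 30184 * b ^ 2 * r + 107546 * b ^ 2) * ((29 - 5 * r) * rem2 e1 e2 e3 e4 T n - (- 12 + 6 * r) * gradp e1 e2 e3 e4 x)
      + (r ^ 2 - 13) * ((-172433920) * a ^ 6 * r ^ 4 + (-1741949952) * a ^ 6 * r ^ 3 + (-2886087936) * a ^ 6 * r ^ 2 + 52386108160 * a ^ 6 * r + (-78973552800) * a ^ 6 + 3971397120 * a ^ 5 * b * r ^ 4 + 29727201024 * a ^ 5 * b * r ^ 3 + 325507968 * a ^ 5 * b * r ^ 2 + (-649137088320) * a ^ 5 * b * r + 1056703587840 * a ^ 5 * b + (-37792593600) * a ^ 4 * b ^ 2 * r ^ 4 + (-188485312320) * a ^ 4 * b ^ 2 * r ^ 3 + 493288829424 * a ^ 4 * b ^ 2 * r ^ 2 + 4492679511552 * a ^ 4 * b ^ 2 * r + (-8932246804656) * a ^ 4 * b ^ 2 + 13290496 * a ^ 4 * m * r ^ 2 + 84263936 * a ^ 4 * m * r + (-344494080) * a ^ 4 * m + (-1001472) * a ^ 4 * n * r ^ 2 + (-102604800) * a ^ 4 * n * r + 313539840 * a ^ 4 * n + 191614133600 * a ^ 3 * b ^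 3 * r ^ 4 + 510915274320 * a ^ 3 * b ^ 3 * r ^ 3 + (-4263640942944) * a ^ 3 * b ^ 3 * r ^ 2 + (-20284156684592) * a ^ 3 * b ^ 3 * r + 29955778410528 * a ^ 3 * b ^ 3 + (-237160960) * a ^ 3 * b * m * r ^ 2 + (-1946407424) * a ^ 3 * b * m * r + 1841711040 * a ^ 3 * b * m + 3738624 * a ^ 3 * b * n * r ^ 2 + 1441708032 * a ^ 3 * b * n * r + 442496448 * a ^ 3 * b * n + (-553845062850) * a ^ 2 * b ^ 4 * r ^ 4 + (-322019197200) * a ^ 2 * b ^ 4 * r ^ 3 + 14884052451228 * a ^ 2 * b ^ 4 * r ^ 2 + 44609050234752 * a ^ 2 * b ^ 4 * r + (-26997092276202) * a ^ 2 * b ^ 4 + 1633815744 * a ^ 2 * b ^ 2 * m * r ^ 2 + 14422467648 * a ^ 2 * b ^ 2 * m * r + 15630299136 * a ^ 2 * b ^ 2 * m + 325687680 * a ^ 2 * b ^ 2 * n * r ^ 2 + (-6632068608) * a ^ 2 * b ^ 2 * n * r + (-27633408768) * a ^ 2 * b ^ 2 * n + 3247776 * a ^ 2 * m ^ 2 + (-6166080) * a ^ 2 * m * n + 2918304 * a ^ 2 * n ^ 2 + 886073604720 * a * b ^ 5 * r ^ 4 + (-1114801142688) * a * b ^ 5 * r ^ 3 + (-23226086091744) * a * b ^ 5 * r ^ 2 + (-29309485374816) * a * b ^ 5 * r + 20489187971952 * a * b ^ 5 + (-5165886592) * a * b ^ 3 * m * r ^ 2 + (-37804305728) * a * b ^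 3 * m * r + (-109358463744) * a * b ^ 3 * m + (-2917772544) * a * b ^ 3 * n * r ^ 2 + 13436912640 * a * b ^ 3 * n * r + 90442594368 * a * b ^ 3 * n + (-25249536) * a * b * m ^ 2 + 35390592 * a * b * m * n + (-10141056) * a * b * n ^ 2 + (-631981263820) * b ^ 6 * r ^ 4 + 1882046661816 * b ^ 6 * r ^ 3 + 12690058443504 * b ^ 6 * r ^ 2 + (-12493723097336) * b ^ 6 * r + (-56405733270372) * b ^ 6 + 6326233312 * b ^ 4 * m * r ^ 2 + 19867719968 * b ^ 4 * m * r + 122835417408 * b ^ 4 * m + 6620231712 * b ^ 4 * n * r ^ 2 + (-16467183264) * b ^ 4 * n * r + (-83644331328) * b ^ 4 * n + 82900800 * b ^ 2 * m ^ 2 + (-67819392) * b ^ 2 * m * n + (-15081408) * b ^ 2 * n ^ 2)"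
    unfolding dd2_def rem2_def gradp_def tw0_def tw1_def quad3_def lin3_def const3_def e1_def e2_def e3_def e4_def elim(1-3) by algebra
  then have "gradp e1 e2 e3 e4 x * (S) ^ 2 = 0"
    unfolding dd r elim(4) by simp
  then show "S = 0"
    using \<open>l \<noteq> 0\<close> pivot unfolding g by simp
  have "99360 * (gradp e1 e2 e3 e4 x * (m)) =
        (20252403 * a ^ 3 * r + (-298995111) * a ^ 3 + (-1940337180) * a ^ 2 * b * r + (-7763182560) * a ^ 2 * b + 15173345655 * a * b ^ 2 * r + 53309985003 * a * b ^ 2 + 2658204 * a * m * r + 14029092 * a * m + (-927720) * a * n * r + (-777168) * a * n + (-27976502088) * b ^ 3 * r + (-80275706208) * b ^ 3 + (-10698588) * b * m * r + (-34848036) * b * m + 6966594 * b * n * r + 8405910 * b * n) * (dd2 e1 e2 e3 S m)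
      + (246044529 * a ^ 3 * r + (-1343978037) * a ^ 3 + (-1951886430) * a ^ 2 * b * r + 419346342 * a ^ 2 * b + 3678876657 * a * b ^ 2 * r + 13853149389 * a * b ^ 2 + 1671192 * a * m * r + 15869520 * a * m + 59292 * a * n * r + (-2617596) * a * n + (-3089643084) * b ^ 3 * r + (-12955851792) * b ^ 3 + (-3731994) * b * m * r + (-26442126) * b * m) * (dd2 e1 e2 e3 T n)
      + ((-1626192) * a ^ 2 * r + (-5256972) * a ^ 2 + 18567486 * a * b * r + 67110642 * a * b + (-36227070) * b ^ 2 * r + (-134808750) * b ^ 2 + (-460) * m * r + (-1150) * m + 8740 * n * r + 34270 * n) * ((29 - 5 * r) * rem2 e1 e2 e3 e4 S m - (- 4 - 2 * r) * gradp e1 e2 e3 e4 x)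
      + ((-982836) * a ^ 2 * r + (-3277224) * a ^ 2 + 7660242 * a * b * r + 27612558 * a * b + (-11118798) * b ^ 2 * r + (-41847534) * b ^ 2 + 3680 * m * r + 15410 * m + 4600 * n * r + 17710 * n) * ((29 - 5 * r) * rem2 e1 e2 e3 e4 T n - (- 12 + 6 * r) * gradp e1 e2 e3 e4 x)
      + (r ^ 2 - 13) * (20082908160 * a ^ 6 * r ^ 4 + 179022237696 * a ^ 6 * r ^ 3 + (-950402391552) * a ^ 6 * r ^ 2 + (-13144772947968) * a ^ 6 * r + 35220236253120 * a ^ 6 + (-560730608640) * a ^ 5 * b * r ^ 4 + (-3836442216960) * a ^ 5 * b * r ^ 3 + 24923114353152 * a ^ 5 * b * r ^ 2 + 224560551712896 * a ^ 5 * b * r + (-500812916036544) * a ^ 5 * b + 6418340035200 * a ^ 4 * b ^ 2 * r ^ 4 + 30729665029248 * a ^ 4 * b ^ 2 * r ^ 3 + (-253574154748512) * a ^ 4 * b ^ 2 * r ^ 2 + (-1421823694952160) * a ^ 4 * b ^ 2 * r + 2477787671077632 * a ^ 4 * b ^ 2 + (-50048000) * a ^ 4 * m * r ^ 4 + (-619417600) * a ^ 4 * m * r ^ 3 + (-4524957696) * a ^ 4 * m * r ^ 2 + (-27979824640) * a ^ 4 * m * r + (-13144721216) * a ^ 4 * m + (-98329600) * a ^ 4 * n * r ^ 4 + (-910991360) * a ^ 4 * n * r ^ 3 + (-1209550848) * a ^ 4 * n * r ^ 2 + 52219462144 * a ^ 4 * n * r + 18094945856 * a ^ 4 * n + (-38480075553600)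 * a ^ 3 * b ^ 3 * r ^ 4 + (-106900494208992) * a ^ 3 * b ^ 3 * r ^ 3 + 1269757665373392 * a ^ 3 * b ^ 3 * r ^ 2 + 4234403974817664 * a ^ 3 * b ^ 3 * r + (-4972555194949296) * a ^ 3 * b ^ 3 + 950912000 * a ^ 3 * b * m * r ^ 4 + 8565568000 * a ^ 3 * b * m * r ^ 3 + 64157726208 * a ^ 3 * b * m * r ^ 2 + 678950147200 * a ^ 3 * b * m * r + 265324835840 * a ^ 3 * b * m + 1868262400 * a ^ 3 * b * n * r ^ 4 + 11984729600 * a ^ 3 * b * n * r ^ 3 + 18557689344 * a ^ 3 * b * n * r ^ 2 + (-440702859136) * a ^ 3 * b * n * r + (-1379819861888) * a ^ 3 * b * n + 127050793091100 * a ^ 2 * b ^ 4 * r ^ 4 + 107877588610248 * a ^ 2 * b ^ 4 * r ^ 3 + (-3239921919232224) * a ^ 2 * b ^ 4 * r ^ 2 + (-6188753820875976) * a ^ 2 * b ^ 4 * r + 3565350947870532 * a ^ 2 * b ^ 4 + (-6775248000) * a ^ 2 * b ^ 2 * m * r ^ 4 + (-38205686400) * a ^ 2 * b ^ 2 * m * r ^ 3 + (-339951345408) * a ^ 2 * b ^ 2 * m * r ^ 2 + (-4225185510144) * a ^ 2 * b ^ 2 * m * r + (-5004405632640) * a ^ 2 * b ^ 2 * m + (-13311369600) * a ^ 2 * b ^ 2 * n * r ^ 4 + (-47456941440) * a ^ 2 * b ^ 2 * n * r ^ 3 + (-129634579584) * a ^ 2 * b ^ 2 * n * r ^ 2 +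 1482348009984 * a ^ 2 * b ^ 2 * n * r + 7625601105024 * a ^ 2 * b ^ 2 * n + (-5593600) * a ^ 2 * m ^ 2 * r ^ 2 + (-125002240) * a ^ 2 * m ^ 2 * r + (-524529856) * a ^ 2 * m ^ 2 + 2237440 * a ^ 2 * m * n * r ^ 2 + 69713920 * a ^ 2 * m * n * r + 994377856 * a ^ 2 * m * n + 11834880 * a ^ 2 * n ^ 2 * r ^ 2 + 12894720 * a ^ 2 * n ^ 2 * r + (-416856000) * a ^ 2 * n ^ 2 + (-217949700792960) * a * b ^ 5 * r ^ 4 + 205261188908112 * a * b ^ 5 * r ^ 3 + 3887816443738272 * a * b ^ 5 * r ^ 2 + 3549264502213008 * a * b ^ 5 * r + (-1205429561951040) * a * b ^ 5 + 21454952000 * a * b ^ 3 * m * r ^ 4 + 48708719200 * a * b ^ 3 * m * r ^ 3 + 826654490976 * a * b ^ 3 * m * r ^ 2 + 8924324714368 * a * b ^ 3 * m * r + 15749289896384 * a * b ^ 3 * m + 42152670400 * a * b ^ 3 * n * r ^ 4 + 30155167520 * a * b ^ 3 * n * r ^ 3 + 493924237728 * a * b ^ 3 * n * r ^ 2 + (-3414888601216) * a * b ^ 3 * n * r + (-13934159562944) * a * b ^ 3 * n + 53139200 * a * b * m ^ 2 * r ^ 2 + 575463680 * a * b * m ^ 2 * r + 7880693504 * a * b * m ^ 2 + (-21255680) * a * b * m * n * r ^ 2 + (-451639040) * a * b * m * n * r + (-8824127744) * a * b * m * n + (-112431360) * a * b * n ^ 2 * r ^ 2 + 107220480 * a * b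 * n ^ 2 * r + 869245440 * a * b * n ^ 2 + 150512927920740 * b ^ 6 * r ^ 4 + (-375139730969352) * b ^ 6 * r ^ 3 + (-1712195095872528) * b ^ 6 * r ^ 2 + 744684922448136 * b ^ 6 * r + 1005095045337516 * b ^ 6 + (-25477755500) * b ^ 4 * m * r ^ 4 + 27986091800 * b ^ 4 * m * r ^ 3 + (-828856462080) * b ^ 4 * m * r ^ 2 + (-5580565850584) * b ^ 4 * m * r + (-12915461277908) * b ^ 4 * m + (-50056296100) * b ^ 4 * n * r ^ 4 + 106839350680 * b ^ 4 * n * r ^ 3 + (-794380586640) * b ^ 4 * n * r ^ 2 + 3423021682024 * b ^ 4 * n * r + 10207651778612 * b ^ 4 * n + (-126205600) * b ^ 2 * m ^ 2 * r ^ 2 + 86910560 * b ^ 2 * m ^ 2 * r + (-14090055808) * b ^ 2 * m ^ 2 + 50482240 * b ^ 2 * m * n * r ^ 2 + 572365120 * b ^ 2 * m * n * r + 17077251328 * b ^ 2 * m * n + 267024480 * b ^ 2 * n ^ 2 * r ^ 2 + (-800234400) * b ^ 2 * n ^ 2 * r + 1674510720 * b ^ 2 * n ^ 2 + (-772800) * m ^ 3 + 1788480 * m ^ 2 * n + (-1258560) * m * n ^ 2 + 242880 * n ^ 3)"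
    unfolding dd2_def rem2_def gradp_def tw0_def tw1_def quad3_def lin3_def const3_def e1_def e2_def e3_def e4_def elim(1-3) by algebra
  then have "gradp e1 e2 e3 e4 x * (m) = 0"
    unfolding dd r elim(4) by simp
  then show "m = 0"
    using \<open>l \<noteq> 0\<close> pivot unfolding g by simp
qed

text \<open>Three equal coordinates p and a pair u + k w, u - k w with k^2 = -3; u1 and w1 clear the
  denominators of the hyperplane equation. The relation obtained fixes u : w, hence the projective
  point.\<close>

lemma tangency_D4_equal:
  fixes u1 w1 r l u w p :: complex
  assumes elim: "u = 6 * u1" "w = 6 * w1" "p = (15 - 3 * r) * u1 + (17 - 5 * r) * w1" "r ^ 2 = 13"
  defines "e1 \<equiv> 3 * p + 2 * u" and "e2 \<equiv> 3 * p ^ 2 + (u ^ 2 + 3 * w ^ 2) + 6 * p * u" and "e3 \<equiv> p ^ 3 + 6 * p ^ 2 * u + 3 * p * (u ^ 2 + 3 * w ^ 2)" and "e4 \<equiv> 2 * p ^ 3 * u + 3 * p ^ 2 * (u ^ 2 + 3 * w ^ 2)"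
  assumes g: "gradp e1 e2 e3 e4 p = l * 12" "tw0 e1 e2 e3 e4 (- 3) u w = l * (- 45 + 9 * r)" "tw1 e1 e2 e3 e4 (- 3) u w = l * (17 - 5 * r)"
    and "l \<noteq> 0"
  shows "(2 - r) * u - (1 + 2 * r) * w = 0"
proof -
  have r: "12 * tw0 e1 e2 e3 e4 (- 3) u w - (- 45 + 9 * r) * gradp e1 e2 e3 e4 p = 0" "12 * tw1 e1 e2 e3 e4 (- 3) u w - (17 - 5 * r) * gradp e1 e2 e3 e4 p = 0"
    unfolding g by algebra+
  have "40 * (gradp e1 e2 e3 e4 p * ((2 - r) * u - (1 + 2 * r) * w) ^ 2) =
        (7 * u1 ^ 2 * r + 85 * u1 ^ 2 + (-1670) * u1 * w1 * r + (-6458) * u1 * w1 + (-725) * w1 ^ 2 * r + (-3295) * w1 ^ 2) * (12 * tw0 e1 e2 e3 e4 (- 3) u w - (- 45 + 9 * r) * gradp e1 e2 e3 e4 p)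
      + (395 * u1 ^ 2 * r + 245 * u1 ^ 2 + 474 * u1 * w1 * r + (-1650) * u1 * w1 + (-705) * w1 ^ 2 * r + (-5151) * w1 ^ 2) * (12 * tw1 e1 e2 e3 e4 (- 3) u w - (17 - 5 * r) * gradp e1 e2 e3 e4 p)
      + (r ^ 2 - 13) * (191160 * u1 ^ 6 * r ^ 4 + (-3304800) * u1 ^ 6 * r ^ 3 + 20898000 * u1 ^ 6 * r ^ 2 + (-56700000) * u1 ^ 6 * r + 54675000 * u1 ^ 6 + 5988600 * u1 ^ 5 * w1 * r ^ 4 + (-105343200) * u1 ^ 5 * w1 * r ^ 3 + 662055120 * u1 ^ 5 * w1 * r ^ 2 + (-1748947680) * u1 ^ 5 * w1 * r + 1250114040 * u1 ^ 5 * w1 + 33496200 * u1 ^ 4 * w1 ^ 2 * r ^ 4 + (-575264160) * u1 ^ 4 * w1 ^ 2 * r ^ 3 + 3561194160 * u1 ^ 4 * w1 ^ 2 * r ^ 2 + (-9495303840) * u1 ^ 4 * w1 ^ 2 * r + 8553624840 * u1 ^ 4 * w1 ^ 2 + 74658000 * u1 ^ 3 * w1 ^ 3 * r ^ 4 + (-1259928000) * u1 ^ 3 * w1 ^ 3 * r ^ 3 + 7791907680 * u1 ^ 3 * w1 ^ 3 * r ^ 2 + (-22434997440) * u1 ^ 3 * w1 ^ 3 * r + 21679229520 * u1 ^ 3 * w1 ^ 3 + 70145000 * u1 ^ 2 * w1 ^ 4 * r ^ 4 + (-1206404000) * u1 ^ 2 * w1 ^ 4 * r ^ 3 + 7676131440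 * u1 ^ 2 * w1 ^ 4 * r ^ 2 + (-24387769760) * u1 ^ 2 * w1 ^ 4 * r + 27746434280 * u1 ^ 2 * w1 ^ 4 + 15675000 * u1 * w1 ^ 5 * r ^ 4 + (-365820000) * u1 * w1 ^ 5 * r ^ 3 + 2672830800 * u1 * w1 ^ 5 * r ^ 2 + (-9779399520) * u1 * w1 ^ 5 * r + 12911111160 * u1 * w1 ^ 5 + (-8625000) * w1 ^ 6 * r ^ 4 + 63300000 * w1 ^ 6 * r ^ 3 + (-206406000) * w1 ^ 6 * r ^ 2 + (-431023200) * w1 ^ 6 * r + (-2253930600) * w1 ^ 6)"
    unfolding dd2_def rem2_def gradp_def tw0_def tw1_def quad3_def lin3_def const3_def e1_def e2_def e3_def e4_def elim(1-3) by algebra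
  then have "gradp e1 e2 e3 e4 p * ((2 - r) * u - (1 + 2 * r) * w) ^ 2 = 0"
    unfolding r elim(4) by simp
  then show "(2 - r) * u - (1 + 2 * r) * w = 0"
    using \<open>l \<noteq> 0\<close> unfolding g by simp
qed

text \<open>Excludes coordinates p, p, q with p different from q among the three that carry equal
  coefficients.\<close>

lemma tangency_D4_two_equal:
  fixes p u1 w1 r l u w q :: complex
  assumes elim: "u = 2 * u1" "w = 2 * w1" "q = (15 - 3 * r) * u1 + (17 - 5 * r) * w1 - 2 * p" "r ^ 2 = 13"
  defines "e1 \<equiv> 2 * p + q + 2 * u" and "e2 \<equiv> p ^ 2 + 2 * p * q + (u ^ 2 + 3 * w ^ 2) + 2 * u * (2 * p + q)" and "e3 \<equiv> p ^ 2 * q + 2 * u * (p ^ 2 + 2 * p * q) + (2 * p + q) * (u ^ 2 + 3 * w ^ 2)" and "e4 \<equiv> 2 * u * p ^ 2 * q + (p ^ 2 + 2 * p * q) * (u ^ 2 + 3 * w ^ 2)"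
  assumes dd: "dd2 e1 e2 e3 (p + q) (p * q) = 0"
    and g: "gradp e1 e2 e3 e4 p = l * 12" "tw0 e1 e2 e3 e4 (- 3) u w = l * (- 45 + 9 * r)" "tw1 e1 e2 e3 e4 (- 3) u w = l * (17 - 5 * r)"
    and "l \<noteq> 0"
  shows "p - q = 0"
proof -
  have r: "12 * tw0 e1 e2 e3 e4 (- 3) u w - (- 45 + 9 * r) * gradp e1 e2 e3 e4 p = 0" "12 * tw1 e1 e2 e3 e4 (- 3) u w - (17 - 5 * r) * gradp e1 e2 e3 e4 p = 0"
    unfolding g by algebra+
  have "5524020 * (gradp e1 e2 e3 e4 p * (p - q) ^ 2) =
        (2570733 * p ^ 3 * r + 13646763 * p ^ 3 + (-17892756) * p ^ 2 * u1 * r + (-161084034) * p ^ 2 * u1 + 55464714 * p ^ 2 * w1 * r + 82921248 * p ^ 2 * w1 + (-934524) * p * u1 ^ 2 * r + 479864250 * p * u1 ^ 2 + (-403794744) * p * u1 * w1 * r + (-496671852) * p * u1 * w1 + (-36450576) * p * w1 ^ 2 * r + 299696742 * p * w1 ^ 2 + (-91057851) * u1 ^ 3 * r + 108944757 * u1 ^ 3 + (-183059721) * u1 ^ 2 * w1 * r + 3379341699 * u1 ^ 2 * w1 + (-1133116557) * u1 * w1 ^ 2 * r + 4303332339 * u1 * w1 ^ 2 + (-834157287) * w1 ^ 3 * r + 2008517373 * w1 ^ 3) * (dd2 e1 e2 e3 (p + q) (p * q))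
      + ((-268620) * p ^ 2 * r + (-686160) * p ^ 2 + 3467756 * p * u1 * r + 6402412 * p * u1 + (-753600) * p * w1 * r + (-12783588) * p * w1 + (-6327915) * u1 ^ 2 * r + 11371767 * u1 ^ 2 + (-5922097) * u1 * w1 * r + 90221197 * u1 * w1 + (-13485900) * w1 ^ 2 * r + 40232928 * w1 ^ 2) * (12 * tw0 e1 e2 e3 e4 (- 3) u w - (- 45 + 9 * r) * gradp e1 e2 e3 e4 p)
      + (1981485 * p ^ 2 * r + 7023393 * p ^ 2 + (-8652096) * p * u1 * r + (-28072980) * p * u1 + 1779732 * p * w1 * r + 7971588 * p * w1 + 11390625 * u1 ^ 2 * r + 20915739 * u1 ^ 2 + 3861891 * u1 * w1 * r + (-16054011) * u1 * w1) * (12 * tw1 e1 e2 e3 e4 (- 3) u w - (17 - 5 * r) * gradp e1 e2 e3 e4 p)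
      + (r ^ 2 - 13) * (986000400 * p ^ 6 + 5916002400 * p ^ 5 * u1 * r + (-34884535680) * p ^ 5 * u1 + 9860004000 * p ^ 5 * w1 * r + (-33810364800) * p ^ 5 * w1 + 13311005400 * p ^ 4 * u1 ^ 2 * r ^ 2 + (-165916844640) * p ^ 4 * u1 ^ 2 * r + 496610654760 * p ^ 4 * u1 ^ 2 + 44370018000 * p ^ 4 * u1 * w1 * r ^ 2 + (-426792988800) * p ^ 4 * u1 * w1 * r + 933268580400 * p ^ 4 * u1 * w1 + 36975015000 * p ^ 4 * w1 ^ 2 * r ^ 2 + (-250441524000) * p ^ 4 * w1 ^ 2 * r + 418269318120 * p ^ 4 * w1 ^ 2 + 13311005400 * p ^ 3 * u1 ^ 3 * r ^ 3 + (-275684569200) * p ^ 3 * u1 ^ 3 * r ^ 2 + 1767551031432 * p ^ 3 * u1 ^ 3 * r + (-3596901513552) * p ^ 3 * u1 ^ 3 + 66555027000 * p ^ 3 * u1 ^ 2 * w1 * r ^ 3 + (-1138700754000) * p ^ 3 * u1 ^ 2 * w1 * r ^ 2 + 5972849732520 * p ^ 3 * u1 ^ 2 * w1 * r + (-9765526513968) * p ^ 3 * u1 ^ 2 * w1 + 110925045000 * p ^ 3 * u1 * w1 ^ 2 * r ^ 3 + (-1498297770000) * p ^ 3 * u1 * w1 ^ 2 * r ^ 2 + 6206493927960 * p ^ 3 * u1 * w1 ^ 2 * r + (-8264662822320) * p ^ 3 * u1 * w1 ^ 2 + 61625025000 * p ^ 3 * w1 ^ 3 * r ^ 3 + (-610422750000)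 * p ^ 3 * w1 ^ 3 * r ^ 2 + 1936013916600 * p ^ 3 * w1 ^ 3 * r + (-1997347980240) * p ^ 3 * w1 ^ 3 + 4991627025 * p ^ 2 * u1 ^ 4 * r ^ 4 + (-178056237960) * p ^ 2 * u1 ^ 4 * r ^ 3 + 1962085047066 * p ^ 2 * u1 ^ 4 * r ^ 2 + (-8722165433616) * p ^ 2 * u1 ^ 4 * r + 13684880821869 * p ^ 2 * u1 ^ 4 + 33277513500 * p ^ 2 * u1 ^ 3 * w1 * r ^ 4 + (-991689512400) * p ^ 2 * u1 ^ 3 * w1 * r ^ 3 + 9304754403960 * p ^ 2 * u1 ^ 3 * w1 * r ^ 2 + (-35239279789872) * p ^ 2 * u1 ^ 3 * w1 * r + 46934816848812 * p ^ 2 * u1 ^ 3 * w1 + 83193783750 * p ^ 2 * u1 ^ 2 * w1 ^ 2 * r ^ 4 + (-1990843596000) * p ^ 2 * u1 ^ 2 * w1 ^ 2 * r ^ 3 + 15323635508220 * p ^ 2 * u1 ^ 2 * w1 ^ 2 * r ^ 2 + (-48162359792016) * p ^ 2 * u1 ^ 2 * w1 ^ 2 * r + 54632815625070 * p ^ 2 * u1 ^ 2 * w1 ^ 2 + 92437537500 * p ^ 2 * u1 * w1 ^ 3 * r ^ 4 + (-1669403790000) * p ^ 2 * u1 * w1 ^ 3 * r ^ 3 + 9874073273400 * p ^ 2 * u1 * w1 ^ 3 * r ^ 2 + (-24279885841680) * p ^ 2 * u1 * w1 ^ 3 * r + 21922021914732 * p ^ 2 * u1 * w1 ^ 3 + 38515640625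 * p ^ 2 * w1 ^ 4 * r ^ 4 + (-469482975000) * p ^ 2 * w1 ^ 4 * r ^ 3 + 1829156168250 * p ^ 2 * w1 ^ 4 * r ^ 2 + (-2526298279200) * p ^ 2 * w1 ^ 4 * r + 648104836365 * p ^ 2 * w1 ^ 4 + (-30160465020) * p * u1 ^ 5 * r ^ 4 + 659529518292 * p * u1 ^ 5 * r ^ 3 + (-5333182761852) * p * u1 ^ 5 * r ^ 2 + 18914097184812 * p * u1 ^ 5 * r + (-24831816026760) * p * u1 ^ 5 + (-194718937500) * p * u1 ^ 4 * w1 * r ^ 4 + 3758399577180 * p * u1 ^ 4 * w1 * r ^ 3 + (-26773834034196) * p * u1 ^ 4 * w1 * r ^ 2 + 83663897679108 * p * u1 ^ 4 * w1 * r + (-97016822016048) * p * u1 ^ 4 * w1 + (-460335555000) * p * u1 ^ 3 * w1 ^ 2 * r ^ 4 + 7581107341800 * p * u1 ^ 3 * w1 ^ 2 * r ^ 3 + (-46048071285144) * p * u1 ^ 3 * w1 ^ 2 * r ^ 2 + 124142219621784 * p * u1 ^ 3 * w1 ^ 2 * r + (-127909544864688) * p * u1 ^ 3 * w1 ^ 2 + (-452679975000) * p * u1 ^ 2 * w1 ^ 3 * r ^ 4 + 5799317751000 * p * u1 ^ 2 * w1 ^ 3 * r ^ 3 + (-26904464041320) * p * u1 ^ 2 * w1 ^ 3 * r ^ 2 + 56098637782632 * p * u1 ^ 2 * w1 ^ 3 * r + (-47650811945472) * p * u1 ^ 2 * w1 ^ 3 + (-115111687500) * p * u1 * w1 ^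 4 * r ^ 4 + 310345162500 * p * u1 * w1 ^ 4 * r ^ 3 + 3996146985300 * p * u1 * w1 ^ 4 * r ^ 2 + (-19343478310020) * p * u1 * w1 ^ 4 * r + 22640187638904 * p * u1 * w1 ^ 4 + 49003312500 * p * w1 ^ 5 * r ^ 4 + (-1012647712500) * p * w1 ^ 5 * r ^ 3 + 6212408413500 * p * w1 ^ 5 * r ^ 2 + (-15654101193900) * p * w1 ^ 5 * r + 14572163562480 * p * w1 ^ 5 + 25996212900 * u1 ^ 6 * r ^ 4 + (-514444525380) * u1 ^ 6 * r ^ 3 + 3792299141844 * u1 ^ 6 * r ^ 2 + (-12337758464940) * u1 ^ 6 * r + 14939246388600 * u1 ^ 6 + 135597615840 * u1 ^ 5 * w1 * r ^ 4 + (-2445452702424) * u1 ^ 5 * w1 * r ^ 3 + 16491353834520 * u1 ^ 5 * w1 * r ^ 2 + (-49446428251176) * u1 ^ 5 * w1 * r + 55721897862408 * u1 ^ 5 * w1 + 175092483600 * u1 ^ 4 * w1 ^ 2 * r ^ 4 + (-2682602114220) * u1 ^ 4 * w1 ^ 2 * r ^ 3 + 15963622496820 * u1 ^ 4 * w1 ^ 2 * r ^ 2 + (-45307527539364) * u1 ^ 4 * w1 ^ 2 * r + 52534659448332 * u1 ^ 4 * w1 ^ 2 + (-192260466000) * u1 ^ 3 * w1 ^ 3 * r ^ 4 + 3551812081200 * u1 ^ 3 * w1 ^ 3 * r ^ 3 + (-21431268247248) * u1 ^ 3 * w1 ^ 3 * r ^ 2 + 49465535541840 * u1 ^ 3 *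 w1 ^ 3 * r + (-33660813358944) * u1 ^ 3 * w1 ^ 3 + (-610663927500) * u1 ^ 2 * w1 ^ 4 * r ^ 4 + 8795883190500 * u1 ^ 2 * w1 ^ 4 * r ^ 3 + (-44728865956260) * u1 ^ 2 * w1 ^ 4 * r ^ 2 + 95246128604556 * u1 ^ 2 * w1 ^ 4 * r + (-69692236206336) * u1 ^ 2 * w1 ^ 4 + (-416431350000) * u1 * w1 ^ 5 * r ^ 4 + 4694735145000 * u1 * w1 ^ 5 * r ^ 3 + (-18504507313800) * u1 * w1 ^ 5 * r ^ 2 + 29455313768280 * u1 * w1 ^ 5 * r + (-14628579639816) * u1 * w1 ^ 5 + (-52273125000) * w1 ^ 6 * r ^ 4 + 111823087500 * w1 ^ 6 * r ^ 3 + 1809106177500 * w1 ^ 6 * r ^ 2 + (-8322315738300) * w1 ^ 6 * r + 9778760142300 * w1 ^ 6)"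
    unfolding dd2_def rem2_def gradp_def tw0_def tw1_def quad3_def lin3_def const3_def e1_def e2_def e3_def e4_def elim(1-3) by algebra
  then have "gradp e1 e2 e3 e4 p * (p - q) ^ 2 = 0"
    unfolding dd r elim(4) by simp
  then show "p - q = 0"
    using \<open>l \<noteq> 0\<close> unfolding g by simp
qed

text \<open>If the first three coordinates are distinct, the remainder modulo their cubic has no
  quadratic or linear term. This forces the last two coordinates to vanish, after which a direct
  argument ends the case.\<close>

lemma tangency_D4_distinct:
  fixes u1 w1 m n r l u w S :: complex
  assumes elim: "u = 2 * u1" "w = 2 * w1" "S = (15 - 3 * r) * u1 + (17 - 5 * r) * w1" "r ^ 2 = 13"
  defines "e1 \<equiv> S + 2 * u" and "e2 \<equiv> m + (u ^ 2 + 3 * w ^ 2) + 2 * u * S" and "e3 \<equiv> n + 2 * u * m + S * (u ^ 2 + 3 * w ^ 2)" and "e4 \<equiv> 2 * u * n + m * (u ^ 2 + 3 * w ^ 2)"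
  assumes dd: "quad3 e1 e2 S m = 0" "lin3 e1 e2 e3 S m n = 0"
    and g: "const3 e1 e2 e3 e4 S n = l * 12" "tw0 e1 e2 e3 e4 (- 3) u w = l * (- 45 + 9 * r)" "tw1 e1 e2 e3 e4 (- 3) u w = l * (17 - 5 * r)"
    and "l \<noteq> 0"
  shows "u = 0" "w = 0"
proof -
  have r: "12 * tw0 e1 e2 e3 e4 (- 3) u w - (- 45 + 9 * r) * const3 e1 e2 e3 e4 S n = 0" "12 * tw1 e1 e2 e3 e4 (- 3) u w - (17 - 5 * r) * const3 e1 e2 e3 e4 S n = 0"
    unfolding g by algebra+
  have "4320 * (const3 e1 e2 e3 e4 S n * (u)) =
        (63828 * u1 ^ 3 * r + (-196668) * u1 ^ 3 + 477468 * u1 ^ 2 * w1 * r + (-387396) * u1 ^ 2 * w1 + 379884 * u1 * w1 ^ 2 * r + (-1905348) * u1 * w1 ^ 2 + (-528) * u1 * m * r + (-696) * u1 * m + 157380 * w1 ^ 3 * r + (-1068828) * w1 ^ 3 + (-6600) * w1 * m * r + (-21408) * w1 * m) * (quad3 e1 e2 S m)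
      + (3888 * u1 ^ 2 * r + (-3456) * u1 ^ 2 + 60816 * u1 * w1 * r + 153168 * u1 * w1 + (-3360) * w1 ^ 2 * r + (-64176) * w1 ^ 2) * (lin3 e1 e2 e3 S m n)
      + (95 * u1 * r + 97 * u1 + 1105 * w1 * r + 3515 * w1) * (12 * tw0 e1 e2 e3 e4 (- 3) u w - (- 45 + 9 * r) * const3 e1 e2 e3 e4 S n)
      + (1215 * u1 * r + 3645 * u1 + (-315) * w1 * r + (-2061) * w1) * (12 * tw1 e1 e2 e3 e4 (- 3) u w - (17 - 5 * r) * const3 e1 e2 e3 e4 S n)
      + (r ^ 2 - 13) * (2114100 * u1 ^ 5 * r ^ 4 + (-39171600) * u1 ^ 5 * r ^ 3 + 266889816 * u1 ^ 5 * r ^ 2 + (-791997264) * u1 ^ 5 * r + 862878420 * u1 ^ 5 + 9428400 * u1 ^ 4 * w1 * r ^ 4 + (-143324640) * u1 ^ 4 * w1 * r ^ 3 + 707141664 * u1 ^ 4 * w1 * r ^ 2 + (-1129926240) * u1 ^ 4 * w1 * r + (-36437904) * u1 ^ 4 * w1 + 4131000 * u1 ^ 3 * w1 ^ 2 * r ^ 4 + 59810400 * u1 ^ 3 * w1 ^ 2 * r ^ 3 + (-1489719600) * u1 ^ 3 * w1 ^ 2 * r ^ 2 + 7936444512 * u1 ^ 3 * w1 ^ 2 * r + (-12756824136) * u1 ^ 3 * w1 ^ 2 + (-1127520) * u1 ^ 3 * m * r ^ 2 + 10044864 * u1 ^ 3 * m * r + (-21553632) * u1 ^ 3 * m + (-38610000)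 * u1 ^ 2 * w1 ^ 3 * r ^ 4 + 874296000 * u1 ^ 2 * w1 ^ 3 * r ^ 3 + (-7128686880) * u1 ^ 2 * w1 ^ 3 * r ^ 2 + 24666934080 * u1 ^ 2 * w1 ^ 3 * r + (-30804967056) * u1 ^ 2 * w1 ^ 3 + (-1270080) * u1 ^ 2 * w1 * m * r ^ 2 + 3617280 * u1 ^ 2 * w1 * m * r + 13960896 * u1 ^ 2 * w1 * m + 501120 * u1 ^ 2 * n * r + (-1853568) * u1 ^ 2 * n + (-70087500) * u1 * w1 ^ 4 * r ^ 4 + 1272990000 * u1 * w1 ^ 4 * r ^ 3 + (-8549418600) * u1 * w1 ^ 4 * r ^ 2 + 25235568240 * u1 * w1 ^ 4 * r + (-27775746540) * u1 * w1 ^ 4 + 5162400 * u1 * w1 ^ 2 * m * r ^ 2 + (-54826560) * u1 * w1 ^ 2 * m * r + 137291040 * u1 * w1 ^ 2 * m + (-270720) * u1 * w1 * n * r + 1176960 * u1 * w1 * n + 83520 * u1 * m ^ 2 + (-36000000) * w1 ^ 5 * r ^ 4 + 572100000 * w1 ^ 5 * r ^ 3 + (-3368088000) * w1 ^ 5 * r ^ 2 + 8816234400 * w1 ^ 5 * r + (-8748447360) * w1 ^ 5 + 6912000 * w1 ^ 3 * m * r ^ 2 + (-54921600) * w1 ^ 3 * m * r + 111820800 * w1 ^ 3 * m + (-1843200) * w1 ^ 2 * n * r + 6247680 * w1 ^ 2 * n + (-184320) * w1 * m ^ 2)"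
    unfolding dd2_def rem2_def gradp_def tw0_def tw1_def quad3_def lin3_def const3_def e1_def e2_def e3_def e4_def elim(1-3) by algebra
  then have "const3 e1 e2 e3 e4 S n * (u) = 0"
    unfolding dd r elim(4) by simp
  then show "u = 0"
    using \<open>l \<noteq> 0\<close> unfolding g by simp
  have "480 * (const3 e1 e2 e3 e4 S n * (w)) =
        ((-8100) * u1 ^ 3 * r + 15228 * u1 ^ 3 + (-23484) * u1 ^ 2 * w1 * r + 121524 * u1 ^ 2 * w1 + (-35292) * u1 * w1 ^ 2 * r + 179652 * u1 * w1 ^ 2 + 168 * u1 * m * r + 480 * u1 * m + (-22884) * w1 ^ 3 * r + 66156 * w1 ^ 3 + (-144) * w1 * m * r + (-744) * w1 * m) * (quad3 e1 e2 S m)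
      + ((-864) * u1 ^ 2 * r + (-1296) * u1 ^ 2 + 432 * u1 * w1 * r + 7728 * u1 * w1 + 912 * w1 ^ 2 * r + 7872 * w1 ^ 2) * (lin3 e1 e2 e3 S m n)
      + ((-29) * u1 * r + (-79) * u1 + 25 * w1 * r + 135 * w1) * (12 * tw0 e1 e2 e3 e4 (- 3) u w - (- 45 + 9 * r) * const3 e1 e2 e3 e4 S n)
      + (15 * u1 * r + 105 * u1 + 57 * w1 * r + 267 * w1) * (12 * tw1 e1 e2 e3 e4 (- 3) u w - (17 - 5 * r) * const3 e1 e2 e3 e4 S n)
      + (r ^ 2 - 13) * (136080 * u1 ^ 5 * r ^ 4 + (-2848608) * u1 ^ 5 * r ^ 3 + 22946976 * u1 ^ 5 * r ^ 2 + (-83055456) * u1 ^ 5 * r + 112628880 * u1 ^ 5 + 931500 * u1 ^ 4 * w1 * r ^ 4 + (-18007920) * u1 ^ 4 * w1 * r ^ 3 + 132760296 * u1 ^ 4 * w1 * r ^ 2 + (-437077296) * u1 ^ 4 * w1 * r + 536969484 * u1 ^ 4 * w1 + 2430000 * u1 ^ 3 * w1 ^ 2 * r ^ 4 + (-42724800) * u1 ^ 3 * w1 ^ 2 * r ^ 3 + 284135904 * u1 ^ 3 * w1 ^ 2 * r ^ 2 + (-843981120) * u1 ^ 3 * w1 ^ 2 * r + 943471344 * u1 ^ 3 * w1 ^ 2 + (-72576) * u1 ^ 3 * m * r ^ 2 + 733824 * u1 ^ 3 * m * r + (-1929600) * u1 ^ 3 * m + 2925000 * u1 ^ 2 * w1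 ^ 3 * r ^ 4 + (-45372000) * u1 ^ 2 * w1 ^ 3 * r ^ 3 + 264175920 * u1 ^ 2 * w1 ^ 3 * r ^ 2 + (-691912800) * u1 ^ 2 * w1 ^ 3 * r + 696496584 * u1 ^ 2 * w1 ^ 3 + (-254880) * u1 ^ 2 * w1 * m * r ^ 2 + 2222400 * u1 ^ 2 * w1 * m * r + (-4923936) * u1 ^ 2 * w1 * m + 32256 * u1 ^ 2 * n * r + (-115968) * u1 ^ 2 * n + 1500000 * u1 * w1 ^ 4 * r ^ 4 + (-18780000) * u1 * w1 ^ 4 * r ^ 3 + 86011200 * u1 * w1 ^ 4 * r ^ 2 + (-174828000) * u1 * w1 ^ 4 * r + 139910304 * u1 * w1 ^ 4 + (-244800) * u1 * w1 ^ 2 * m * r ^ 2 + 1708800 * u1 * w1 ^ 2 * m * r + (-3216960) * u1 * w1 ^ 2 * m + 59520 * u1 * w1 * n * r + (-202368) * u1 * w1 * n + 5376 * u1 * m ^ 2 + 187500 * w1 ^ 5 * r ^ 4 + (-750000) * w1 ^ 5 * r ^ 3 + (-4311000) * w1 ^ 5 * r ^ 2 + 27690000 * w1 ^ 5 * r + (-36963060) * w1 ^ 5 + (-36000) * w1 ^ 3 * m * r ^ 2 + 72000 * w1 ^ 3 * m * r + (-84000) * w1 ^ 3 * m + 9600 * w1 ^ 2 * n * r + (-36480) * w1 ^ 2 * n + 960 * w1 * m ^ 2)"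
    unfolding dd2_def rem2_def gradp_def tw0_def tw1_def quad3_def lin3_def const3_def e1_def e2_def e3_def e4_def elim(1-3) by algebra
  then have "const3 e1 e2 e3 e4 S n * (w) = 0"
    unfolding dd r elim(4) by simp
  then show "w = 0"
    using \<open>l \<noteq> 0\<close> unfolding g by simp
qed

section \<open>Local equations at the points of tangency\<close>

lemma quintic_vector:
  "quintic (vector [a, b, c, d, e]) = 128 * (a * b * c * d * e)
     - 64 * (a * b * c * d + a * b * c * e + a * b * d * e + a * c * d * e + b * c * d * e) * (a + b + c + d + e)
     - 64 * (a * b * c + a * b * d + a * b * e + a * c * d + a * c * e + a * d * e + b * c * d + b * c * e + b * d * e + c * d * e)
          * (a * b + a * c + a * d + a * e + b * c + b * d + b * e + c * d + c * e + d * e)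
     + 48 * (a * b * c + a * b * d + a * b * e + a * c * d + a * c * e + a * d * e + b * c * d + b * c * e + b * d * e + c * d * e)
          * (a + b + c + d + e) ^ 2
     + 48 * (a * b + a * c + a * d + a * e + b * c + b * d + b * e + c * d + c * e + d * e) ^ 2 * (a + b + c + d + e)
     - 40 * (a * b + a * c + a * d + a * e + b * c + b * d + b * e + c * d + c * e + d * e) * (a + b + c + d + e) ^ 3
     + 7 * (a + b + c + d + e) ^ 5"
  by (simp add: quintic_el el_defs)

text \<open>A conjugate pair enters only through its sum 2u and its product u^2 - q^2 w^2, so q
  appears only as q^2 and can be replaced by its rational value.\<close>

lemma quintic_conjugate_pair:
  "quintic (vector [a, b, c, u + q * w, u - q * w]) = 128 * (a * b * c * (u ^ 2 - q ^ 2 * w ^ 2))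
     - 64 * (2 * a * b * c * u + (a * b + a * c + b * c) * (u ^ 2 - q ^ 2 * w ^ 2)) * (a + b + c + 2 * u)
     - 64 * (a * b * c + 2 * (a * b + a * c + b * c) * u + (a + b + c) * (u ^ 2 - q ^ 2 * w ^ 2))
          * (a * b + a * c + b * c + 2 * (a + b + c) * u + (u ^ 2 - q ^ 2 * w ^ 2))
     + 48 * (a * b * c + 2 * (a * b + a * c + b * c) * u + (a + b + c) * (u ^ 2 - q ^ 2 * w ^ 2)) * (a + b + c + 2 * u) ^ 2
     + 48 * (a * b + a * c + b * c + 2 * (a + b + c) * u + (u ^ 2 - q ^ 2 * w ^ 2)) ^ 2 * (a + b + c + 2 * u)
     - 40 * (a * b + a * c + b * c + 2 * (a + b + c) * u + (u ^ 2 - q ^ 2 * w ^ 2)) * (a + b + c + 2 * u) ^ 3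
     + 7 * (a + b + c + 2 * u) ^ 5"
  unfolding quintic_vector by algebra

lemma quintic_conjugate_pairs:
  "quintic (vector [a, s + q * d, s - q * d, u + q * w, u - q * w]) = 128 * (a * (s ^ 2 - q ^ 2 * d ^ 2) * (u ^ 2 - q ^ 2 * w ^ 2))
     - 64 * (2 * a * (s ^ 2 - q ^ 2 * d ^ 2) * u + (2 * a * s + (s ^ 2 - q ^ 2 * d ^ 2)) * (u ^ 2 - q ^ 2 * w ^ 2)) * (a + 2 * s + 2 * u)
     - 64 * (a * (s ^ 2 - q ^ 2 * d ^ 2) + 2 * (2 * a * s + (s ^ 2 - q ^ 2 * d ^ 2)) * u + (a + 2 * s) * (u ^ 2 - q ^ 2 * w ^ 2))
          * (2 * a * s + (s ^ 2 - q ^ 2 * d ^ 2) + 2 * (a + 2 * s) * u + (u ^ 2 - q ^ 2 * w ^ 2))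
     + 48 * (a * (s ^ 2 - q ^ 2 * d ^ 2) + 2 * (2 * a * s + (s ^ 2 - q ^ 2 * d ^ 2)) * u + (a + 2 * s) * (u ^ 2 - q ^ 2 * w ^ 2)) * (a + 2 * s + 2 * u) ^ 2
     + 48 * (2 * a * s + (s ^ 2 - q ^ 2 * d ^ 2) + 2 * (a + 2 * s) * u + (u ^ 2 - q ^ 2 * w ^ 2)) ^ 2 * (a + 2 * s + 2 * u)
     - 40 * (2 * a * s + (s ^ 2 - q ^ 2 * d ^ 2) + 2 * (a + 2 * s) * u + (u ^ 2 - q ^ 2 * w ^ 2)) * (a + 2 * s + 2 * u) ^ 3
     + 7 * (a + 2 * s + 2 * u) ^ 5"
  unfolding quintic_vector by algebra

text \<open>The direction b3 spans the kernel of the Hessian, which is 3072 (x1^2 - x2^2) up to a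
  factor 2. The shifts by 18 x3^2 and -18 x3^2 remove the terms x1 x3^2 and x2 x3^2, and the
  coefficient of x3^3 that remains is nonzero at 0.\<close>

lemma has_sing_type_17A2:
  shows "has_sing_type quintic (hyperplane (vector [3, - 13, - 13, 7, 7])) (vec.span {vector [0, 2, - 2, 1, - 1]}) (Type_A 2)"
proof -
  let ?p = "vector [0, 2, - 2, 1, - 1] :: complex^5"
  let ?b1 = "vector [0, 8, 6, 13, 13] :: complex^5" and ?b2 = "vector [0, 6, 8, 13, 13] :: complex^5" and ?b3 = "vector [16, 4, 4, 4, 4] :: complex^5"
  let ?e = "vector [1, 0, 0, 0, 0] :: complex^5"
  let ?U = "\<lambda>x :: complex^3. x $ 1 + 18 * (x $ 3) ^ 2" and ?V = "\<lambda>x :: complex^3. x $ 2 + (-18) * (x $ 3) ^ 2"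
  let ?a = "\<lambda>x. (-37376) * (?U x) ^ 3 + (-38400) * (?U x) ^ 2 * (?V x) + 2672640 * (?U x) ^ 2 * (x $ 3) ^ 2 + (-148480) * (?U x) ^ 2 + 75776 * (?U x) * (?V x) ^ 2 + 5492736 * (?U x) * (?V x) * (x $ 3) ^ 2 + (-305152) * (?U x) * (?V x) + (-46780416) * (?U x) * (x $ 3) ^ 4 + 5234688 * (?U x) * (x $ 3) ^ 2 + (-15872) * (?U x) + 75776 * (?V x) ^ 3 + (-148303872) * (?V x) * (x $ 3) ^ 4 + 16441344 * (?V x) * (x $ 3) ^ 2 + (-67072) * (?V x) + (-47775744) * (x $ 3) ^ 6 + 5308416 * (x $ 3) ^ 4 + 5931008 * (x $ 3) ^ 3 + (-202752) * (x $ 3) ^ 2 + 3072"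
  let ?b = "\<lambda>x. (-38400) * (?V x) ^ 3 + (-5492736) * (?V x) ^ 2 * (x $ 3) ^ 2 + 305152 * (?V x) ^ 2 + (-148303872) * (?V x) * (x $ 3) ^ 4 + 16441344 * (?V x) * (x $ 3) ^ 2 + (-67072) * (?V x) + 11993088 * (x $ 3) ^ 3"
  let ?c = "\<lambda>x. (-37376) * (?V x) ^ 3 + (-2672640) * (?V x) ^ 2 * (x $ 3) ^ 2 + 148480 * (?V x) ^ 2 + (-46780416) * (?V x) * (x $ 3) ^ 4 + 5234688 * (?V x) * (x $ 3) ^ 2 + (-15872) * (?V x) + 47775744 * (x $ 3) ^ 6 + (-5308416) * (x $ 3) ^ 4 + 5931008 * (x $ 3) ^ 3 + 202752 * (x $ 3) ^ 2 + (-3072)"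
  let ?d = "\<lambda>x. 429981696 * (?U x) * (x $ 3) ^ 5 + (-47775744) * (?U x) * (x $ 3) ^ 3 + 2359296 * (?U x) * (x $ 3) ^ 2 + (-6868992) * (?U x) * (x $ 3) + (-131072) * (?U x) + 429981696 * (?V x) * (x $ 3) ^ 5 + (-47775744) * (?V x) * (x $ 3) ^ 3 + (-2359296) * (?V x) * (x $ 3) ^ 2 + (-6868992) * (?V x) * (x $ 3) + 131072 * (?V x) + (-42467328) * (x $ 3) ^ 4 + 7864320 * (x $ 3) ^ 2 + (-163840)"
  show ?thesis
  proof (rule has_sing_typeI[where e = ?e])
    show "?p \<in> hyperplane (vector [3, - 13, - 13, 7, 7])" "?b1 \<in> hyperplane (vector [3, - 13, - 13, 7, 7])" "?b2 \<in> hyperplane (vector [3, - 13, - 13, 7, 7])"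
      "?b3 \<in> hyperplane (vector [3, - 13, - 13, 7, 7])" "(\<Sum>i\<in>UNIV. vector [3, - 13, - 13, 7, 7] $ i * ?e $ i) \<noteq> 0"
      by (simp_all add: hyperplane_def sum_5)
    fix w :: "complex^5"
    \<comment> \<open>Solution of the linear system for the coefficients of w by successive
      substitution.\<close>
    define c0 where "c0 = (w $ 4 - w $ 5) / 2"
    have w4: "w $ 4 = w $ 5 + 2 * c0" by (simp add: c0_def field_simps)
    define D where "D = (w $ 2 - w $ 3) / 2 - 2 * c0"
    have w2: "w $ 2 = w $ 3 + 2 * D + 4 * c0" by (simp add: D_def field_simps)
    define S where "S = (w $ 5 - w $ 3 - D - c0) / 6"
    have w5: "w $ 5 = 6 * S + w $ 3 + D + c0" by (simp add: S_def field_simps)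
    define c3 where "c3 = (w $ 3 + D + 2 * c0 - 7 * S) / 4"
    have w3: "w $ 3 = 4 * c3 - D - 2 * c0 + 7 * S" by (simp add: c3_def field_simps)
    define c1 c2 s where "c1 = (S + D) / 2" and "c2 = (S - D) / 2" and "s = w $ 1 - 16 * c3"
    have c: "S = c1 + c2" "D = c1 - c2" "w $ 1 = s + 16 * c3" by (simp_all add: c1_def c2_def s_def field_simps)
    show "\<exists>c0 c1 c2 c3 s. w = c0 *s ?p + c1 *s ?b1 + c2 *s ?b2 + c3 *s ?b3 + s *s ?e"
      by (intro exI[of _ c0] exI[of _ c1] exI[of _ c2] exI[of _ c3] exI[of _ s])
        (simp add: vec_eq_iff forall_5 w4 w2 w5 w3 c algebra_simps)
  next
    show "germ_iso (\<lambda>x. quintic (?p + (x $ 1 *s ?b1 + x $ 2 *s ?b2 + x $ 3 *s ?b3))) (normal_form (Type_A 2))"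
    proof (rule germ_iso_type_A[where a = ?a and b = ?b and c = ?c and d = ?d and \<alpha> = "18" and \<beta> = "(-18)"])
      show "c1_entire ?a" "c1_entire ?b" "c1_entire ?c" "c1_entire ?d"
        by (intro c1_entire_intros)+
      show "?a 0 \<noteq> 0" "?d 0 \<noteq> 0" "4 * ?a 0 * ?c 0 \<noteq> ?b 0 ^ 2"
        by (simp_all)
      fix x :: "complex^3"
      define x1 x2 x3 where x: "x1 = x $ 1" "x2 = x $ 2" "x3 = x $ 3"
      have "?p + (x $ 1 *s ?b1 + x $ 2 *s ?b2 + x $ 3 *s ?b3) = vector [16 * x3, 2 + 8 * x1 + 6 * x2 + 4 * x3, - 2 + 6 * x1 + 8 * x2 + 4 * x3, 1 + 13 * x1 + 13 * x2 + 4 * x3, - 1 + 13 * x1 + 13 * x2 + 4 * x3]"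
        unfolding x by (simp add: vec_eq_iff forall_5 algebra_simps)
      then have "quintic (?p + (x $ 1 *s ?b1 + x $ 2 *s ?b2 + x $ 3 *s ?b3)) = quintic (vector [16 * x3, 2 + 8 * x1 + 6 * x2 + 4 * x3, - 2 + 6 * x1 + 8 * x2 + 4 * x3, 1 + 13 * x1 + 13 * x2 + 4 * x3, - 1 + 13 * x1 + 13 * x2 + 4 * x3])" by simp
      also have "\<dots> = ?a x * (x $ 1 + 18 * (x $ 3) ^ 2) ^ 2
        + ?b x * (x $ 1 + 18 * (x $ 3) ^ 2) * (x $ 2 + (-18) * (x $ 3) ^ 2)
        + ?c x * (x $ 2 + (-18) * (x $ 3) ^ 2) ^ 2 + ?d x * (x $ 3) ^ 3"
        unfolding x[symmetric] quintic_vector by algebra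
      finally show "quintic (?p + (x $ 1 *s ?b1 + x $ 2 *s ?b2 + x $ 3 *s ?b3)) = ?a x * (x $ 1 + 18 * (x $ 3) ^ 2) ^ 2
        + ?b x * (x $ 1 + 18 * (x $ 3) ^ 2) * (x $ 2 + (-18) * (x $ 3) ^ 2)
        + ?c x * (x $ 2 + (-18) * (x $ 3) ^ 2) ^ 2 + ?d x * (x $ 3) ^ (2 + 1)"
        by simp
    qed
  qed
qed

text \<open>Again b3 is the kernel direction of the Hessian. Exchanging the first two coordinates
  changes only the sign of x2, so the equation is even in x2 and only x1 needs a shift.\<close>

lemma has_sing_type_16A2:
  fixes q :: complex
  assumes "q ^ 2 = 3"
  shows "has_sing_type quintic (hyperplane (vector [- 8, - 8, 1, 6 + 3 * q, 6 - 3 * q])) (vec.span {vector [9, 9, 0, 6 + 4 * q, 6 - 4 * q]}) (Type_A 2)"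
proof -
  let ?p = "vector [9, 9, 0, 6 + 4 * q, 6 - 4 * q] :: complex^5"
  let ?b1 = "vector [0, 0, - 12, 1, 1] :: complex^5" and ?b2 = "vector [1, - 1, 0, 0, 0] :: complex^5" and ?b3 = "vector [0, 0, 0, - 9 + 6 * q, - 9 - 6 * q] :: complex^5"
  let ?e = "vector [0, 0, 1, 0, 0] :: complex^5"
  let ?U = "\<lambda>x :: complex^3. x $ 1 + 6 * (x $ 3) ^ 2" and ?V = "\<lambda>x :: complex^3. x $ 2 + 0 * (x $ 3) ^ 2"
  let ?a = "\<lambda>x. (-1949184) * (?U x) ^ 3 + 58475520 * (?U x) ^ 2 * (x $ 3) ^ 2 + 1866240 * (?U x) ^ 2 * (x $ 3) + (-3359232) * (?U x) ^ 2 + 16128 * (?U x) * (?V x) ^ 2 + (-701706240) * (?U x) * (x $ 3) ^ 4 + (-44789760) * (?U x) * (x $ 3) ^ 3 + 81962496 * (?U x) * (x $ 3) ^ 2 + 4027392 * (?U x) * (x $ 3) + (-897024) * (?U x) + (-290304) * (?V x) ^ 2 * (x $ 3) ^ 2 + (-20736) * (?V x) ^ 2 * (x $ 3) + (-13824) * (?V x) ^ 2 + 4210237440 * (x $ 3) ^ 6 + 403107840 * (x $ 3) ^ 5 + (-749730816) * (x $ 3) ^ 4 + (-72119808) * (x $ 3) ^ 3 + 17763840 * (x $ 3) ^ 2 + 1658880 * (x $ 3) + 497664"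
  let ?b = "\<lambda>x. 160 * (?V x) ^ 3 + 1741824 * (?V x) * (x $ 3) ^ 4 + 248832 * (?V x) * (x $ 3) ^ 3 + 117504 * (?V x) * (x $ 3) ^ 2 + (-2304) * (?V x) * (x $ 3) + (-11136) * (?V x)"
  let ?c = "\<lambda>x. (-960) * (?V x) ^ 2 * (x $ 3) ^ 2 + 288 * (?V x) ^ 2 * (x $ 3) + 672 * (?V x) ^ 2 + (-3483648) * (x $ 3) ^ 6 + (-746496) * (x $ 3) ^ 5 + (-207360) * (x $ 3) ^ 4 + 76032 * (x $ 3) ^ 3 + 46080 * (x $ 3) ^ 2 + (-17280) * (x $ 3) + (-14976)"
  let ?d = "\<lambda>x. (-12630712320) * (?U x) * (x $ 3) ^ 5 + (-1612431360) * (?U x) * (x $ 3) ^ 4 + 3047196672 * (?U x) * (x $ 3) ^ 3 + 430479360 * (?U x) * (x $ 3) ^ 2 + (-102850560) * (?U x) * (x $ 3) + (-1990656) * (?U x) + 15156854784 * (x $ 3) ^ 7 + 2418647040 * (x $ 3) ^ 6 + (-4643205120) * (x $ 3) ^ 5 + (-856479744) * (x $ 3) ^ 4 + 171362304 * (x $ 3) ^ 3 + (-67931136) * (x $ 3) ^ 2 + (-44789760) * (x $ 3) + (-8957952)"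
  show ?thesis
  proof (rule has_sing_typeI[where e = ?e])
    have q: "q \<noteq> 0" using assms by auto
    show "?p \<in> hyperplane (vector [- 8, - 8, 1, 6 + 3 * q, 6 - 3 * q])" "?b1 \<in> hyperplane (vector [- 8, - 8, 1, 6 + 3 * q, 6 - 3 * q])" "?b2 \<in> hyperplane (vector [- 8, - 8, 1, 6 + 3 * q, 6 - 3 * q])"
      "?b3 \<in> hyperplane (vector [- 8, - 8, 1, 6 + 3 * q, 6 - 3 * q])" "(\<Sum>i\<in>UNIV. vector [- 8, - 8, 1, 6 + 3 * q, 6 - 3 * q] $ i * ?e $ i) \<noteq> 0"
      using assms by (simp_all add: hyperplane_def sum_5 algebra_simps power2_eq_square)
    fix w :: "complex^5"
    define R where "R = (w $ 4 - w $ 5) / (2 * q)"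
    have R: "w $ 4 = w $ 5 + 2 * q * R" using q by (simp add: R_def)
    define c0 where "c0 = (w $ 1 + w $ 2) / 18"
    have w1: "w $ 1 = 18 * c0 - w $ 2" by (simp add: c0_def field_simps)
    define c2 where "c2 = 9 * c0 - w $ 2"
    have w2: "w $ 2 = 9 * c0 - c2" by (simp add: c2_def)
    define c3 where "c3 = (R - 4 * c0) / 6"
    have R': "R = 6 * c3 + 4 * c0" by (simp add: c3_def field_simps)
    define c1 s where "c1 = w $ 5 + q * R - 6 * c0 + 9 * c3" and "s = w $ 3 + 12 * c1"
    have c: "w $ 5 = c1 - q * R + 6 * c0 - 9 * c3" "w $ 3 = s - 12 * c1" by (simp_all add: c1_def s_def)
    show "\<exists>c0 c1 c2 c3 s. w = c0 *s ?p + c1 *s ?b1 + c2 *s ?b2 + c3 *s ?b3 + s *s ?e"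
      by (intro exI[of _ c0] exI[of _ c1] exI[of _ c2] exI[of _ c3] exI[of _ s])
        (simp add: vec_eq_iff forall_5 w1 w2 R c R' algebra_simps)
  next
    show "germ_iso (\<lambda>x. quintic (?p + (x $ 1 *s ?b1 + x $ 2 *s ?b2 + x $ 3 *s ?b3))) (normal_form (Type_A 2))"
    proof (rule germ_iso_type_A[where a = ?a and b = ?b and c = ?c and d = ?d and \<alpha> = "6" and \<beta> = "0"])
      show "c1_entire ?a" "c1_entire ?b" "c1_entire ?c" "c1_entire ?d"
        by (intro c1_entire_intros)+
      show "?a 0 \<noteq> 0" "?d 0 \<noteq> 0" "4 * ?a 0 * ?c 0 \<noteq> ?b 0 ^ 2"
        by (simp_all)
      fix x :: "complex^3"
      define x1 x2 x3 where x: "x1 = x $ 1" "x2 = x $ 2" "x3 = x $ 3"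
      have "?p + (x $ 1 *s ?b1 + x $ 2 *s ?b2 + x $ 3 *s ?b3) = vector [9 + x2, 9 - x2, - 12 * x1, (6 + x1 - 9 * x3) + q * (4 + 6 * x3), (6 + x1 - 9 * x3) - q * (4 + 6 * x3)]"
        unfolding x by (simp add: vec_eq_iff forall_5 algebra_simps)
      then have "quintic (?p + (x $ 1 *s ?b1 + x $ 2 *s ?b2 + x $ 3 *s ?b3)) = quintic (vector [9 + x2, 9 - x2, - 12 * x1, (6 + x1 - 9 * x3) + q * (4 + 6 * x3), (6 + x1 - 9 * x3) - q * (4 + 6 * x3)])" by simp
      also have "\<dots> = ?a x * (x $ 1 + 6 * (x $ 3) ^ 2) ^ 2
        + ?b x * (x $ 1 + 6 * (x $ 3) ^ 2) * (x $ 2 + 0 * (x $ 3) ^ 2)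
        + ?c x * (x $ 2 + 0 * (x $ 3) ^ 2) ^ 2 + ?d x * (x $ 3) ^ 3"
        unfolding x[symmetric] quintic_conjugate_pair assms by algebra
      finally show "quintic (?p + (x $ 1 *s ?b1 + x $ 2 *s ?b2 + x $ 3 *s ?b3)) = ?a x * (x $ 1 + 6 * (x $ 3) ^ 2) ^ 2
        + ?b x * (x $ 1 + 6 * (x $ 3) ^ 2) * (x $ 2 + 0 * (x $ 3) ^ 2)
        + ?c x * (x $ 2 + 0 * (x $ 3) ^ 2) ^ 2 + ?d x * (x $ 3) ^ (2 + 1)"
        by simp
    qed
  qed
qed

text \<open>The point and the hyperplane are fixed by exchanging coordinates 1, 2 and by exchanging
  3, 4, so the equation is even in x2 and in x3. The Hessian degenerates along x3, where the cubic
  term vanishes by parity; after completing the square the coefficient of x3^4 is nonzero, which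
  gives A_3.\<close>

lemma has_sing_type_A3:
  fixes r :: complex
  assumes "r ^ 2 = 13"
  shows "has_sing_type quintic (hyperplane (vector [- 4 - 2 * r, - 4 - 2 * r, - 12 + 6 * r, - 12 + 6 * r, 29 - 5 * r])) (vec.span {vector [9 + 3 * r, 9 + 3 * r, 13 - r, 13 - r, 24]}) (Type_A 3)"
proof -
  have r2: "r ^ 2 = 13" using assms by simp
  \<comment> \<open>A nonzero norm in Q(sqrt 13) shows that the number itself is nonzero.\<close>
  have nz: "A + B * r \<noteq> 0" if "A ^ 2 - 13 * B ^ 2 \<noteq> 0" for A B
  proof
    assume "A + B * r = 0"
    moreover have "A ^ 2 - 13 * B ^ 2 = (A + B * r) * (A - B * r) + B ^ 2 * (r ^ 2 - 13)" by algebra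
    ultimately show False using that r2 by simp
  qed
  let ?p = "vector [9 + 3 * r, 9 + 3 * r, 13 - r, 13 - r, 24] :: complex^5"
  let ?b1 = "vector [0, 0, 19 * r - 7, 19 * r - 7, - 108] :: complex^5" and ?b2 = "vector [0, 0, 1, - 1, 0] :: complex^5" and ?b3 = "vector [72, - 72, 0, 0, 0] :: complex^5"
  let ?e = "vector [0, 0, 1, 1, 0] :: complex^5"
  let ?U = "\<lambda>x :: complex^3. x $ 1 + ((-234)+66 * r) * (x $ 3) ^ 2" and ?V = "\<lambda>x :: complex^3. x $ 2 + 0 * (x $ 3) ^ 2"
  let ?a = "\<lambda>x. ((-93329542656)+(-25849290240) * r) * (?U x) ^ 3 + (1697890222080+555079495680 * r) * (?U x) ^ 2 * (x $ 3) ^ 2 + (62219695104+17232860160 * r) * (?U x) ^ 2 + (31502080+6386432 * r) * (?U x) * (?V x) ^ 2 + ((-157903790653440)+35655694663680 * r) * (?U x) * (x $ 3) ^ 4 + ((-860070887424)+(-277660680192) * r) * (?U x) * (x $ 3) ^ 2 + ((-13826598912)+(-3829524480) * r) * (?U x) + (5675784192+(-1754136576) * r) * (?V x) ^ 2 * (x $ 3) ^ 2 + ((-3823104)+542208 * r) * (?V x) ^ 2 + ((-67542073034342400)+18765082734428160 * r) * (x $ 3) ^ 6 + (47767311581184+(-10361483919360) * r) * (x $ 3) ^ 4 + (98680799232+31926140928 * r) * (x $ 3) ^ 2 + (1024192512+283668480 * r)"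
  let ?b = "\<lambda>x. (1056+1824 * r) * (?V x) ^ 3 + (2833182683136+(-785069715456) * r) * (?V x) * (x $ 3) ^ 4 + ((-2735235072)+752099328 * r) * (?V x) * (x $ 3) ^ 2 + ((-24576)+(-371712) * r) * (?V x)"
  let ?c = "\<lambda>x. ((-1317888)+357120 * r) * (?V x) ^ 2 * (x $ 3) ^ 2 + (576+(-192) * r) * (?V x) ^ 2 + (445518187905024+(-123565456834560) * r) * (x $ 3) ^ 6 + ((-641793245184)+178035425280 * r) * (x $ 3) ^ 4 + (309860352+(-86022144) * r) * (x $ 3) ^ 2 + ((-40960)+16384 * r)"
  let ?d = "\<lambda>x. ((-15952643038087741440)+4424403090061393920 * r) * (?U x) * (x $ 3) ^ 4 + (11062094374895616+(-3075218770231296) * r) * (?U x) * (x $ 3) ^ 2 + ((-1532239773696)+314531610624 * r) * (?U x) + ((-1505811264437041496064)+417636952717631422464 * r) * (x $ 3) ^ 6 + (1033349572279664640+(-286593002989682688) * r) * (x $ 3) ^ 4 + (199252657963008+(-55279306801152) * r) * (x $ 3) ^ 2 + ((-171562696704)+47727968256 * r)"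
  show ?thesis
  proof (rule has_sing_typeI[where e = ?e])
    show "?p \<in> hyperplane (vector [- 4 - 2 * r, - 4 - 2 * r, - 12 + 6 * r, - 12 + 6 * r, 29 - 5 * r])" "?b1 \<in> hyperplane (vector [- 4 - 2 * r, - 4 - 2 * r, - 12 + 6 * r, - 12 + 6 * r, 29 - 5 * r])" "?b2 \<in> hyperplane (vector [- 4 - 2 * r, - 4 - 2 * r, - 12 + 6 * r, - 12 + 6 * r, 29 - 5 * r])"
      "?b3 \<in> hyperplane (vector [- 4 - 2 * r, - 4 - 2 * r, - 12 + 6 * r, - 12 + 6 * r, 29 - 5 * r])" "(\<Sum>i\<in>UNIV. vector [- 4 - 2 * r, - 4 - 2 * r, - 12 + 6 * r, - 12 + 6 * r, 29 - 5 * r] $ i * ?e $ i) \<noteq> 0"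
      using nz[of "- 24" 12] r2 by (simp_all add: hyperplane_def sum_5 algebra_simps power2_eq_square)
    fix w :: "complex^5"
    \<comment> \<open>The factor inverts 2 (9 + 3r), because (3r + 9)(3r - 9) = 9 * 13 - 81 =
      36.\<close>
    define c0 where "c0 = (w $ 1 + w $ 2) * (3 * r - 9) / 72"
    have "36 * (2 * c0 * (9 + 3 * r)) = 9 * (w $ 1 + w $ 2) * (r ^ 2 - 9)" unfolding c0_def by algebra
    then have "36 * (w $ 1 + w $ 2) = 36 * (2 * c0 * (9 + 3 * r))" unfolding r2 by simp
    then have c0: "w $ 1 + w $ 2 = 2 * c0 * (9 + 3 * r)" by (simp only: mult_cancel_left) simp
    have w1: "w $ 1 = 2 * c0 * (9 + 3 * r) - w $ 2" by (simp add: c0[symmetric])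
    define c3 where "c3 = ((9 + 3 * r) * c0 - w $ 2) / 72"
    have w2: "w $ 2 = (9 + 3 * r) * c0 - 72 * c3" by (simp add: c3_def field_simps)
    define c1 c2 where "c1 = (24 * c0 - w $ 5) / 108" and "c2 = (w $ 3 - w $ 4) / 2"
    have w5: "w $ 5 = 24 * c0 - 108 * c1" "w $ 3 = w $ 4 + 2 * c2" by (simp_all add: c1_def c2_def field_simps)
    define s where "s = w $ 4 + c2 - c0 * (13 - r) - c1 * (19 * r - 7)"
    have w4: "w $ 4 = s - c2 + c0 * (13 - r) + c1 * (19 * r - 7)" by (simp add: s_def)
    show "\<exists>c0 c1 c2 c3 s. w = c0 *s ?p + c1 *s ?b1 + c2 *s ?b2 + c3 *s ?b3 + s *s ?e"
      by (intro exI[of _ c0] exI[of _ c1] exI[of _ c2] exI[of _ c3] exI[of _ s])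
        (simp add: vec_eq_iff forall_5 w1 w2 w5 w4 algebra_simps)
  next
    show "germ_iso (\<lambda>x. quintic (?p + (x $ 1 *s ?b1 + x $ 2 *s ?b2 + x $ 3 *s ?b3))) (normal_form (Type_A 3))"
    proof (rule germ_iso_type_A[where a = ?a and b = ?b and c = ?c and d = ?d and \<alpha> = "((-234)+66 * r)" and \<beta> = "0"])
      show "c1_entire ?a" "c1_entire ?b" "c1_entire ?c" "c1_entire ?d"
        by (intro c1_entire_intros)+
      show "?a 0 \<noteq> 0" "?d 0 \<noteq> 0" "4 * ?a 0 * ?c 0 \<noteq> ?b 0 ^ 2"
        by (use nz[of "1024192512" "283668480"] nz[of "4096770048" "1134673920"] nz[of "(- 40960)" "16384"] nz[of "(- 171562696704)" "47727968256"] in simp_all)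
      fix x :: "complex^3"
      define x1 x2 x3 where x: "x1 = x $ 1" "x2 = x $ 2" "x3 = x $ 3"
      have "?p + (x $ 1 *s ?b1 + x $ 2 *s ?b2 + x $ 3 *s ?b3) = vector [9 + 3 * r + 72 * x3, 9 + 3 * r - 72 * x3, 13 - r + (19 * r - 7) * x1 + x2, 13 - r + (19 * r - 7) * x1 - x2, 24 - 108 * x1]"
        unfolding x by (simp add: vec_eq_iff forall_5 algebra_simps)
      then have "quintic (?p + (x $ 1 *s ?b1 + x $ 2 *s ?b2 + x $ 3 *s ?b3)) = quintic (vector [9 + 3 * r + 72 * x3, 9 + 3 * r - 72 * x3, 13 - r + (19 * r - 7) * x1 + x2, 13 - r + (19 * r - 7) * x1 - x2, 24 - 108 * x1])" by simp
      also have "\<dots> = ?a x * (x $ 1 + ((-234)+66 * r) * (x $ 3) ^ 2) ^ 2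
        + ?b x * (x $ 1 + ((-234)+66 * r) * (x $ 3) ^ 2) * (x $ 2 + 0 * (x $ 3) ^ 2)
        + ?c x * (x $ 2 + 0 * (x $ 3) ^ 2) ^ 2 + ?d x * (x $ 3) ^ 4
        + (r ^ 2 - 13) * (8530265779200 * x1 ^ 4 * x3 ^ 2 + (-1148857344) * x1 ^ 4 + 877952 * x1 ^ 3 * x2 ^ 2 * r + 1524864 * x1 ^ 3 * x2 ^ 2 + 1125995082854400 * x1 ^ 3 * x3 ^ 4 * r + (-4065434878095360) * x1 ^ 3 * x3 ^ 4 + (-4549475082240) * x1 ^ 3 * x3 ^ 2 + 826371072 * x1 ^ 3 + (-1264513536) * x1 ^ 2 * x2 ^ 2 * x3 ^ 2 + (-277248) * x1 ^ 2 * x2 ^ 2 * r + 379392 * x1 ^ 2 * x2 ^ 2 + 74315675468390400 * x1 ^ 2 * x3 ^ 6 * r ^ 2 + (-536637403908587520) * x1 ^ 2 * x3 ^ 6 * r + 966103781089075200 * x1 ^ 2 * x3 ^ 6 + (-450398033141760) * x1 ^ 2 * x3 ^ 4 * r + 1622534371172352 * x1 ^ 2 * x3 ^ 4 + 756203433984 * x1 ^ 2 * x3 ^ 2 + (-210511872) * x1 ^ 2 + (-83457893376) * x1 * x2 ^ 2 * x3 ^ 4 * r + 411669181440 * x1 * x2 ^ 2 * x3 ^ 4 + (-71571456) * x1 * x2 ^ 2 * x3 ^ 2 + 21888 * x1 * x2 ^ 2 * r + (-170112) * x1 * x2 ^ 2 + 2452417290456883200 * x1 * x3 ^ 8 * r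 ^ 3 + (-26563551493475082240) * x1 * x3 ^ 8 * r ^ 2 + 95644274327818444800 * x1 * x3 ^ 8 * r + (-115108723138392023040) * x1 * x3 ^ 8 + (-19817513458237440) * x1 * x3 ^ 6 * r ^ 2 + 142863095424614400 * x1 * x3 ^ 6 * r + (-257033465622134784) * x1 * x3 ^ 6 + 50044225904640 * x1 * x3 ^ 4 * r + (-178387312435200) * x1 * x3 ^ 4 + (-113467392) * x1 * x3 ^ 2 * r + (-37199388672) * x1 * x3 ^ 2 + 21565440 * x1 + (-120384) * x2 ^ 4 * x3 ^ 2 + (-1836073654272) * x2 ^ 2 * x3 ^ 6 * r ^ 2 + 18113443983360 * x2 ^ 2 * x3 ^ 6 * r + (-23868957505536) * x2 ^ 2 * x3 ^ 6 + (-2361858048) * x2 ^ 2 * x3 ^ 4 * r + (-16237393920) * x2 ^ 2 * x3 ^ 4 + 24532992 * x2 ^ 2 * x3 ^ 2 + (-512) * x2 ^ 2 * r + 7680 * x2 ^ 2 + 32371908234030858240 * x3 ^ 10 * r ^ 4 + (-467518506285161447424) * x3 ^ 10 * r ^ 3 + 2525008842254406942720 * x3 ^ 10 * r ^ 2 + (-6077740581707098816512) * x3 ^ 10 * r + 5470852491551215042560 * x3 ^ 10 + (-326988972060917760) * x3 ^ 8 * r ^ 3 + 3536522195541147648 * x3 ^ 8 * r ^ 2 + (-12726424699637907456) * x3 ^ 8 * r + 15279129038463713280 * x3 ^ 8 + 1100972969902080 * x3 ^ 6 * r ^ 2 + (-7874327250763776) * x3 ^ 6 * r + 14086157470285824 *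 x3 ^ 6 + (-1235659898880) * x3 ^ 4 * r + 4300569427968 * x3 ^ 4 + 23887872 * x3 ^ 2 * r + 23887872 * x3 ^ 2 + (-663552))"
        unfolding x[symmetric] quintic_vector by algebra
      finally show "quintic (?p + (x $ 1 *s ?b1 + x $ 2 *s ?b2 + x $ 3 *s ?b3)) = ?a x * (x $ 1 + ((-234)+66 * r) * (x $ 3) ^ 2) ^ 2
        + ?b x * (x $ 1 + ((-234)+66 * r) * (x $ 3) ^ 2) * (x $ 2 + 0 * (x $ 3) ^ 2)
        + ?c x * (x $ 2 + 0 * (x $ 3) ^ 2) ^ 2 + ?d x * (x $ 3) ^ (3 + 1)"
        unfolding r2 by simp
    qed
  qed
qed

text \<open>With w = (-1 + k)/2 a cube root of unity, b2 and b3 are 72 (1, w, w^2, 0, 0) and 72 (1,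
  w^2, w, 0, 0), eigenvectors of the cyclic permutation of the first three coordinates. The equation
  thus involves x2 and x3 only through x2 x3, x2^3 and x3^3. At this point the quadratic term x2 x3
  vanishes, so the Hessian has corank 2 and the cubic part on its kernel is a multiple of x2^3 +
  x3^3.\<close>

lemma has_sing_type_D4:
  fixes r k :: complex
  assumes "r ^ 2 = 13" "k ^ 2 = - 3"
  shows "has_sing_type quintic (hyperplane (vector [12, 12, 12, (- 45 + 9 * r) + k * (17 - 5 * r), (- 45 + 9 * r) - k * (17 - 5 * r)])) (vec.span {vector [6, 6, 6, (1 + 2 * r) + k * (2 - r), (1 + 2 * r) - k * (2 - r)]}) (Type_D 4)"
proof -
  have r2: "r ^ 2 = 13" using assms by simp
  have nz: "A + B * r \<noteq> 0" if "A ^ 2 - 13 * B ^ 2 \<noteq> 0" for A B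
  proof
    assume "A + B * r = 0"
    moreover have "A ^ 2 - 13 * B ^ 2 = (A + B * r) * (A - B * r) + B ^ 2 * (r ^ 2 - 13)" by algebra
    ultimately show False using that r2 by simp
  qed
  let ?p = "vector [6, 6, 6, (1 + 2 * r) + k * (2 - r), (1 + 2 * r) - k * (2 - r)] :: complex^5"
  let ?b1 = "vector [0, 0, 0, (17 - 5 * r) + k * (3 * r - 15), (17 - 5 * r) - k * (3 * r - 15)] :: complex^5" and ?b2 = "vector [72, 36 * (- 1 + k), 36 * (- 1 - k), 0, 0] :: complex^5" and ?b3 = "vector [72, 36 * (- 1 - k), 36 * (- 1 + k), 0, 0] :: complex^5"
  let ?e = "vector [0, 0, 0, 1, 1] :: complex^5"
  let ?U = "\<lambda>x :: complex^3. x $ 1 + (78+42 * r) * (x $ 2 * x $ 3)"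
  let ?a = "\<lambda>x. (1222138368+(-339033600) * r) * (?U x) ^ 3 + (448927764480+(-124425953280) * r) * (?U x) ^ 2 * (x $ 2) * (x $ 3) + ((-878376960)+243855360 * r) * (?U x) ^ 2 + (65840409722880+(-18299483504640) * r) * (?U x) * (x $ 2) ^ 2 * (x $ 3) ^ 2 + ((-223697977344)+61809868800 * r) * (?U x) * (x $ 2) * (x $ 3) + (213995520+(-58724352) * r) * (?U x) + (4855966035148800+(-1337937494999040) * r) * (x $ 2) ^ 3 * (x $ 3) ^ 3 + (24508956672+(-6449725440) * r) * (x $ 2) ^ 3 + ((-20601068027904)+5798948143104 * r) * (x $ 2) ^ 2 * (x $ 3) ^ 2 + (28056305664+(-8062156800) * r) * (x $ 2) * (x $ 3) + (24508956672+(-6449725440) * r) * (x $ 3) ^ 3 + ((-16920576)+4976640 * r)"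
  let ?b = "\<lambda>x. (175874260763934720+(-49795724433162240) * r) * (?U x) * (x $ 2) * (x $ 3) ^ 4 + (3219702939648+(-1052595191808) * r) * (?U x) * (x $ 2) * (x $ 3) + ((-853020047572992)+222763197136896 * r) * (?U x) * (x $ 3) ^ 3 + ((-17199267840)+5159780352 * r) * (?U x) + (2694054640183934976+(-700530489259720704) * r) * (x $ 2) ^ 2 * (x $ 3) ^ 5 + (161790072717312+(-26562549252096) * r) * (x $ 2) ^ 2 * (x $ 3) ^ 2 + ((-10241673819586560)+3678309377114112 * r) * (x $ 2) * (x $ 3) ^ 4 + ((-1104192995328)+319906381824 * r) * (x $ 2) * (x $ 3) + ((-24751466348544)+6733513359360 * r) * (x $ 3) ^ 3 + (4013162496+(-1146617856) * r)"
  let ?c = "\<lambda>x. (3219702939648+(-1052595191808) * r) * (?U x) * (x $ 2) * (x $ 3) + ((-17199267840)+5159780352 * r) * (?U x) + (161790072717312+(-26562549252096) * r) * (x $ 2) ^ 2 * (x $ 3) ^ 2 + ((-1104192995328)+319906381824 * r) * (x $ 2) * (x $ 3) + (4013162496+(-1146617856) * r)"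
  let ?g = "\<lambda>x. (673351335936+(-154793410560) * r) * (?U x) + (175432531968+(-49017913344) * r)"
  show ?thesis
  proof (rule has_sing_typeI[where e = ?e])
    have k: "k \<noteq> 0" "k * k = - 3" and rr: "r * r = 13" using assms by (auto simp: power2_eq_square)
    have kk: "k * (k * z) = - 3 * z" "r * (r * z) = 13 * z" for z
      by (simp_all add: mult.assoc[symmetric] k rr)
    show "?p \<in> hyperplane (vector [12, 12, 12, (- 45 + 9 * r) + k * (17 - 5 * r), (- 45 + 9 * r) - k * (17 - 5 * r)])" "?b1 \<in> hyperplane (vector [12, 12, 12, (- 45 + 9 * r) + k * (17 - 5 * r), (- 45 + 9 * r) - k * (17 - 5 * r)])" "?b2 \<in> hyperplane (vector [12, 12, 12, (- 45 + 9 * r) + k * (17 - 5 * r), (- 45 + 9 * r) - k * (17 - 5 * r)])"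
      "?b3 \<in> hyperplane (vector [12, 12, 12, (- 45 + 9 * r) + k * (17 - 5 * r), (- 45 + 9 * r) - k * (17 - 5 * r)])" "(\<Sum>i\<in>UNIV. vector [12, 12, 12, (- 45 + 9 * r) + k * (17 - 5 * r), (- 45 + 9 * r) - k * (17 - 5 * r)] $ i * ?e $ i) \<noteq> 0"
      using nz[of "- 90" 18] by (simp_all add: hyperplane_def sum_5 algebra_simps k rr kk)
    fix w :: "complex^5"
    define R where "R = (w $ 4 - w $ 5) / (2 * k)"
    have R: "w $ 4 = w $ 5 + 2 * k * R" using k by (simp add: R_def)
    define Q where "Q = (w $ 2 - w $ 3) / (2 * k)"
    have Q: "w $ 2 = w $ 3 + 2 * k * Q" using k by (simp add: Q_def)
    \<comment> \<open>The formula for \<open>c1\<close> divides by 3r - 15, using (3r - 15)(3r + 15)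
      = 9 (13 - 25) = -108.\<close>
    define c0 c1 where "c0 = (w $ 1 + w $ 2 + w $ 3) / 18" and "c1 = - ((R - (2 - r) * c0) * (3 * r + 15)) / 108"
    have "108 * ((2 - r) * c0 + (3 * r - 15) * c1) = 108 * (2 - r) * c0 - 9 * (R - (2 - r) * c0) * (r ^ 2 - 25)"
      unfolding c1_def by algebra
    also have "\<dots> = 108 * R" unfolding r2 by algebra
    finally have c1: "R = (2 - r) * c0 + (3 * r - 15) * c1" by (simp only: mult_cancel_left) simp
    have w1: "w $ 1 = 18 * c0 - 2 * w $ 3 - 2 * k * Q" by (simp add: c0_def Q field_simps)
    define P where "P = (6 * c0 - w $ 3 - k * Q) / 36"
    have w3: "w $ 3 = 6 * c0 - k * Q - 36 * P" by (simp add: P_def field_simps)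
    define c2 c3 where "c2 = (P + Q / 36) / 2" and "c3 = (P - Q / 36) / 2"
    have PQ: "P = c2 + c3" "Q = 36 * (c2 - c3)" by (simp_all add: c2_def c3_def field_simps)
    define s where "s = w $ 5 + k * R - (1 + 2 * r) * c0 - (17 - 5 * r) * c1"
    have w5: "w $ 5 = s - k * R + (1 + 2 * r) * c0 + (17 - 5 * r) * c1" by (simp add: s_def)
    show "\<exists>c0 c1 c2 c3 s. w = c0 *s ?p + c1 *s ?b1 + c2 *s ?b2 + c3 *s ?b3 + s *s ?e"
      by (intro exI[of _ c0] exI[of _ c1] exI[of _ c2] exI[of _ c3] exI[of _ s])
        (simp add: vec_eq_iff forall_5 R Q w1 w3 w5 PQ c1 algebra_simps)
  next
    show "germ_iso (\<lambda>x. quintic (?p + (x $ 1 *s ?b1 + x $ 2 *s ?b2 + x $ 3 *s ?b3))) (normal_form (Type_D 4))"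
    proof (rule germ_iso_type_D4[where a = ?a and b = ?b and c = ?c and e = ?g and \<alpha> = "(78+42 * r)"])
      show "c1_entire ?a" "c1_entire ?b" "c1_entire ?c" "c1_entire ?g"
        by (intro c1_entire_intros)+
      show "?a 0 \<noteq> 0" "?b 0 \<noteq> 0" "?c 0 \<noteq> 0"
        by (use nz[of "(- 16920576)" "4976640"] nz[of "4013162496" "(- 1146617856)"] nz[of "4013162496" "(- 1146617856)"] nz[of "175432531968" "(- 49017913344)"] in simp_all)
      fix x :: "complex^3"
      define x1 x2 x3 where x: "x1 = x $ 1" "x2 = x $ 2" "x3 = x $ 3"
      have "?p + (x $ 1 *s ?b1 + x $ 2 *s ?b2 + x $ 3 *s ?b3) = vector [6 + 72 * x2 + 72 * x3, (6 - 36 * x2 - 36 * x3) + k * (36 * x2 - 36 * x3), (6 - 36 * x2 - 36 * x3) - k * (36 * x2 - 36 * x3), (1 + 2 * r + (17 - 5 * r) * x1) + k * (2 - r + (3 * r - 15) * x1), (1 + 2 * r + (17 - 5 * r) * x1) - k * (2 - r + (3 * r - 15) * x1)]"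
        unfolding x by (simp add: vec_eq_iff forall_5 algebra_simps)
      then have "quintic (?p + (x $ 1 *s ?b1 + x $ 2 *s ?b2 + x $ 3 *s ?b3)) = quintic (vector [6 + 72 * x2 + 72 * x3, (6 - 36 * x2 - 36 * x3) + k * (36 * x2 - 36 * x3), (6 - 36 * x2 - 36 * x3) - k * (36 * x2 - 36 * x3), (1 + 2 * r + (17 - 5 * r) * x1) + k * (2 - r + (3 * r - 15) * x1), (1 + 2 * r + (17 - 5 * r) * x1) - k * (2 - r + (3 * r - 15) * x1)])" by simp
      also have "\<dots> = ?a x * (x $ 1 + (78+42 * r) * (x $ 2 * x $ 3)) ^ 2
        + ?b x * (x $ 2) ^ 3 + ?g x * (x $ 2) ^ 2 * (x $ 3) ^ 2 + ?c x * (x $ 3) ^ 3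
        + (r ^ 2 - 13) * (82080 * x1 ^ 5 * r ^ 3 + (-538272) * x1 ^ 5 * r ^ 2 + (-5369760) * x1 ^ 5 * r + 69464736 * x1 ^ 5 + 71197056000 * x1 ^ 4 * x2 * x3 + (-199872) * x1 ^ 4 * r ^ 3 + 1723968 * x1 ^ 4 * r ^ 2 + 808128 * x1 ^ 4 * r + (-50564160) * x1 ^ 4 + 5980552704000 * x1 ^ 3 * x2 ^ 2 * x3 ^ 2 * r + 21558520811520 * x1 ^ 3 * x2 ^ 2 * x3 ^ 2 + (-134369280) * x1 ^ 3 * x2 * x3 * r + (-39167152128) * x1 ^ 3 * x2 * x3 + 181056 * x1 ^ 3 * r ^ 3 + (-1571520) * x1 ^ 3 * r ^ 2 + 2636736 * x1 ^ 3 * r + 10255296 * x1 ^ 3 + 251183213568000 * x1 ^ 2 * x2 ^ 3 * x3 ^ 3 * r ^ 2 + 1810915748167680 * x1 ^ 2 * x2 ^ 3 * x3 ^ 3 * r + 3265381776384000 * x1 ^ 2 * x2 ^ 3 * x3 ^ 3 + 644972544 * x1 ^ 2 * x2 ^ 3 + (-2580965130240) * x1 ^ 2 * x2 ^ 2 * x3 ^ 2 * r + (-8077743636480) * x1 ^ 2 * x2 ^ 2 * x3 ^ 2 + 143327232 * x1 ^ 2 * x2 * x3 * r + 6037659648 * x1 ^ 2 * x2 * x3 + 644972544 * x1 ^ 2 * x3 ^ 3 + (-78336) * x1 ^ 2 * r ^ 3 + 607104 * x1 ^ 2 * r ^ 2 + (-1283328) * x1 ^ 2 * r + (-74880) * x1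 ^ 2 + 5274847484928000 * x1 * x2 ^ 4 * x3 ^ 4 * r ^ 3 + 57043846067281920 * x1 * x2 ^ 4 * x3 ^ 4 * r ^ 2 + 205719051912192000 * x1 * x2 ^ 4 * x3 ^ 4 * r + 247189999624888320 * x1 * x2 ^ 4 * x3 ^ 4 + 541776936960 * x1 * x2 ^ 4 * x3 + (-72267023646720) * x1 * x2 ^ 3 * x3 ^ 3 * r ^ 2 + (-469419617157120) * x1 * x2 ^ 3 * x3 ^ 3 * r + (-755158793453568) * x1 * x2 ^ 3 * x3 ^ 3 + (-429981696) * x1 * x2 ^ 3 + 310769270784 * x1 * x2 ^ 2 * x3 ^ 2 * r + 699042742272 * x1 * x2 ^ 2 * x3 ^ 2 + 541776936960 * x1 * x2 * x3 ^ 4 + (-50761728) * x1 * x2 * x3 * r + (-128397312) * x1 * x2 * x3 + (-429981696) * x1 * x3 ^ 3 + 16416 * x1 * r ^ 3 + (-102816) * x1 * r ^ 2 + 201312 * x1 * r + (-128736) * x1 + 44308718873395200 * x2 ^ 5 * x3 ^ 5 * r ^ 4 + 638891075953557504 * x2 ^ 5 * x3 ^ 5 * r ^ 3 + 3456080072124825600 * x2 ^ 5 * x3 ^ 5 * r ^ 2 + 8305583987396247552 * x2 ^ 5 * x3 ^ 5 * r + 7488173489603788800 * x2 ^ 5 * x3 ^ 5 + 11377315676160 * x2 ^ 5 * x3 ^ 2 * r + 43233799569408 * x2 ^ 5 * x3 ^ 2 + (-758803748290560) * x2 ^ 4 * x3 ^ 4 * r ^ 3 + (-7482955331174400) * x2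 ^ 4 * x3 ^ 4 * r ^ 2 + (-24432595792625664) * x2 ^ 4 * x3 ^ 4 * r + (-26214125409239040) * x2 ^ 4 * x3 ^ 4 + (-216710774784) * x2 ^ 4 * x3 + 4350769790976 * x2 ^ 3 * x3 ^ 3 * r ^ 2 + 22607147630592 * x2 ^ 3 * x3 ^ 3 * r + 23078192578560 * x2 ^ 3 * x3 ^ 3 + 71663616 * x2 ^ 3 + 11377315676160 * x2 ^ 2 * x3 ^ 5 * r + 43233799569408 * x2 ^ 2 * x3 ^ 5 + (-8778792960) * x2 ^ 2 * x3 ^ 2 * r + (-2759049216) * x2 ^ 2 * x3 ^ 2 + (-216710774784) * x2 * x3 ^ 4 + 5971968 * x2 * x3 * r + (-11943936) * x2 * x3 + 71663616 * x3 ^ 3 + (-1344) * r ^ 3 + 5952 * r ^ 2 + (-10176) * r + 5568)"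
        unfolding x[symmetric] quintic_conjugate_pairs assms(2) by algebra
      finally show "quintic (?p + (x $ 1 *s ?b1 + x $ 2 *s ?b2 + x $ 3 *s ?b3)) = ?a x * (x $ 1 + (78+42 * r) * (x $ 2 * x $ 3)) ^ 2
        + ?b x * (x $ 2) ^ 3 + ?g x * (x $ 2) ^ 2 * (x $ 3) ^ 2 + ?c x * (x $ 3) ^ 3"
        unfolding r2 by simp
    qed
  qed
qed

section \<open>The singular set from the cusps and the points of tangency\<close>

text \<open>Singular points of the section split according to the factor m in gradient = m a: those
  with m = 0 are the 15 cusp points, those with m nonzero are assumed to be represented by
  E.\<close>

lemma has_singular_setI:
  assumes a: "transversal_to_cusp_lines a"
    and E: "finite E" "inj_on (\<lambda>e. vec.span {e}) E"
    and EH: "\<And>e. e \<in> E \<Longrightarrow> e \<in> hyperplane a" "\<And>e i. e \<in> E \<Longrightarrow> grad_poly e (e $ i) = l * a $ i" "l \<noteq> 0"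
    and ET: "\<And>e. e \<in> E \<Longrightarrow> has_sing_type quintic (hyperplane a) (vec.span {e}) T"
    and tangent: "\<And>v m. v \<in> hyperplane a \<Longrightarrow> v \<noteq> 0 \<Longrightarrow> m \<noteq> 0 \<Longrightarrow> (\<And>i. grad_poly v (v $ i) = m * a $ i)
       \<Longrightarrow> \<exists>e\<in>E. vec.span {v} = vec.span {e}"
  shows "has_singular_set quintic (hyperplane a) (replicate_mset 15 (Type_A 2) + replicate_mset (card E) T)"
proof -
  let ?C = "(\<lambda>t. vec.span {cusp_point a t}) ` cusp_lines" and ?D = "(\<lambda>e. vec.span {e}) ` E"
  have "a $ 2 + a $ 3 \<noteq> 0"
    using a by (auto simp: transversal_to_cusp_lines_def cusp_lines_def)
  then have a0: "a \<noteq> 0" by auto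
  have fin: "finite ?C" "finite ?D" using E(1) card_cusp_lines by (auto intro: card_ge_0_finite)
  have cC: "card ?C = 15" using card_image[OF inj_on_span_cusp_point[OF a]] card_cusp_lines by simp
  have cD: "card ?D = card E" using card_image[OF E(2)] .
  have typeC: "has_sing_type quintic (hyperplane a) P (Type_A 2)" if "P \<in> ?C" for P
    using that has_sing_type_cusp_point[OF a] by auto
  \<comment> \<open>The gradient vanishes at cusp points but equals l a, which is nonzero, at points
    of E.\<close>
  have disj: "?C \<inter> ?D = {}"
  proof (rule ccontr)
    assume "?C \<inter> ?D \<noteq> {}"
    then obtain t e where t: "t \<in> cusp_lines" "e \<in> E" "vec.span {cusp_point a t} = vec.span {e}" by auto
    have "e \<in> vec.span {cusp_point a t}" unfolding t(3) by (simp add: vec.span_base)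
    then obtain c where c: "e = c *s cusp_point a t" by (auto simp: vec.span_singleton)
    obtain i where "a $ i \<noteq> 0" using a0 by (auto simp: vec_eq_iff)
    moreover have "grad_poly e (e $ i) = 0"
      unfolding c using cusp_point_singular[OF t(1), of a i] by (simp add: grad_poly_scale)
    ultimately show False using EH(2)[OF t(2), of i] EH(3) by simp
  qed
  have sing: "section_sing quintic (hyperplane a) = ?C \<union> ?D"
  proof (intro equalityI subsetI)
    fix P assume "P \<in> section_sing quintic (hyperplane a)"
    then obtain v m where v: "P = vec.span {v}" "v \<noteq> 0" "v \<in> hyperplane a" "\<And>i. grad_poly v (v $ i) = m * a $ i"
      using section_sing_quintic_parallel[OF a0] by blast
    show "P \<in> ?C \<union> ?D"
    proof (cases "m = 0")
      case True
      then have "\<And>i. grad_poly v (v $ i) = 0" using v(4) by simp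
      from singular_point_is_cusp_point[OF a v(3,2) this]
      obtain t where "t \<in> cusp_lines" "vec.span {v} = vec.span {cusp_point a t}" by blast
      then show ?thesis using v(1) by blast
    next
      case False
      then show ?thesis using tangent[OF v(3,2) _ v(4)] v(1) by auto
    qed
  next
    fix P assume "P \<in> ?C \<union> ?D"
    then show "P \<in> section_sing quintic (hyperplane a)"
    proof
      assume P: "P \<in> ?C"
      then obtain t where t: "t \<in> cusp_lines" "P = vec.span {cusp_point a t}" by auto
      obtain f where "local_equation quintic (hyperplane a) P f" using typeC[OF P] by (auto simp: has_sing_type_def)
      then show ?thesis
        unfolding t(2) using cusp_point_in_hyperplane[OF t(1)] cusp_point_singular[OF t(1)]
        by (intro parallel_in_section_sing[where l = 0]) auto
    next
      assume "P \<in> ?D"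
      then obtain e where e: "e \<in> E" "P = vec.span {e}" by auto
      obtain f where "local_equation quintic (hyperplane a) P f" using ET[OF e(1)] e(2) by (auto simp: has_sing_type_def)
      then show ?thesis
        unfolding e(2) using EH e(1) by (intro parallel_in_section_sing[where l = l]) auto
    qed
  qed
  define \<tau> where "\<tau> = (\<lambda>P. if P \<in> ?C then Type_A 2 else T)"
  have "image_mset \<tau> (mset_set (?C \<union> ?D)) = image_mset \<tau> (mset_set ?C) + image_mset \<tau> (mset_set ?D)"
    using fin disj by (simp add: mset_set_Union)
  also have "image_mset \<tau> (mset_set ?C) = image_mset (\<lambda>_. Type_A 2) (mset_set ?C)"
    using fin by (intro image_mset_cong) (simp add: \<tau>_def)
  also have "\<dots> = replicate_mset 15 (Type_A 2)" by (simp add: image_mset_const_eq cC)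
  also have "image_mset \<tau> (mset_set ?D) = image_mset (\<lambda>_. T) (mset_set ?D)"
    using fin disj by (intro image_mset_cong) (auto simp: \<tau>_def)
  also have "\<dots> = replicate_mset (card E) T" by (simp add: image_mset_const_eq cD)
  finally have "image_mset \<tau> (mset_set (?C \<union> ?D)) = replicate_mset 15 (Type_A 2) + replicate_mset (card E) T" .
  moreover have "\<forall>P\<in>?C \<union> ?D. has_sing_type quintic (hyperplane a) P (\<tau> P)"
    using typeC ET by (auto simp: \<tau>_def)
  ultimately show ?thesis
    unfolding has_singular_set_def sing using fin by blast
qed

text \<open>A point where the gradient is a nonzero multiple of a is a smooth point of X, on X by
  Euler's relation, with the given hyperplane as tangent space.\<close>

lemma tangent_hyperplaneI:
  assumes a: "transversal_to_cusp_lines a" and e: "e \<in> hyperplane a" "\<And>i. grad_poly e (e $ i) = l * a $ i" "l \<noteq> 0"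
  shows "tangent_hyperplane quintic (hyperplane a)"
proof -
  have "a $ 2 + a $ 3 \<noteq> 0"
    using a by (auto simp: transversal_to_cusp_lines_def cusp_lines_def)
  then have a0: "a \<noteq> 0" by auto
  have g: "gradient quintic e = l *s a" by (simp add: vec_eq_iff gradient_quintic e)
  have "l *s a \<noteq> 0" using a0 e(3) by simp
  moreover have "hyperplane (l *s a) = hyperplane a"
    using e(3) by (simp add: hyperplane_def mult.assoc sum_distrib_left[symmetric])
  moreover have "5 * quintic e = (\<Sum>i\<in>UNIV. l * (a $ i * e $ i))"
    unfolding euler_quintic[symmetric] e(2) by (simp add: ac_simps)
  then have "quintic e = 0" using e(1) by (simp add: sum_distrib_left[symmetric] hyperplane_def)
  moreover have "e \<noteq> 0"
  proof
    assume "e = 0"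
    then have "gradient quintic e = 0"
      by (simp add: vec_eq_iff gradient_quintic grad_poly_def el_defs)
    then show False using g \<open>l *s a \<noteq> 0\<close> by simp
  qed
  ultimately show ?thesis unfolding tangent_hyperplane_def using g by metis
qed

section \<open>Equal values of the quartic at several coordinates\<close>

lemma grad_poly_gradp: "grad_poly v = gradp (el1 v) (el2 v) (el3 v) (el4 v)"
  by (simp add: grad_poly_def gradp_def fun_eq_iff)

lemma gradp_two_roots:
  assumes "gradp e1 e2 e3 e4 y = c" "gradp e1 e2 e3 e4 z = c" "y \<noteq> z"
  shows "dd2 e1 e2 e3 (y + z) (y * z) = 0" "rem2 e1 e2 e3 e4 (y + z) (y * z) = c"
proof -
  have "gradp e1 e2 e3 e4 y - gradp e1 e2 e3 e4 z = (y - z) * dd2 e1 e2 e3 (y + z) (y * z)"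
    unfolding gradp_def dd2_def by algebra
  then show d: "dd2 e1 e2 e3 (y + z) (y * z) = 0" using assms by simp
  have "gradp e1 e2 e3 e4 y = y * dd2 e1 e2 e3 (y + z) (y * z) + rem2 e1 e2 e3 e4 (y + z) (y * z)"
    unfolding gradp_def dd2_def rem2_def by algebra
  then show "rem2 e1 e2 e3 e4 (y + z) (y * z) = c" using assms d by simp
qed

text \<open>Adding and subtracting the two conjugate equations separates them into parts free of q,
  although q is a complex number and not an indeterminate.\<close>

lemma gradp_conjugate_roots:
  assumes "gradp e1 e2 e3 e4 (u + q * w) = l * (A + q * B)" "gradp e1 e2 e3 e4 (u - q * w) = l * (A - q * B)" "q \<noteq> 0"
  shows "tw0 e1 e2 e3 e4 (q ^ 2) u w = l * A" "tw1 e1 e2 e3 e4 (q ^ 2) u w = l * B"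
proof -
  let ?P = "tw0 e1 e2 e3 e4 (q ^ 2) u w" and ?R = "tw1 e1 e2 e3 e4 (q ^ 2) u w"
  have "gradp e1 e2 e3 e4 (u + q * w) = ?P + q * ?R" "gradp e1 e2 e3 e4 (u - q * w) = ?P - q * ?R"
    unfolding gradp_def tw0_def tw1_def by algebra+
  then have *: "?P + q * ?R = l * A + q * (l * B)" "?P - q * ?R = l * A - q * (l * B)"
    using assms by (simp_all add: algebra_simps)
  have "2 * ?P = 2 * (l * A)" using * by algebra
  then show "?P = l * A" by simp
  with *(1) have "q * ?R = q * (l * B)" by simp
  then show "?R = l * B" using \<open>q \<noteq> 0\<close> by simp
qed

text \<open>A remainder of degree at most 2 that takes the same value c at three distinct points is
  the constant c.\<close>

lemma gradp_three_roots:
  assumes "gradp e1 e2 e3 e4 x = c" "gradp e1 e2 e3 e4 y = c" "gradp e1 e2 e3 e4 z = c" "x \<noteq> y" "x \<noteq> z" "y \<noteq> z"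
  defines "S \<equiv> x + y + z" and "m \<equiv> x * y + x * z + y * z" and "n \<equiv> x * y * z"
  shows "quad3 e1 e2 S m = 0" "lin3 e1 e2 e3 S m n = 0" "const3 e1 e2 e3 e4 S n = c"
proof -
  \<comment> \<open>Division of the quartic by the cubic (T - x)(T - y)(T - z), with its linear
    quotient.\<close>
  have r: "gradp e1 e2 e3 e4 T = T ^ 2 * quad3 e1 e2 S m + T * lin3 e1 e2 e3 S m n + const3 e1 e2 e3 e4 S n
      + (T - x) * (T - y) * (T - z) * (128 * T + 128 * S - 64 * e1)" for T
    unfolding gradp_def quad3_def lin3_def const3_def S_def m_def n_def by algebra
  let ?q = "quad3 e1 e2 S m" and ?l = "lin3 e1 e2 e3 S m n" and ?c = "const3 e1 e2 e3 e4 S n"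
  have *: "x ^ 2 * ?q + x * ?l + ?c = c" "y ^ 2 * ?q + y * ?l + ?c = c" "z ^ 2 * ?q + z * ?l + ?c = c"
    using r[of x] r[of y] r[of z] assms(1-3) by simp_all
  have "(x - y) * ((x + y) * ?q + ?l) = (x ^ 2 * ?q + x * ?l + ?c) - (y ^ 2 * ?q + y * ?l + ?c)"
     "(x - z) * ((x + z) * ?q + ?l) = (x ^ 2 * ?q + x * ?l + ?c) - (z ^ 2 * ?q + z * ?l + ?c)"
    by algebra+
  then have l: "(x + y) * ?q + ?l = 0" "(x + z) * ?q + ?l = 0"
    unfolding * using assms(4,5) by simp_all
  have "(y - z) * ?q = ((x + y) * ?q + ?l) - ((x + z) * ?q + ?l)" by algebra
  then show q: "?q = 0" unfolding l using assms(6) by simp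
  then show l0: "?l = 0" using l by simp
  show "?c = c" using * q l0 by simp
qed

section \<open>Gradients at the chosen points and transversality of the hyperplanes\<close>

text \<open>Together with the two analogues below this verifies tangency, with explicit nonzero
  proportionality factor; relations among q, r and k appear as multiples of their minimal
  polynomials.\<close>

lemma grad_poly_16A2:
  fixes q :: complex
  assumes "q ^ 2 = 3"
  shows "grad_poly (vector [9, 9, 0, 6 + 4 * q, 6 - 4 * q]) ((vector [9, 9, 0, 6 + 4 * q, 6 - 4 * q] :: complex^5) $ i) = (18432) * (vector [- 8, - 8, 1, 6 + 3 * q, 6 - 3 * q] :: complex^5) $ i"
proof -
  have g1: "grad_poly (vector [9, 9, 0, 6 + 4 * q, 6 - 4 * q]) (9) = (18432) * (- 8) + (q ^ 2 - 3) * ((-4096) * q ^ 2 + (-49152))"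
    unfolding grad_poly_def el_defs vector_5 by algebra
  have g2: "grad_poly (vector [9, 9, 0, 6 + 4 * q, 6 - 4 * q]) (9) = (18432) * (- 8) + (q ^ 2 - 3) * ((-4096) * q ^ 2 + (-49152))"
    unfolding grad_poly_def el_defs vector_5 by algebra
  have g3: "grad_poly (vector [9, 9, 0, 6 + 4 * q, 6 - 4 * q]) (0) = (18432) * (1) + (q ^ 2 - 3) * ((-4096) * q ^ 2 + 6144)"
    unfolding grad_poly_def el_defs vector_5 by (simp; algebra)
  have g4: "grad_poly (vector [9, 9, 0, 6 + 4 * q, 6 - 4 * q]) (6 + 4 * q) = (18432) * (6 + 3 * q) + (q ^ 2 - 3) * (12288 * q ^ 2 + 36864 * q + 36864)"
    unfolding grad_poly_def el_defs vector_5 by algebra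
  have g5: "grad_poly (vector [9, 9, 0, 6 + 4 * q, 6 - 4 * q]) (6 - 4 * q) = (18432) * (6 - 3 * q) + (q ^ 2 - 3) * (12288 * q ^ 2 + (-36864) * q + 36864)"
    unfolding grad_poly_def el_defs vector_5 by algebra
  show ?thesis
    using exhaust_5[of i] g1 g2 g3 g4 g5 assms by auto
qed

lemma grad_poly_A3:
  fixes r :: complex
  assumes "r ^ 2 = 13"
  shows "grad_poly (vector [9 + 3 * r, 9 + 3 * r, 13 - r, 13 - r, 24]) ((vector [9 + 3 * r, 9 + 3 * r, 13 - r, 13 - r, 24] :: complex^5) $ i) = (55296) * (vector [- 4 - 2 * r, - 4 - 2 * r, - 12 + 6 * r, - 12 + 6 * r, 29 - 5 * r] :: complex^5) $ i"
proof -
  have g1: "grad_poly (vector [9 + 3 * r, 9 + 3 * r, 13 - r, 13 - r, 24]) (9 + 3 * r) = (55296) * (- 4 - 2 * r)"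
    unfolding grad_poly_def el_defs vector_5 by algebra
  have g2: "grad_poly (vector [9 + 3 * r, 9 + 3 * r, 13 - r, 13 - r, 24]) (9 + 3 * r) = (55296) * (- 4 - 2 * r)"
    unfolding grad_poly_def el_defs vector_5 by algebra
  have g3: "grad_poly (vector [9 + 3 * r, 9 + 3 * r, 13 - r, 13 - r, 24]) (13 - r) = (55296) * (- 12 + 6 * r)"
    unfolding grad_poly_def el_defs vector_5 by algebra
  have g4: "grad_poly (vector [9 + 3 * r, 9 + 3 * r, 13 - r, 13 - r, 24]) (13 - r) = (55296) * (- 12 + 6 * r)"
    unfolding grad_poly_def el_defs vector_5 by algebra
  have g5: "grad_poly (vector [9 + 3 * r, 9 + 3 * r, 13 - r, 13 - r, 24]) (24) = (55296) * (29 - 5 * r) + (r ^ 2 - 13) * ((-82944))"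
    unfolding grad_poly_def el_defs vector_5 by algebra
  show ?thesis
    using exhaust_5[of i] g1 g2 g3 g4 g5 assms by auto
qed

lemma grad_poly_D4:
  fixes r k :: complex
  assumes "r ^ 2 = 13" "k ^ 2 = - 3"
  shows "grad_poly (vector [6, 6, 6, (1 + 2 * r) + k * (2 - r), (1 + 2 * r) - k * (2 - r)]) ((vector [6, 6, 6, (1 + 2 * r) + k * (2 - r), (1 + 2 * r) - k * (2 - r)] :: complex^5) $ i) = (1536 * (5 - r)) * (vector [12, 12, 12, (- 45 + 9 * r) + k * (17 - 5 * r), (- 45 + 9 * r) - k * (17 - 5 * r)] :: complex^5) $ i"
proof -
  have g1: "grad_poly (vector [6, 6, 6, (1 + 2 * r) + k * (2 - r), (1 + 2 * r) - k * (2 - r)]) (6) = (1536 * (5 - r)) * (12) + (r ^ 2 - 13) * (624 * r ^ 2 + (-2304) * r + 8016) + (k ^ 2 + 3) * ((-16) * k ^ 2 * r ^ 4 + 128 * k ^ 2 * r ^ 3 + (-384) * k ^ 2 * r ^ 2 + 512 * k ^ 2 * r + (-256) * k ^ 2 + (-208) * r ^ 4 + 768 * r ^ 3 + 32 * r ^ 2 + (-2688) * r + 2432)"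
    unfolding grad_poly_def el_defs vector_5 by algebra
  have g2: "grad_poly (vector [6, 6, 6, (1 + 2 * r) + k * (2 - r), (1 + 2 * r) - k * (2 - r)]) (6) = (1536 * (5 - r)) * (12) + (r ^ 2 - 13) * (624 * r ^ 2 + (-2304) * r + 8016) + (k ^ 2 + 3) * ((-16) * k ^ 2 * r ^ 4 + 128 * k ^ 2 * r ^ 3 + (-384) * k ^ 2 * r ^ 2 + 512 * k ^ 2 * r + (-256) * k ^ 2 + (-208) * r ^ 4 + 768 * r ^ 3 + 32 * r ^ 2 + (-2688) * r + 2432)"
    unfolding grad_poly_def el_defs vector_5 by algebra
  have g3: "grad_poly (vector [6, 6, 6, (1 + 2 * r) + k * (2 - r), (1 + 2 * r) - k * (2 - r)]) (6) = (1536 * (5 - r)) * (12) + (r ^ 2 - 13) * (624 * r ^ 2 + (-2304) * r + 8016) + (k ^ 2 + 3) * ((-16) * k ^ 2 * r ^ 4 + 128 * k ^ 2 * r ^ 3 + (-384) * k ^ 2 * r ^ 2 + 512 * k ^ 2 * r + (-256) * k ^ 2 + (-208) * r ^ 4 + 768 * r ^ 3 + 32 * r ^ 2 + (-2688) * r + 2432)"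
    unfolding grad_poly_def el_defs vector_5 by algebra
  have g4: "grad_poly (vector [6, 6, 6, (1 + 2 * r) + k * (2 - r), (1 + 2 * r) - k * (2 - r)]) ((1 + 2 * r) + k * (2 - r)) = (1536 * (5 - r)) * ((- 45 + 9 * r) + k * (17 - 5 * r)) + (r ^ 2 - 13) * (128 * k * r ^ 2 + (-2944) * k * r + 8960 * k + (-1872) * r ^ 2 + 10368 * r + (-27504)) + (k ^ 2 + 3) * (48 * k ^ 2 * r ^ 4 + (-384) * k ^ 2 * r ^ 3 + 1152 * k ^ 2 * r ^ 2 + (-1536) * k ^ 2 * r + 768 * k ^ 2 + (-384) * k * r ^ 4 + 2688 * k * r ^ 3 + (-6912) * k * r ^ 2 + 7680 * k * r + (-3072) * k + 624 * r ^ 4 + (-3456) * r ^ 3 + 5664 * r ^ 2 + (-1152) * r + (-2688))"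
    unfolding grad_poly_def el_defs vector_5 by algebra
  have g5: "grad_poly (vector [6, 6, 6, (1 + 2 * r) + k * (2 - r), (1 + 2 * r) - k * (2 - r)]) ((1 + 2 * r) - k * (2 - r)) = (1536 * (5 - r)) * ((- 45 + 9 * r) - k * (17 - 5 * r)) + (r ^ 2 - 13) * ((-128) * k * r ^ 2 + 2944 * k * r + (-8960) * k + (-1872) * r ^ 2 + 10368 * r + (-27504)) + (k ^ 2 + 3) * (48 * k ^ 2 * r ^ 4 + (-384) * k ^ 2 * r ^ 3 + 1152 * k ^ 2 * r ^ 2 + (-1536) * k ^ 2 * r + 768 * k ^ 2 + 384 * k * r ^ 4 + (-2688) * k * r ^ 3 + 6912 * k * r ^ 2 + (-7680) * k * r + 3072 * k + 624 * r ^ 4 + (-3456) * r ^ 3 + 5664 * r ^ 2 + (-1152) * r + (-2688))"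
    unfolding grad_poly_def el_defs vector_5 by algebra
  show ?thesis
    using exhaust_5[of i] g1 g2 g3 g4 g5 assms by auto
qed

lemma transversal_to_cusp_linesI:
  assumes "a $ 1 + a $ 2 \<noteq> 0" "a $ 1 + a $ 3 \<noteq> 0" "a $ 1 + a $ 4 \<noteq> 0" "a $ 1 + a $ 5 \<noteq> 0" "a $ 2 + a $ 3 \<noteq> 0"
    "a $ 2 + a $ 4 \<noteq> 0" "a $ 2 + a $ 5 \<noteq> 0" "a $ 3 + a $ 4 \<noteq> 0" "a $ 3 + a $ 5 \<noteq> 0" "a $ 4 + a $ 5 \<noteq> 0"
    "a $ 2 + a $ 3 + a $ 4 + a $ 5 \<noteq> 0" "a $ 1 + a $ 3 + a $ 4 + a $ 5 \<noteq> 0" "a $ 1 + a $ 2 + a $ 4 + a $ 5 \<noteq> 0"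
    "a $ 1 + a $ 2 + a $ 3 + a $ 5 \<noteq> 0" "a $ 1 + a $ 2 + a $ 3 + a $ 4 \<noteq> 0"
  shows "transversal_to_cusp_lines a"
  using assms unfolding transversal_to_cusp_lines_def cusp_lines_def by (simp add: add_ac)

lemma quadratic_nonzero:
  fixes r :: complex
  assumes "r ^ 2 = d" and "z = A + B * r" and "A ^ 2 - d * B ^ 2 \<noteq> 0"
  shows "z \<noteq> 0"
proof
  assume "z = 0"
  moreover have "A ^ 2 - d * B ^ 2 = (A + B * r) * (A - B * r) + B ^ 2 * (r ^ 2 - d)" by algebra
  ultimately show False using assms by simp
qed

text \<open>Two norms in succession: multiplying by the conjugate under k to -k lands in Q(sqrt 13),
  where the norm of \<open>quadratic_nonzero\<close> applies.\<close>

lemma quadratic_k_nonzero: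
  fixes r k :: complex
  assumes "r ^ 2 = 13" "k ^ 2 = - 3" and z: "z = A + B * r + k * (C + D * r)"
    and "(A ^ 2 + 13 * B ^ 2 + 3 * C ^ 2 + 39 * D ^ 2) ^ 2 - 13 * (2 * A * B + 6 * C * D) ^ 2 \<noteq> 0"
  shows "z \<noteq> 0"
proof
  assume "z = 0"
  moreover have "(A ^ 2 + 13 * B ^ 2 + 3 * C ^ 2 + 39 * D ^ 2) + (2 * A * B + 6 * C * D) * r
    = z * (A + B * r - k * (C + D * r)) - (B ^ 2 + 3 * D ^ 2) * (r ^ 2 - 13) + (C + D * r) ^ 2 * (k ^ 2 + 3)"
    unfolding z by algebra
  ultimately show False
    using quadratic_nonzero[OF assms(1) refl assms(4)] assms(1,2) by simp
qed

lemma vector_components: "(v :: complex^5) = vector [v $ 1, v $ 2, v $ 3, v $ 4, v $ 5]"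
  by (simp add: vec_eq_iff forall_5)

lemma span_eq_span_multiple:
  fixes v :: "complex^'n"
  assumes "v = c *s e" "v \<noteq> 0" shows "vec.span {v} = vec.span {e}"
  using assms span_scale_singleton[of c e] by auto

lemma transversal_17A2:
  shows "transversal_to_cusp_lines (vector [3, - 13, - 13, 7, 7])"
proof (rule transversal_to_cusp_linesI)
  let ?a = "vector [3, - 13, - 13, 7, 7] :: complex^5"
  show "?a $ 1 + ?a $ 2 \<noteq> 0" by simp
  show "?a $ 1 + ?a $ 3 \<noteq> 0" by simp
  show "?a $ 1 + ?a $ 4 \<noteq> 0" by simp
  show "?a $ 1 + ?a $ 5 \<noteq> 0" by simp
  show "?a $ 2 + ?a $ 3 \<noteq> 0" by simp
  show "?a $ 2 + ?a $ 4 \<noteq> 0" by simp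
  show "?a $ 2 + ?a $ 5 \<noteq> 0" by simp
  show "?a $ 3 + ?a $ 4 \<noteq> 0" by simp
  show "?a $ 3 + ?a $ 5 \<noteq> 0" by simp
  show "?a $ 4 + ?a $ 5 \<noteq> 0" by simp
  show "?a $ 2 + ?a $ 3 + ?a $ 4 + ?a $ 5 \<noteq> 0" by simp
  show "?a $ 1 + ?a $ 3 + ?a $ 4 + ?a $ 5 \<noteq> 0" by simp
  show "?a $ 1 + ?a $ 2 + ?a $ 4 + ?a $ 5 \<noteq> 0" by simp
  show "?a $ 1 + ?a $ 2 + ?a $ 3 + ?a $ 5 \<noteq> 0" by simp
  show "?a $ 1 + ?a $ 2 + ?a $ 3 + ?a $ 4 \<noteq> 0" by simp
qed

lemma transversal_16A2:
  fixes q :: complex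
  assumes "q ^ 2 = 3"
  shows "transversal_to_cusp_lines (vector [- 8, - 8, 1, 6 + 3 * q, 6 - 3 * q])"
proof (rule transversal_to_cusp_linesI)
  let ?a = "vector [- 8, - 8, 1, 6 + 3 * q, 6 - 3 * q] :: complex^5"
  show "?a $ 1 + ?a $ 2 \<noteq> 0" by (rule quadratic_nonzero[OF assms, of _ "- 16" 0]) (simp_all add: algebra_simps)
  show "?a $ 1 + ?a $ 3 \<noteq> 0" by (rule quadratic_nonzero[OF assms, of _ "- 7" 0]) (simp_all add: algebra_simps)
  show "?a $ 1 + ?a $ 4 \<noteq> 0" by (rule quadratic_nonzero[OF assms, of _ "- 2" 3]) (simp_all add: algebra_simps)
  show "?a $ 1 + ?a $ 5 \<noteq> 0" by (rule quadratic_nonzero[OF assms, of _ "- 2" "- 3"]) (simp_all add: algebra_simps)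
  show "?a $ 2 + ?a $ 3 \<noteq> 0" by (rule quadratic_nonzero[OF assms, of _ "- 7" 0]) (simp_all add: algebra_simps)
  show "?a $ 2 + ?a $ 4 \<noteq> 0" by (rule quadratic_nonzero[OF assms, of _ "- 2" 3]) (simp_all add: algebra_simps)
  show "?a $ 2 + ?a $ 5 \<noteq> 0" by (rule quadratic_nonzero[OF assms, of _ "- 2" "- 3"]) (simp_all add: algebra_simps)
  show "?a $ 3 + ?a $ 4 \<noteq> 0" by (rule quadratic_nonzero[OF assms, of _ 7 3]) (simp_all add: algebra_simps)
  show "?a $ 3 + ?a $ 5 \<noteq> 0" by (rule quadratic_nonzero[OF assms, of _ 7 "- 3"]) (simp_all add: algebra_simps)
  show "?a $ 4 + ?a $ 5 \<noteq> 0" by (rule quadratic_nonzero[OF assms, of _ 12 0]) (simp_all add: algebra_simps)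
  show "?a $ 2 + ?a $ 3 + ?a $ 4 + ?a $ 5 \<noteq> 0" by (rule quadratic_nonzero[OF assms, of _ 5 0]) (simp_all add: algebra_simps)
  show "?a $ 1 + ?a $ 3 + ?a $ 4 + ?a $ 5 \<noteq> 0" by (rule quadratic_nonzero[OF assms, of _ 5 0]) (simp_all add: algebra_simps)
  show "?a $ 1 + ?a $ 2 + ?a $ 4 + ?a $ 5 \<noteq> 0" by (rule quadratic_nonzero[OF assms, of _ "- 4" 0]) (simp_all add: algebra_simps)
  show "?a $ 1 + ?a $ 2 + ?a $ 3 + ?a $ 5 \<noteq> 0" by (rule quadratic_nonzero[OF assms, of _ "- 9" "- 3"]) (simp_all add: algebra_simps)
  show "?a $ 1 + ?a $ 2 + ?a $ 3 + ?a $ 4 \<noteq> 0" by (rule quadratic_nonzero[OF assms, of _ "- 9" 3]) (simp_all add: algebra_simps)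
qed

lemma transversal_A3:
  fixes r :: complex
  assumes "r ^ 2 = 13"
  shows "transversal_to_cusp_lines (vector [- 4 - 2 * r, - 4 - 2 * r, - 12 + 6 * r, - 12 + 6 * r, 29 - 5 * r])"
proof (rule transversal_to_cusp_linesI)
  let ?a = "vector [- 4 - 2 * r, - 4 - 2 * r, - 12 + 6 * r, - 12 + 6 * r, 29 - 5 * r] :: complex^5"
  show "?a $ 1 + ?a $ 2 \<noteq> 0" by (rule quadratic_nonzero[OF assms, of _ "- 8" "- 4"]) (simp_all add: algebra_simps)
  show "?a $ 1 + ?a $ 3 \<noteq> 0" by (rule quadratic_nonzero[OF assms, of _ "- 16" 4]) (simp_all add: algebra_simps)
  show "?a $ 1 + ?a $ 4 \<noteq> 0" by (rule quadratic_nonzero[OF assms, of _ "- 16" 4]) (simp_all add: algebra_simps)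
  show "?a $ 1 + ?a $ 5 \<noteq> 0" by (rule quadratic_nonzero[OF assms, of _ 25 "- 7"]) (simp_all add: algebra_simps)
  show "?a $ 2 + ?a $ 3 \<noteq> 0" by (rule quadratic_nonzero[OF assms, of _ "- 16" 4]) (simp_all add: algebra_simps)
  show "?a $ 2 + ?a $ 4 \<noteq> 0" by (rule quadratic_nonzero[OF assms, of _ "- 16" 4]) (simp_all add: algebra_simps)
  show "?a $ 2 + ?a $ 5 \<noteq> 0" by (rule quadratic_nonzero[OF assms, of _ 25 "- 7"]) (simp_all add: algebra_simps)
  show "?a $ 3 + ?a $ 4 \<noteq> 0" by (rule quadratic_nonzero[OF assms, of _ "- 24" 12]) (simp_all add: algebra_simps)
  show "?a $ 3 + ?a $ 5 \<noteq> 0" by (rule quadratic_nonzero[OF assms, of _ 17 1]) (simp_all add: algebra_simps)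
  show "?a $ 4 + ?a $ 5 \<noteq> 0" by (rule quadratic_nonzero[OF assms, of _ 17 1]) (simp_all add: algebra_simps)
  show "?a $ 2 + ?a $ 3 + ?a $ 4 + ?a $ 5 \<noteq> 0" by (rule quadratic_nonzero[OF assms, of _ 1 5]) (simp_all add: algebra_simps)
  show "?a $ 1 + ?a $ 3 + ?a $ 4 + ?a $ 5 \<noteq> 0" by (rule quadratic_nonzero[OF assms, of _ 1 5]) (simp_all add: algebra_simps)
  show "?a $ 1 + ?a $ 2 + ?a $ 4 + ?a $ 5 \<noteq> 0" by (rule quadratic_nonzero[OF assms, of _ 9 "- 3"]) (simp_all add: algebra_simps)
  show "?a $ 1 + ?a $ 2 + ?a $ 3 + ?a $ 5 \<noteq> 0" by (rule quadratic_nonzero[OF assms, of _ 9 "- 3"]) (simp_all add: algebra_simps)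
  show "?a $ 1 + ?a $ 2 + ?a $ 3 + ?a $ 4 \<noteq> 0" by (rule quadratic_nonzero[OF assms, of _ "- 32" 8]) (simp_all add: algebra_simps)
qed

lemma transversal_D4:
  fixes r k :: complex
  assumes "r ^ 2 = 13" "k ^ 2 = - 3"
  shows "transversal_to_cusp_lines (vector [12, 12, 12, (- 45 + 9 * r) + k * (17 - 5 * r), (- 45 + 9 * r) - k * (17 - 5 * r)])"
proof (rule transversal_to_cusp_linesI)
  let ?a = "vector [12, 12, 12, (- 45 + 9 * r) + k * (17 - 5 * r), (- 45 + 9 * r) - k * (17 - 5 * r)] :: complex^5"
  show "?a $ 1 + ?a $ 2 \<noteq> 0" by (rule quadratic_k_nonzero[OF assms, of _ 24 0 0 0]) (simp_all add: algebra_simps)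
  show "?a $ 1 + ?a $ 3 \<noteq> 0" by (rule quadratic_k_nonzero[OF assms, of _ 24 0 0 0]) (simp_all add: algebra_simps)
  show "?a $ 1 + ?a $ 4 \<noteq> 0" by (rule quadratic_k_nonzero[OF assms, of _ "- 33" 9 17 "- 5"]) (simp_all add: algebra_simps)
  show "?a $ 1 + ?a $ 5 \<noteq> 0" by (rule quadratic_k_nonzero[OF assms, of _ "- 33" 9 "- 17" 5]) (simp_all add: algebra_simps)
  show "?a $ 2 + ?a $ 3 \<noteq> 0" by (rule quadratic_k_nonzero[OF assms, of _ 24 0 0 0]) (simp_all add: algebra_simps)
  show "?a $ 2 + ?a $ 4 \<noteq> 0" by (rule quadratic_k_nonzero[OF assms, of _ "- 33" 9 17 "- 5"]) (simp_all add: algebra_simps)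
  show "?a $ 2 + ?a $ 5 \<noteq> 0" by (rule quadratic_k_nonzero[OF assms, of _ "- 33" 9 "- 17" 5]) (simp_all add: algebra_simps)
  show "?a $ 3 + ?a $ 4 \<noteq> 0" by (rule quadratic_k_nonzero[OF assms, of _ "- 33" 9 17 "- 5"]) (simp_all add: algebra_simps)
  show "?a $ 3 + ?a $ 5 \<noteq> 0" by (rule quadratic_k_nonzero[OF assms, of _ "- 33" 9 "- 17" 5]) (simp_all add: algebra_simps)
  show "?a $ 4 + ?a $ 5 \<noteq> 0" by (rule quadratic_k_nonzero[OF assms, of _ "- 90" 18 0 0]) (simp_all add: algebra_simps)
  show "?a $ 2 + ?a $ 3 + ?a $ 4 + ?a $ 5 \<noteq> 0" by (rule quadratic_k_nonzero[OF assms, of _ "- 66" 18 0 0]) (simp_all add: algebra_simps)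
  show "?a $ 1 + ?a $ 3 + ?a $ 4 + ?a $ 5 \<noteq> 0" by (rule quadratic_k_nonzero[OF assms, of _ "- 66" 18 0 0]) (simp_all add: algebra_simps)
  show "?a $ 1 + ?a $ 2 + ?a $ 4 + ?a $ 5 \<noteq> 0" by (rule quadratic_k_nonzero[OF assms, of _ "- 66" 18 0 0]) (simp_all add: algebra_simps)
  show "?a $ 1 + ?a $ 2 + ?a $ 3 + ?a $ 5 \<noteq> 0" by (rule quadratic_k_nonzero[OF assms, of _ "- 9" 9 "- 17" 5]) (simp_all add: algebra_simps)
  show "?a $ 1 + ?a $ 2 + ?a $ 3 + ?a $ 4 \<noteq> 0" by (rule quadratic_k_nonzero[OF assms, of _ "- 9" 9 17 "- 5"]) (simp_all add: algebra_simps)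
qed

section \<open>Completeness of the lists of tangency points\<close>

text \<open>The coefficients of y and z agree, as do those of w and t, so the quartic takes equal
  values on each pair. Of the four cases (each pair equal or distinct) only the one with both pairs
  distinct survives.\<close>

lemma tangent_points_17A2:
  assumes H: "v \<in> hyperplane (vector [3, - 13, - 13, 7, 7])" and v0: "v \<noteq> 0" and l: "l \<noteq> 0"
    and gr: "\<And>i. grad_poly v (v $ i) = l * (vector [3, - 13, - 13, 7, 7] :: complex^5) $ i"
  shows "\<exists>e\<in>{vector [0, 2, - 2, 1, - 1], vector [0, 2, - 2, - 1, 1]}. vec.span {v} = vec.span {e}"
proof -
  obtain x y z w t where v: "v = vector [x, y, z, w, t]" using vector_components by blast
  let ?g = "gradp (el1 v) (el2 v) (el3 v) (el4 v)"
  have g: "?g x = l * 3" "?g y = l * (- 13)" "?g z = l * (- 13)" "?g w = l * 7" "?g t = l * 7"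
    using gr[of 1] gr[of 2] gr[of 3] gr[of 4] gr[of 5] by (simp_all add: grad_poly_gradp v)
  have "3 * x = 13 * y + 13 * z - 7 * w - 7 * t"
    using H by (simp add: hyperplane_def sum_5 v) algebra
  then have x: "x = (13 * (y + z) - 7 * (w + t)) / 3" by (simp add: field_simps)
  consider "y = z" "w = t" | "y \<noteq> z" "w = t" | "y = z" "w \<noteq> t" | "y \<noteq> z" "w \<noteq> t" by blast
  then show ?thesis
  proof cases
    case 1
    have e: "el1 v = x + 2 * y + 2 * w" "el2 v = y ^ 2 + w ^ 2 + 2 * x * (y + w) + 4 * y * w"
      "el3 v = x * (y ^ 2 + w ^ 2 + 4 * y * w) + 2 * y ^ 2 * w + 2 * w ^ 2 * y" "el4 v = y ^ 2 * w ^ 2 + 2 * x * (y ^ 2 * w + w ^ 2 * y)"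
      unfolding v el_defs vector_5 1[symmetric] by algebra+
    have "x = (26 * y - 14 * w) / 3" using x 1 by simp
    from tangency_17A2_equal[OF this g(2)[unfolded e] g(4)[unfolded e] g(1)[unfolded e] l] show ?thesis ..
  next
    case 2
    have e: "el1 v = x + (y + z) + 2 * w" "el2 v = y * z + w ^ 2 + x * ((y + z) + 2 * w) + 2 * (y + z) * w"
      "el3 v = x * (y * z + w ^ 2 + 2 * (y + z) * w) + 2 * (y * z) * w + w ^ 2 * (y + z)" "el4 v = (y * z) * w ^ 2 + x * (2 * (y * z) * w + w ^ 2 * (y + z))"
      unfolding v el_defs vector_5 2(2)[symmetric] by algebra+
    have "x = (13 * (y + z) - 14 * w) / 3" using x 2 by simp
    from tangency_17A2_distinct_equal[OF this gradp_two_roots[OF g(2,3) 2(1), unfolded e] g(4)[unfolded e] g(1)[unfolded e] l] show ?thesis ..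
  next
    case 3
    have e: "el1 v = x + (w + t) + 2 * y" "el2 v = w * t + y ^ 2 + x * ((w + t) + 2 * y) + 2 * (w + t) * y"
      "el3 v = x * (w * t + y ^ 2 + 2 * (w + t) * y) + 2 * (w * t) * y + y ^ 2 * (w + t)" "el4 v = (w * t) * y ^ 2 + x * (2 * (w * t) * y + y ^ 2 * (w + t))"
      unfolding v el_defs vector_5 3(1)[symmetric] by algebra+
    have "x = (26 * y - 7 * (w + t)) / 3" using x 3 by simp
    from tangency_17A2_equal_distinct[OF this gradp_two_roots[OF g(4,5) 3(2), unfolded e] g(2)[unfolded e] g(1)[unfolded e] l] show ?thesis ..
  next
    case 4
    have e: "el1 v = x + (y + z) + (w + t)" "el2 v = y * z + w * t + x * ((y + z) + (w + t)) + (y + z) * (w + t)"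
      "el3 v = x * (y * z + w * t + (y + z) * (w + t)) + (y * z) * (w + t) + (w * t) * (y + z)"
      "el4 v = (y * z) * (w * t) + x * ((y * z) * (w + t) + (w * t) * (y + z))"
      unfolding v el_defs vector_5 by algebra+
    note two = gradp_two_roots[OF g(2,3) 4(1), unfolded e] gradp_two_roots[OF g(4,5) 4(2), unfolded e]
    note c = tangency_17A2_distinct[OF x two(1) two(3) two(2) two(4) g(1)[unfolded e] l]
    have z: "z = - y" and t: "t = - w" using c(1,2) by (simp_all add: add_eq_0_iff)
    \<comment> \<open>Since the products are -y^2 and -w^2, the relation m = 4n reads y^2 = 4 w^2;
      its two solutions are the two points of tangency.\<close>
    have "(y - 2 * w) * (y + 2 * w) = 0" using c(3) unfolding z t by algebra
    moreover have x0: "x = 0" using x c(1,2) by simp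
    ultimately consider "y = 2 * w" | "y = - 2 * w" by (auto simp: add_eq_0_iff)
    then show ?thesis
    proof cases
      case 1
      then have "v = w *s vector [0, 2, - 2, 1, - 1]" by (simp add: v vec_eq_iff forall_5 x0 z t)
      then show ?thesis using span_eq_span_multiple[OF _ v0] by blast
    next
      case 2
      then have "v = (- w) *s vector [0, 2, - 2, - 1, 1]" by (simp add: v vec_eq_iff forall_5 x0 z t)
      then show ?thesis using span_eq_span_multiple[OF _ v0] by blast
    qed
  qed
qed

lemma tangent_points_16A2:
  fixes q :: complex
  assumes q2: "q ^ 2 = 3" and H: "v \<in> hyperplane (vector [- 8, - 8, 1, 6 + 3 * q, 6 - 3 * q])" and v0: "v \<noteq> 0" and l: "l \<noteq> 0"
    and gr: "\<And>i. grad_poly v (v $ i) = l * (vector [- 8, - 8, 1, 6 + 3 * q, 6 - 3 * q] :: complex^5) $ i"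
  shows "vec.span {v} = vec.span {vector [9, 9, 0, 6 + 4 * q, 6 - 4 * q]}"
proof -
  have q: "q \<noteq> 0" using q2 by auto
  \<comment> \<open>The last two coordinates are rewritten as a conjugate pair, which is possible
    for any complex values because q is nonzero.\<close>
  obtain p s x u w where v: "v = vector [p, s, x, u + q * w, u - q * w]"
  proof
    show "v = vector [v $ 1, v $ 2, v $ 3, (v $ 4 + v $ 5) / 2 + q * ((v $ 4 - v $ 5) / (2 * q)), (v $ 4 + v $ 5) / 2 - q * ((v $ 4 - v $ 5) / (2 * q))]"
      using q by (simp add: vec_eq_iff forall_5 field_simps)
  qed
  let ?g = "gradp (el1 v) (el2 v) (el3 v) (el4 v)"
  have g: "?g p = l * (- 8)" "?g s = l * (- 8)" "?g x = l * 1" "?g (u + q * w) = l * (6 + q * 3)" "?g (u - q * w) = l * (6 - q * 3)"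
    using gr[of 1] gr[of 2] gr[of 3] gr[of 4] gr[of 5] by (simp_all add: grad_poly_gradp v mult.commute[of q 3])
  note tw = gradp_conjugate_roots[OF g(4,5) q, unfolded q2]
  have "(- 8) * p + (- 8) * s + x + (6 + 3 * q) * (u + q * w) + (6 - 3 * q) * (u - q * w) = 0"
    using H by (simp add: hyperplane_def sum_5 v)
  moreover have "(6 + 3 * q) * (u + q * w) + (6 - 3 * q) * (u - q * w) = 12 * u + 6 * q ^ 2 * w" by algebra
  ultimately have x: "x = 8 * (p + s) - 12 * u - 18 * w" unfolding q2 by algebra
  show ?thesis
  proof (cases "p = s")
    case True
    have "el1 v = x + 2 * p + 2 * u" "el2 v = p ^ 2 + (u ^ 2 - q ^ 2 * w ^ 2) + 2 * x * (p + u) + 4 * p * u"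
      "el3 v = x * (p ^ 2 + (u ^ 2 - q ^ 2 * w ^ 2) + 4 * p * u) + 2 * p ^ 2 * u + 2 * (u ^ 2 - q ^ 2 * w ^ 2) * p"
      "el4 v = p ^ 2 * (u ^ 2 - q ^ 2 * w ^ 2) + 2 * x * (p ^ 2 * u + (u ^ 2 - q ^ 2 * w ^ 2) * p)"
      unfolding v el_defs vector_5 True[symmetric] by algebra+
    note e = this[unfolded q2]
    have x': "x = 16 * p - 12 * u - 18 * w" using x True by simp
    note c = tangency_16A2_equal[OF x' g(1)[unfolded e] g(3)[unfolded e] tw[unfolded e] l]
    have u: "u = 3 / 2 * w" using c by (simp add: field_simps)
    have p: "p = 9 / 4 * w" using c(1) unfolding u by (simp add: field_simps)
    have "v = (w / 4) *s vector [9, 9, 0, 6 + 4 * q, 6 - 4 * q]"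
      unfolding v True[symmetric] x' p u by (simp add: vec_eq_iff forall_5 field_simps)
    then show ?thesis using span_eq_span_multiple v0 by blast
  next
    case False
    have "el1 v = x + (p + s) + 2 * u" "el2 v = p * s + (u ^ 2 - q ^ 2 * w ^ 2) + x * ((p + s) + 2 * u) + 2 * (p + s) * u"
      "el3 v = x * (p * s + (u ^ 2 - q ^ 2 * w ^ 2) + 2 * (p + s) * u) + 2 * (p * s) * u + (u ^ 2 - q ^ 2 * w ^ 2) * (p + s)"
      "el4 v = (p * s) * (u ^ 2 - q ^ 2 * w ^ 2) + x * (2 * (p * s) * u + (u ^ 2 - q ^ 2 * w ^ 2) * (p + s))"
      unfolding v el_defs vector_5 by algebra+
    note e = this[unfolded q2]
    from tangency_16A2_distinct[OF x gradp_two_roots[OF g(1,2) False, unfolded e] g(3)[unfolded e] tw[unfolded e] l]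
    show ?thesis ..
  qed
qed

lemma tangent_points_A3:
  fixes r :: complex
  assumes r2: "r ^ 2 = 13" and H: "v \<in> hyperplane (vector [- 4 - 2 * r, - 4 - 2 * r, - 12 + 6 * r, - 12 + 6 * r, 29 - 5 * r])"
    and v0: "v \<noteq> 0" and l: "l \<noteq> 0"
    and gr: "\<And>i. grad_poly v (v $ i) = l * (vector [- 4 - 2 * r, - 4 - 2 * r, - 12 + 6 * r, - 12 + 6 * r, 29 - 5 * r] :: complex^5) $ i"
  shows "vec.span {v} = vec.span {vector [9 + 3 * r, 9 + 3 * r, 13 - r, 13 - r, 24]}"
proof -
  obtain y z w t x where v: "v = vector [y, z, w, t, x]" using vector_components by blast
  let ?g = "gradp (el1 v) (el2 v) (el3 v) (el4 v)"
  have g: "?g y = l * (- 4 - 2 * r)" "?g z = l * (- 4 - 2 * r)" "?g w = l * (- 12 + 6 * r)" "?g t = l * (- 12 + 6 * r)" "?g x = l * (29 - 5 * r)"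
    using gr[of 1] gr[of 2] gr[of 3] gr[of 4] gr[of 5] by (simp_all add: grad_poly_gradp v)
  \<comment> \<open>The scaling under which the hyperplane equation gives w + t without
    denominators.\<close>
  define a b where "a = (y + z) / 27" and "b = x / 54"
  have ab: "y + z = 27 * a" "x = 54 * b" by (simp_all add: a_def b_def)
  have H': "(- 4 - 2 * r) * y + (- 4 - 2 * r) * z + (- 12 + 6 * r) * w + (- 12 + 6 * r) * t + (29 - 5 * r) * x = 0"
    using H by (simp add: hyperplane_def sum_5 v)
  \<comment> \<open>This is the hyperplane equation; r - 2 is nonzero by its norm, so w + t is
    determined.\<close>
  have "6 * (r - 2) * (w + t - ((17 + 4 * r) * a - (19 * r - 7) * b))
    = ((- 4 - 2 * r) * (27 * a) + (- 12 + 6 * r) * (w + t) + (29 - 5 * r) * (54 * b)) - (24 * a - 114 * b) * (r ^ 2 - 13)"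
    by algebra
  also have "\<dots> = 0" using H' unfolding ab[symmetric] r2 by (simp add: algebra_simps)
  finally have "6 * (r - 2) = 0 \<or> w + t - ((17 + 4 * r) * a - (19 * r - 7) * b) = 0"
    by (simp only: mult_eq_0_iff)
  then have wt: "w + t = (17 + 4 * r) * a - (19 * r - 7) * b"
    using quadratic_nonzero[OF r2, of "r - 2" "- 2" 1] by auto
  consider "y = z" "w = t" | "y \<noteq> z" "w = t" | "y = z" "w \<noteq> t" | "y \<noteq> z" "w \<noteq> t" by blast
  then show ?thesis
  proof cases
    case 1
    have e: "el1 v = x + 2 * y + 2 * w" "el2 v = y ^ 2 + w ^ 2 + 2 * x * (y + w) + 4 * y * w"
      "el3 v = x * (y ^ 2 + w ^ 2 + 4 * y * w) + 2 * y ^ 2 * w + 2 * w ^ 2 * y" "el4 v = y ^ 2 * w ^ 2 + 2 * x * (y ^ 2 * w + w ^ 2 * y)"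
      unfolding v el_defs vector_5 1[symmetric] by algebra+
    have "w = ((17 + 4 * r) * a - (19 * r - 7) * b) / 2" using wt 1 by (simp add: mult.commute[of _ 2])
    then have p: "y = 27 * (a / 2)" "x = 108 * (b / 2)" "w = (17 + 4 * r) * (a / 2) - (19 * r - 7) * (b / 2)"
      using ab 1 by (simp_all add: diff_divide_distrib mult.commute[of _ 2])
    have c: "(13 - r) * y - (9 + 3 * r) * w = 0"
      by (rule tangency_A3_equal[OF p r2 g(1)[unfolded e] g(3)[unfolded e] g(5)[unfolded e] l])
    have nz: "13 - r \<noteq> 0" "29 - 5 * r \<noteq> 0"
      using quadratic_nonzero[OF r2, of "13 - r" 13 "- 1"] quadratic_nonzero[OF r2, of "29 - 5 * r" 29 "- 5"] by simp_all
    define d where "d = w / (13 - r)"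
    have w: "w = (13 - r) * d" using nz by (simp add: d_def)
    have "(13 - r) * y = (13 - r) * ((9 + 3 * r) * d)" using c unfolding w by algebra
    then have y: "y = (9 + 3 * r) * d" using nz by simp
    have "(29 - 5 * r) * (x - 24 * d) = ((- 4 - 2 * r) * y + (- 4 - 2 * r) * z + (- 12 + 6 * r) * w + (- 12 + 6 * r) * t + (29 - 5 * r) * x)
      + 24 * d * (r ^ 2 - 13)"
      unfolding 1[symmetric] y w by algebra
    then have x: "x = 24 * d" using H' r2 nz by simp
    have "v = d *s vector [9 + 3 * r, 9 + 3 * r, 13 - r, 13 - r, 24]"
      unfolding v 1[symmetric] x y w by (simp add: vec_eq_iff forall_5)
    then show ?thesis using span_eq_span_multiple v0 by blast
  next
    case 2
    have e: "el1 v = x + (y + z) + 2 * w" "el2 v = y * z + w ^ 2 + x * ((y + z) + 2 * w) + 2 * (y + z) * w"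
      "el3 v = x * (y * z + w ^ 2 + 2 * (y + z) * w) + 2 * (y * z) * w + w ^ 2 * (y + z)" "el4 v = (y * z) * w ^ 2 + x * (2 * (y * z) * w + w ^ 2 * (y + z))"
      unfolding v el_defs vector_5 2(2)[symmetric] by algebra+
    have "w = ((17 + 4 * r) * a - (19 * r - 7) * b) / 2" using wt 2 by (simp add: mult.commute[of _ 2])
    then have p: "y + z = 54 * (a / 2)" "x = 108 * (b / 2)" "w = (17 + 4 * r) * (a / 2) - (19 * r - 7) * (b / 2)"
      using ab 2 by (simp_all add: diff_divide_distrib)
    have "(y + z) ^ 2 - 4 * (y * z) = 0"
      by (rule tangency_A3_distinct_equal[OF p r2 gradp_two_roots[OF g(1,2) 2(1), unfolded e] g(3)[unfolded e] g(5)[unfolded e] l])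
    moreover have "(y + z) ^ 2 - 4 * (y * z) = (y - z) ^ 2" by algebra
    ultimately show ?thesis using 2 by simp
  next
    case 3
    have e: "el1 v = x + (w + t) + 2 * y" "el2 v = w * t + y ^ 2 + x * ((w + t) + 2 * y) + 2 * (w + t) * y"
      "el3 v = x * (w * t + y ^ 2 + 2 * (w + t) * y) + 2 * (w * t) * y + y ^ 2 * (w + t)" "el4 v = (w * t) * y ^ 2 + x * (2 * (w * t) * y + y ^ 2 * (w + t))"
      unfolding v el_defs vector_5 3(1)[symmetric] by algebra+
    have p: "y = 27 * (a / 2)" "x = 54 * b" "w + t = 2 * ((17 + 4 * r) * (a / 2)) - (19 * r - 7) * b"
      using ab wt 3 by (simp_all add: mult.commute[of _ 2])
    note c = tangency_A3_equal_distinct[OF p r2 gradp_two_roots[OF g(3,4) 3(2), unfolded e] g(1)[unfolded e] g(5)[unfolded e] l]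
    have "(w - t) ^ 2 = (w + t) ^ 2 - 4 * (w * t)" by algebra
    then show ?thesis using 3 c by simp
  next
    case 4
    have e: "el1 v = x + (y + z) + (w + t)" "el2 v = y * z + w * t + x * ((y + z) + (w + t)) + (y + z) * (w + t)"
      "el3 v = x * (y * z + w * t + (y + z) * (w + t)) + (y * z) * (w + t) + (w * t) * (y + z)"
      "el4 v = (y * z) * (w * t) + x * ((y * z) * (w + t) + (w * t) * (y + z))"
      unfolding v el_defs vector_5 by algebra+
    note two = gradp_two_roots[OF g(1,2) 4(1), unfolded e] gradp_two_roots[OF g(3,4) 4(2), unfolded e]
    note c = tangency_A3_distinct[OF ab wt r2 two(1) two(3) two(2) two(4) g(5)[unfolded e] l]
    have "(y - z) ^ 2 = (y + z) ^ 2 - 4 * (y * z)" by algebra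
    then show ?thesis using 4 c by simp
  qed
qed

lemma tangent_points_D4:
  fixes r k :: complex
  assumes r2: "r ^ 2 = 13" and k2: "k ^ 2 = - 3"
    and H: "v \<in> hyperplane (vector [12, 12, 12, (- 45 + 9 * r) + k * (17 - 5 * r), (- 45 + 9 * r) - k * (17 - 5 * r)])"
    and v0: "v \<noteq> 0" and l: "l \<noteq> 0"
    and gr: "\<And>i. grad_poly v (v $ i)
      = l * (vector [12, 12, 12, (- 45 + 9 * r) + k * (17 - 5 * r), (- 45 + 9 * r) - k * (17 - 5 * r)] :: complex^5) $ i"
  shows "vec.span {v} = vec.span {vector [6, 6, 6, (1 + 2 * r) + k * (2 - r), (1 + 2 * r) - k * (2 - r)]}"
proof -
  have k: "k \<noteq> 0" using k2 by auto
  obtain x y z u w where v: "v = vector [x, y, z, u + k * w, u - k * w]"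
  proof
    show "v = vector [v $ 1, v $ 2, v $ 3, (v $ 4 + v $ 5) / 2 + k * ((v $ 4 - v $ 5) / (2 * k)), (v $ 4 + v $ 5) / 2 - k * ((v $ 4 - v $ 5) / (2 * k))]"
      using k by (simp add: vec_eq_iff forall_5 field_simps)
  qed
  let ?g = "gradp (el1 v) (el2 v) (el3 v) (el4 v)"
  have g: "?g x = l * 12" "?g y = l * 12" "?g z = l * 12" "?g (u + k * w) = l * ((- 45 + 9 * r) + k * (17 - 5 * r))"
      "?g (u - k * w) = l * ((- 45 + 9 * r) - k * (17 - 5 * r))"
    using gr[of 1] gr[of 2] gr[of 3] gr[of 4] gr[of 5] by (simp_all add: grad_poly_gradp v)
  note tw = gradp_conjugate_roots[OF g(4,5) k, unfolded k2]
  have "12 * x + 12 * y + 12 * z + ((- 45 + 9 * r) + k * (17 - 5 * r)) * (u + k * w) + ((- 45 + 9 * r) - k * (17 - 5 * r)) * (u - k * w) = 0"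
    using H by (simp add: hyperplane_def sum_5 v)
  moreover have "((- 45 + 9 * r) + k * (17 - 5 * r)) * (u + k * w) + ((- 45 + 9 * r) - k * (17 - 5 * r)) * (u - k * w)
    = 2 * (- 45 + 9 * r) * u + 2 * k ^ 2 * ((17 - 5 * r) * w)" by algebra
  ultimately have "12 * (x + y + z) = 12 * ((15 - 3 * r) * (u / 2) + (17 - 5 * r) * (w / 2))" unfolding k2 by algebra
  then have S: "x + y + z = (15 - 3 * r) * (u / 2) + (17 - 5 * r) * (w / 2)" by (simp only: mult_cancel_left) simp
  have u2: "u = 2 * (u / 2)" and w2: "w = 2 * (w / 2)" by simp_all
  \<comment> \<open>Rules out that exactly two of x, y, z coincide; the symmetric functions are
    passed as hypotheses so that all three placements of the odd one out are covered.\<close>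
  have two: False if ne: "p \<noteq> s" and ps: "?g p = l * 12" "?g s = l * 12"
    and sum: "x + y + z = 2 * p + s" "x * y + x * z + y * z = p ^ 2 + 2 * p * s" "x * y * z = p ^ 2 * s" for p s
  proof -
    have "el1 v = (x + y + z) + 2 * u" "el2 v = (x * y + x * z + y * z) + (u ^ 2 - k ^ 2 * w ^ 2) + 2 * u * (x + y + z)"
      "el3 v = x * y * z + 2 * u * (x * y + x * z + y * z) + (x + y + z) * (u ^ 2 - k ^ 2 * w ^ 2)"
      "el4 v = 2 * u * (x * y * z) + (x * y + x * z + y * z) * (u ^ 2 - k ^ 2 * w ^ 2)"
      unfolding v el_defs vector_5 by algebra+
    then have e: "el1 v = 2 * p + s + 2 * u" "el2 v = p ^ 2 + 2 * p * s + (u ^ 2 + 3 * w ^ 2) + 2 * u * (2 * p + s)"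
      "el3 v = p ^ 2 * s + 2 * u * (p ^ 2 + 2 * p * s) + (2 * p + s) * (u ^ 2 + 3 * w ^ 2)"
      "el4 v = 2 * u * p ^ 2 * s + (p ^ 2 + 2 * p * s) * (u ^ 2 + 3 * w ^ 2)"
      unfolding sum k2 by (simp_all add: mult.assoc)
    have s: "s = (15 - 3 * r) * (u / 2) + (17 - 5 * r) * (w / 2) - 2 * p" unfolding S[symmetric] sum(1) by simp
    have "p - s = 0"
      by (rule tangency_D4_two_equal[OF u2 w2 s r2 gradp_two_roots(1)[OF ps ne, unfolded e] ps(1)[unfolded e] tw[unfolded e] l])
    then show False using ne by simp
  qed
  have eq: "x = y" if "x = z \<or> y = z"
    using that two[of z y] two[of z x] g by (auto simp: power2_eq_square algebra_simps)
  have eq': "x = z" if "x = y"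
    using that two[of x z] g by (auto simp: power2_eq_square algebra_simps)
  show ?thesis
  proof (cases "x = y")
    case True
    then have yz: "y = x" "z = x" using eq' by auto
    have "el1 v = 3 * x + 2 * u" "el2 v = 3 * x ^ 2 + (u ^ 2 - k ^ 2 * w ^ 2) + 6 * x * u"
      "el3 v = x ^ 3 + 6 * x ^ 2 * u + 3 * x * (u ^ 2 - k ^ 2 * w ^ 2)" "el4 v = 2 * x ^ 3 * u + 3 * x ^ 2 * (u ^ 2 - k ^ 2 * w ^ 2)"
      unfolding v el_defs vector_5 yz by algebra+
    then have e: "el1 v = 3 * x + 2 * u" "el2 v = 3 * x ^ 2 + (u ^ 2 + 3 * w ^ 2) + 6 * x * u"
      "el3 v = x ^ 3 + 6 * x ^ 2 * u + 3 * x * (u ^ 2 + 3 * w ^ 2)" "el4 v = 2 * x ^ 3 * u + 3 * x ^ 2 * (u ^ 2 + 3 * w ^ 2)"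
      unfolding k2 by simp_all
    have u6: "u = 6 * (u / 6)" and w6: "w = 6 * (w / 6)" by simp_all
    have "3 * x = 3 * ((15 - 3 * r) * (u / 6) + (17 - 5 * r) * (w / 6))" using S yz by (simp add: algebra_simps)
    then have x: "x = (15 - 3 * r) * (u / 6) + (17 - 5 * r) * (w / 6)" by (simp only: mult_cancel_left) simp
    have c: "(2 - r) * u - (1 + 2 * r) * w = 0"
      by (rule tangency_D4_equal[OF u6 w6 x r2 g(1)[unfolded e] tw[unfolded e] l])
    have nz: "1 + 2 * r \<noteq> 0" using quadratic_nonzero[OF r2, of "1 + 2 * r" 1 2] by simp
    define d where "d = u / (1 + 2 * r)"
    have u: "u = (1 + 2 * r) * d" using nz by (simp add: d_def)
    have "(1 + 2 * r) * w = (1 + 2 * r) * ((2 - r) * d)" using c unfolding u by algebra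
    then have w: "w = (2 - r) * d" using nz by simp
    have "6 * x = 36 * d - d * (r ^ 2 - 13)" unfolding x u w by algebra
    then have x6: "x = 6 * d" using r2 by simp
    have "v = d *s vector [6, 6, 6, (1 + 2 * r) + k * (2 - r), (1 + 2 * r) - k * (2 - r)]"
      unfolding v yz x6 u w by (simp add: vec_eq_iff forall_5 algebra_simps)
    then show ?thesis using span_eq_span_multiple v0 by blast
  next
    case False
    then have ne: "x \<noteq> y" "x \<noteq> z" "y \<noteq> z" using eq by auto
    have "el1 v = (x + y + z) + 2 * u" "el2 v = (x * y + x * z + y * z) + (u ^ 2 - k ^ 2 * w ^ 2) + 2 * u * (x + y + z)"
      "el3 v = x * y * z + 2 * u * (x * y + x * z + y * z) + (x + y + z) * (u ^ 2 - k ^ 2 * w ^ 2)"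
      "el4 v = 2 * u * (x * y * z) + (x * y + x * z + y * z) * (u ^ 2 - k ^ 2 * w ^ 2)"
      unfolding v el_defs vector_5 by algebra+
    then have e: "el1 v = (x + y + z) + 2 * u" "el2 v = (x * y + x * z + y * z) + (u ^ 2 + 3 * w ^ 2) + 2 * u * (x + y + z)"
      "el3 v = x * y * z + 2 * u * (x * y + x * z + y * z) + (x + y + z) * (u ^ 2 + 3 * w ^ 2)"
      "el4 v = 2 * u * (x * y * z) + (x * y + x * z + y * z) * (u ^ 2 + 3 * w ^ 2)"
      unfolding k2 by simp_all
    note three = gradp_three_roots[OF g(1,2,3) ne]
    note c = tangency_D4_distinct[OF u2 w2 S r2 three[unfolded e] tw[unfolded e] l]
    have S0: "x + y + z = 0" unfolding S using c by simp
    \<comment> \<open>With u = w = 0 the symmetric functions of v are those of x, y, z alone, and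
      the remainder conditions force all of them to vanish.\<close>
    have "quad3 (el1 v) (el2 v) 0 (x * y + x * z + y * z) = - 64 * (x * y + x * z + y * z)"
      unfolding e c S0 quad3_def by simp
    then have "- 64 * (x * y + x * z + y * z) = 0" using three(1) S0 by simp
    then have m0: "x * y + x * z + y * z = 0" by (simp only: mult_eq_0_iff) simp
    have "lin3 (el1 v) (el2 v) (el3 v) 0 0 (x * y * z) = 64 * (x * y * z)"
      unfolding e c S0 m0 lin3_def by simp
    then have n0: "x * y * z = 0" using three(2) S0 m0 by simp
    \<comment> \<open>So x and y are roots of T^3, hence both 0, contradicting that they are
      distinct.\<close>
    have "T ^ 3 = (T - x) * (T - y) * (T - z) + (x + y + z) * T ^ 2 - (x * y + x * z + y * z) * T + x * y * z" for T
      by algebra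
    from this[of x] this[of y] have "x ^ 3 = 0" "y ^ 3 = 0" unfolding S0 m0 n0 by simp_all
    then show ?thesis using ne by simp
  qed
qed

section \<open>The four sections\<close>

lemma section_17A2:
  defines "a \<equiv> vector [3, - 13, - 13, 7, 7] :: complex^5"
  shows "tangent_hyperplane quintic (hyperplane a)" "has_singular_set quintic (hyperplane a) (replicate_mset 17 (Type_A 2))"
proof -
  let ?e = "vector [0, 2, - 2, 1, - 1] :: complex^5" and ?e' = "vector [0, 2, - 2, - 1, 1] :: complex^5"
  have H: "e \<in> hyperplane a" if "e \<in> {?e, ?e'}" for e
    using that by (auto simp: hyperplane_def sum_5 a_def)
  \<comment> \<open>At both points e1 = e3 = 0, e2 = -5 and e4 = 4, so the quartic is 128 T^4 - 320
    T^2 - 144, with values -144, 624, -336 at 0, 2 or -2, and 1 or -1.\<close>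
  have gr: "grad_poly e (e $ i) = (- 48) * a $ i" if "e \<in> {?e, ?e'}" for e i
    using that exhaust_5[of i] by (auto simp: grad_poly_def el_defs a_def)
  have type: "has_sing_type quintic (hyperplane a) (vec.span {e}) (Type_A 2)" if "e \<in> {?e, ?e'}" for e
  proof -
    \<comment> \<open>Exchanging the last two coordinates fixes the hyperplane and swaps the two
      points, so one local computation serves both.\<close>
    have "permute_coords (Transposition.transpose 4 5) a = a" "permute_coords (Transposition.transpose 4 5) ?e = ?e'"
      by (simp_all add: permute_coords_def vec_eq_iff forall_5 a_def Transposition.transpose_def)
    with has_sing_type_permute_coords[OF bij_transpose has_sing_type_17A2, of 4 5]
    have "has_sing_type quintic (hyperplane a) (vec.span {?e'}) (Type_A 2)" by (simp add: a_def)
    then show ?thesis using that has_sing_type_17A2 by (auto simp: a_def)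
  qed
  have "vec.span {?e} \<noteq> vec.span {?e'}"
  proof
    assume "vec.span {?e} = vec.span {?e'}"
    then have "?e \<in> vec.span {?e'}" using vec.span_base[of ?e "{?e}"] by simp
    then obtain c where "?e = c *s ?e'" by (auto simp: vec.span_singleton)
    then have "2 = c * 2" "1 = - c" by (simp_all add: vec_eq_iff forall_5)
    then show False by simp
  qed
  then have inj: "inj_on (\<lambda>e. vec.span {e}) {?e, ?e'}" by auto
  have "?e \<noteq> ?e'" by (simp add: vec_eq_iff forall_5)
  then have card: "card {?e, ?e'} = 2" by simp
  have tr: "transversal_to_cusp_lines a" unfolding a_def by (rule transversal_17A2)
  show "tangent_hyperplane quintic (hyperplane a)"
    by (rule tangent_hyperplaneI[OF tr H gr]) auto
  have "has_singular_set quintic (hyperplane a) (replicate_mset 15 (Type_A 2) + replicate_mset (card {?e, ?e'}) (Type_A 2))"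
    using tangent_points_17A2 by (intro has_singular_setI[OF tr _ inj H gr _ type]) (auto simp: a_def)
  moreover have "replicate_mset 15 (Type_A 2) + replicate_mset 2 (Type_A 2) = replicate_mset 17 (Type_A 2)"
    by (simp add: numeral_eq_Suc)
  ultimately show "has_singular_set quintic (hyperplane a) (replicate_mset 17 (Type_A 2))"
    unfolding card by simp
qed

lemma section_with_one_extra_point:
  assumes tr: "transversal_to_cusp_lines a" and e: "e \<in> hyperplane a" "\<And>i. grad_poly e (e $ i) = l * a $ i" "l \<noteq> 0"
    and type: "has_sing_type quintic (hyperplane a) (vec.span {e}) T"
    and tangent: "\<And>v m. v \<in> hyperplane a \<Longrightarrow> v \<noteq> 0 \<Longrightarrow> m \<noteq> 0 \<Longrightarrow> (\<And>i. grad_poly v (v $ i) = m * a $ i)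
       \<Longrightarrow> vec.span {v} = vec.span {e}"
  shows "\<exists>H. tangent_hyperplane quintic H \<and> has_singular_set quintic H (replicate_mset 15 (Type_A 2) + {#T#})"
proof -
  have "has_singular_set quintic (hyperplane a) (replicate_mset 15 (Type_A 2) + replicate_mset (card {e}) T)"
    using e type tangent by (intro has_singular_setI[OF tr, where l = l]) auto
  then show ?thesis using tangent_hyperplaneI[OF tr e] by auto
qed

theorem mainTheorem4:
  shows "(\<exists>H. tangent_hyperplane quintic H \<and>
            has_singular_set quintic H (replicate_mset 17 (Type_A 2))) \<and>
         (\<exists>H. tangent_hyperplane quintic H \<and>
            has_singular_set quintic H (replicate_mset 16 (Type_A 2))) \<and>
         (\<exists>H. tangent_hyperplane quintic H \<and>
            has_singular_set quintic H (replicate_mset 15 (Type_A 2) + {#Type_A 3#})) \<and>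
         (\<exists>H. tangent_hyperplane quintic H \<and>
            has_singular_set quintic H (replicate_mset 15 (Type_A 2) + {#Type_D 4#})) \<and>
         has_singular_set quintic (hyperplane (vector [3, -13, -13, 7, 7]))
           (replicate_mset 17 (Type_A 2))"
proof (intro conjI)
  show "\<exists>H. tangent_hyperplane quintic H \<and> has_singular_set quintic H (replicate_mset 17 (Type_A 2))"
    using section_17A2 by blast
  show "has_singular_set quintic (hyperplane (vector [3, -13, -13, 7, 7])) (replicate_mset 17 (Type_A 2))"
    by (rule section_17A2(2))
  define q where "q = complex_of_real (sqrt 3)"
  define r where "r = complex_of_real (sqrt 13)"
  \<comment> \<open>A square root of -3, as required for the D_4 section.\<close>
  define k where "k = \<i> * q"
  have q: "q ^ 2 = 3" and r: "r ^ 2 = 13"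
    unfolding q_def r_def of_real_power[symmetric] by simp_all
  then have k: "k ^ 2 = - 3" by (simp add: k_def power_mult_distrib)
  \<comment> \<open>The single extra point is itself an A_2, which makes 16 in total.\<close>
  have "\<exists>H. tangent_hyperplane quintic H \<and> has_singular_set quintic H (replicate_mset 15 (Type_A 2) + {#Type_A 2#})"
  proof (rule section_with_one_extra_point[OF transversal_16A2[OF q] _ grad_poly_16A2[OF q] _ has_sing_type_16A2[OF q]])
    have *: "- 8 * 9 + - 8 * 9 + 1 * 0 + (6 + 3 * q) * (6 + 4 * q) + (6 - 3 * q) * (6 - 4 * q) = 24 * (q ^ 2 - 3)" by algebra
    show "vector [9, 9, 0, 6 + 4 * q, 6 - 4 * q] \<in> hyperplane (vector [- 8, - 8, 1, 6 + 3 * q, 6 - 3 * q] :: complex^5)"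
      unfolding hyperplane_def mem_Collect_eq sum_5 vector_5 using * q by simp
  qed (use tangent_points_16A2[OF q] in auto)
  then show "\<exists>H. tangent_hyperplane quintic H \<and> has_singular_set quintic H (replicate_mset 16 (Type_A 2))"
    by (simp add: numeral_eq_Suc)
  show "\<exists>H. tangent_hyperplane quintic H \<and> has_singular_set quintic H (replicate_mset 15 (Type_A 2) + {#Type_A 3#})"
  proof (rule section_with_one_extra_point[OF transversal_A3[OF r] _ grad_poly_A3[OF r] _ has_sing_type_A3[OF r]])
    have *: "(- 4 - 2 * r) * (9 + 3 * r) + (- 4 - 2 * r) * (9 + 3 * r) + (- 12 + 6 * r) * (13 - r) + (- 12 + 6 * r) * (13 - r) + (29 - 5 * r) * 24
      = - 24 * (r ^ 2 - 13)" by algebra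
    show "vector [9 + 3 * r, 9 + 3 * r, 13 - r, 13 - r, 24] \<in> hyperplane (vector [- 4 - 2 * r, - 4 - 2 * r, - 12 + 6 * r, - 12 + 6 * r, 29 - 5 * r] :: complex^5)"
      unfolding hyperplane_def mem_Collect_eq sum_5 vector_5 using * r by simp
  qed (use tangent_points_A3[OF r] in auto)
  show "\<exists>H. tangent_hyperplane quintic H \<and> has_singular_set quintic H (replicate_mset 15 (Type_A 2) + {#Type_D 4#})"
  proof (rule section_with_one_extra_point[OF transversal_D4[OF r k] _ grad_poly_D4[OF r k] _ has_sing_type_D4[OF r k]])
    have *: "((- 45 + 9 * r) + k * (17 - 5 * r)) * ((1 + 2 * r) + k * (2 - r)) + ((- 45 + 9 * r) - k * (17 - 5 * r)) * ((1 + 2 * r) - k * (2 - r))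
      = - 216 + 36 * (r ^ 2 - 13) + 2 * (17 - 5 * r) * (2 - r) * (k ^ 2 + 3) - 30 * (r ^ 2 - 13)" by algebra
    show "vector [6, 6, 6, (1 + 2 * r) + k * (2 - r), (1 + 2 * r) - k * (2 - r)]
      \<in> hyperplane (vector [12, 12, 12, (- 45 + 9 * r) + k * (17 - 5 * r), (- 45 + 9 * r) - k * (17 - 5 * r)] :: complex^5)"
      unfolding hyperplane_def mem_Collect_eq sum_5 vector_5 using * r k by (simp add: add.assoc)
    show "1536 * (5 - r) \<noteq> 0" using quadratic_nonzero[OF r, of "5 - r" 5 "- 1"] by simp
  qed (use tangent_points_D4[OF r k] in auto)
qed

end
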